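(* Let $n\ge1$ and put $A=(\zeta+1)^2p_{n-1}(\zeta)$, $B=\zeta^{n+1}\tilde p_n(\zeta)$, $C=(1+2\zeta)^{1+\chi(n\text{ even})}\big(1+\tfrac\zeta2\big)^{1+\chi(n\text{ odd})}p_n(\zeta)^2$, where $\chi(\text{true})=1,\chi(\text{false})=0$. Then the polynomial equation $AX-BY=C$ has a solution $(X,Y)$ in polynomials in $\zeta$ with $X=p_{n+1}$ and $\deg Y=\deg A$.
   Context: Let $\zeta$ be an indeterminate. Define $F(x,y,z)=(\zeta+2)xyz-\zeta(xy+yz+xz+x+y+z)+\zeta(2\zeta+1)$ and $G(x,y)=(\zeta+2)xy(x+y)-\zeta(x^2+y^2)-2(\zeta^2+3\zeta+1)xy+\zeta(2\zeta+1)(x+y)$. For $n\ge 0$ let $$S_n(x_1,\dots,x_n,y_1,\dots,y_n,z)=\frac{\prod_{i,j=1}^nG(x_i,y_j)}{\prod_{1\le i<j\le n}(x_j-x_i)(y_j-y_i)}\det_{1\le i,j\le n}\left(\frac{F(x_i,y_j,z)}{G(x_i,y_j)}\right)$$ ($S_0=1$); it is a polynomial in all variables and $\zeta$, symmetric in its $2n+1$ variables. Let $\delta_k=\lfloor k^2/4\rfloor$. For $n\ge0$ define $$p_n(\zeta)=\frac{(1+\frac\zeta2)^{n^2}\,S_n\big(\underbrace{2\zeta+1,\dots,2\zeta+1}_{n+1},\underbrace{\tfrac{\zeta}{\zeta+2},\dots,\tfrac{\zeta}{\zeta+2}}_{n}\big)}{(-1)^{\binom{n+1}2}\zeta^{n^2}(1+\zeta)^{n^2}(1+2\zeta)^{\delta_n}(1+\frac\zeta2)^{\delta_{n-1}}},$$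 and $p_{-1}=1$; these are polynomials in $\zeta$. Put $\tilde p_n(\zeta)=\zeta^{n(n+1)/2}p_n(1/\zeta)$. *)

theory Defs
  imports
    "HOL-Library.Poly_Mapping"
    "HOL-Computational_Algebra.Polynomial_Factorial"
    "Jordan_Normal_Form.Determinant"
begin

text \<open>The inverse of the embedding of an integral domain into its field of fractions;
  only meaningful on fractions that lie in the domain.\<close>

definition of_fract :: "'a::idom fract \<Rightarrow> 'a" where
  "of_fract r = (THE a. to_fract a = r)"

lemma of_fract_to_fract [simp]: "of_fract (to_fract a) = a"
  by (simp add: of_fract_def)

definition F :: "'a::comm_ring_1 \<Rightarrow> 'a \<Rightarrow> 'a \<Rightarrow> 'a \<Rightarrow> 'a" where
  "F \<zeta> x y z =
     (\<zeta> + 2) * x * y * z - \<zeta> * (x * y + y * z + x * z + x + y + z) + \<zeta> * (2 * \<zeta> + 1)"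

definition G :: "'a::comm_ring_1 \<Rightarrow> 'a \<Rightarrow> 'a \<Rightarrow> 'a" where
  "G \<zeta> x y =
     (\<zeta> + 2) * x * y * (x + y) - \<zeta> * (x\<^sup>2 + y\<^sup>2) - 2 * (\<zeta>\<^sup>2 + 3 * \<zeta> + 1) * x * y
       + \<zeta> * (2 * \<zeta> + 1) * (x + y)"

text \<open>Polynomials in variables indexed by the natural numbers, with coefficients in
  \<open>\<rat>[\<zeta>]\<close>; an element of \<^typ>\<open>nat \<Rightarrow>\<^sub>0 nat\<close> is the exponent vector of a monomial.\<close>

type_synonym mpoly = "(nat \<Rightarrow>\<^sub>0 nat) \<Rightarrow>\<^sub>0 rat poly"

definition mconst :: "rat poly \<Rightarrow> mpoly" where
  "mconst c = Poly_Mapping.single 0 c"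

definition mvar :: "nat \<Rightarrow> mpoly" where
  "mvar i = Poly_Mapping.single (Poly_Mapping.single i 1) 1"

definition meval :: "(nat \<Rightarrow> rat poly fract) \<Rightarrow> mpoly \<Rightarrow> rat poly fract" where
  "meval v P = (\<Sum>m\<in>Poly_Mapping.keys P. to_fract (Poly_Mapping.lookup P m) *
     (\<Prod>i\<in>Poly_Mapping.keys m. v i ^ Poly_Mapping.lookup m i))"

text \<open>The variables \<open>x\<^sub>1,\<dots>,x\<^sub>n,y\<^sub>1,\<dots>,y\<^sub>n,z\<close> are the variables number \<open>0,\<dots>,2n\<close>, in this order.\<close>

definition S_fract :: "nat \<Rightarrow> mpoly fract" where
  "S_fract n =
     (let \<zeta> = to_fract (mconst [:0, 1:]);
          x = (\<lambda>i. to_fract (mvar i));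
          y = (\<lambda>j. to_fract (mvar (n + j)));
          z = to_fract (mvar (2 * n))
      in (\<Prod>i<n. \<Prod>j<n. G \<zeta> (x i) (y j)) /
         (\<Prod>j<n. \<Prod>i<j. (x j - x i) * (y j - y i)) *
         det (mat n n (\<lambda>(i, j). F \<zeta> (x i) (y j) z / G \<zeta> (x i) (y j))))"

definition S :: "nat \<Rightarrow> mpoly" where
  "S n = of_fract (S_fract n)"

definition \<delta> :: "int \<Rightarrow> nat" where
  "\<delta> k = nat (k\<^sup>2 div 4)"

definition p_fract :: "nat \<Rightarrow> rat poly fract" where
  "p_fract n =
     (let \<zeta> = to_fract [:0, 1:]
      in (1 + \<zeta> / 2) ^ n\<^sup>2 *
           meval (\<lambda>k. if k < n + 1 then 2 * \<zeta> + 1 else \<zeta> / (\<zeta> + 2)) (S n) /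
         ((-1) ^ ((n + 1) choose 2) * \<zeta> ^ n\<^sup>2 * (1 + \<zeta>) ^ n\<^sup>2 *
           (1 + 2 * \<zeta>) ^ \<delta> (int n) * (1 + \<zeta> / 2) ^ \<delta> (int n - 1)))"

definition p :: "nat \<Rightarrow> rat poly" where
  "p n = of_fract (p_fract n)"

definition p_tilde :: "nat \<Rightarrow> rat poly" where
  "p_tilde n =
     (let \<zeta> = to_fract [:0, 1:]
      in of_fract (\<zeta> ^ (n * (n + 1) div 2) *
           poly (map_poly (\<lambda>c. to_fract [:c:]) (p n)) (1 / \<zeta>)))"

end

theory Submission
  imports Defs "Jordan_Normal_Form.Char_Poly" "HOL-Computational_Algebra.Formal_Laurent_Series"
begin

text \<open>
  Put \<open>\<phi> = t\<^sup>2(t - 2\<zeta> - 1)\<close>, \<open>\<psi> = (\<zeta> + 2)t - \<zeta>\<close>, \<open>\<chi> = t\<^sup>2 + t\<close>. Then \<open>(x - y) G(x,y)\<close> and \<open>F(x,y,z)\<close>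
  times a Vandermonde product are the alternants of \<open>\<phi>, \<psi>\<close> and of \<open>\<phi>, \<psi>, \<chi>\<close>. By Cauchy-type column
  operations \<open>S\<^sub>n\<close> becomes, up to sign, the determinant of the remainders of
  \<open>\<phi>\<^sup>j\<psi>\<^sup>n\<^sup>-\<^sup>j\<close> (\<open>0 \<le> j \<le> n\<close>) and \<open>\<chi>\<phi>\<^sup>k\<psi>\<^sup>n\<^sup>-\<^sup>1\<^sup>-\<^sup>k\<close> (\<open>0 \<le> k < n\<close>) modulo \<open>\<Prod>(t - t\<^sub>i)\<close>, where \<open>t\<^sub>i\<close> are the
  \<open>2n + 1\<close> variables: a symmetric polynomial that also makes sense for coinciding variables.

  Let \<open>\<xi>\<^sub>0 = 2\<zeta> + 1\<close> and \<open>\<xi>\<^sub>1 = \<zeta>/(\<zeta> + 2)\<close> be the non-trivial zeros of \<open>\<phi>\<close> and \<open>\<psi>\<close>, and \<open>S\<^sub>n(a)\<close> the value of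
  \<open>S\<^sub>n\<close> at \<open>a\<close> copies of \<open>\<xi>\<^sub>0\<close> and \<open>2n + 1 - a\<close> copies of \<open>\<xi>\<^sub>1\<close>. The Desnanot-Jacobi identity gives
  \<open>(\<xi>\<^sub>1 - \<xi>\<^sub>0)\<^sup>2 S\<^sub>n\<^sub>+\<^sub>1(n+2) S\<^sub>n\<^sub>-\<^sub>1(n) = G(\<xi>\<^sub>0,\<xi>\<^sub>1)\<^sup>2 S\<^sub>n(n+2) S\<^sub>n(n) - G(\<xi>\<^sub>0,\<xi>\<^sub>0) G(\<xi>\<^sub>1,\<xi>\<^sub>1) S\<^sub>n(n+1)\<^sup>2\<close>.
  Here \<open>S\<^sub>n(n+1)\<close> is \<open>p\<^sub>n\<close> up to elementary factors; the symmetry \<open>\<zeta> \<mapsto> 1/\<zeta>\<close> exchanges \<open>\<xi>\<^sub>0\<close> with \<open>1/\<xi>\<^sub>1\<close>, so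
  \<open>S\<^sub>n(n)\<close> is the reflected polynomial; and \<open>S\<^sub>n(n+2)\<close> provides \<open>Y\<close>. The elementary factors divide out because
  the orders of vanishing of \<open>S\<^sub>n(a)\<close> at \<open>\<zeta> = 0, -1, -1/2, -2\<close> can be read off from Taylor expansions of the
  determinant. The expansion at \<open>0\<close> also yields the leading coefficient of \<open>p\<^sub>n\<close>, essentially a binomial
  coefficient of \<open>-1/2\<close>; the leading terms of \<open>A X\<close> and \<open>C\<close> then have equal degree but do not cancel,
  which determines the degree of \<open>Y\<close>.
\<close>

section \<open>Determinants of remainders modulo a monic polynomial\<close>

text \<open>The formula for \<open>S\<close> divides by Vandermonde products, so it says nothing
  directly at the repeated arguments that \<open>p\<close> requires; yet the quadratic identity
  comes from minors of exactly this formula. Remainder determinants bridge the two: they exist over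
  every commutative ring and commute with homomorphisms, so identities are proved for generic nodes
  and then specialised, after perturbing the nodes by an indeterminate. The same base change lets
  zeta become a power series around each exceptional point. Elsewhere no pole can occur, so
  regularity at four points suffices for polynomiality. The identity itself stems from the 2 by 2
  corner of a matrix whose inner rows carry \<open>xi0\<close> and whose inner columns carry
  \<open>xi1\<close>, with one corner node of each kind on either side. The degree claim needs a
  strict inequality: the leading coefficients are governed by |binom(-1/2, k)|, whose successive
  ratios (2k+1)/(2k+2) vary with k, so three consecutive ones never form a geometric
  progression.\<close>

definition mrem :: "'a::comm_ring_1 poly \<Rightarrow> 'a poly \<Rightarrow> 'a poly" where
  "mrem u m = (SOME r. (\<exists>q. u = m * q + r) \<and> (\<forall>i\<ge>degree m. coeff r i = 0))"

definition rmat :: "(nat \<Rightarrow> 'a::comm_ring_1 poly) \<Rightarrow> 'a poly \<Rightarrow> 'a mat" where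
  "rmat u m = mat (degree m) (degree m) (\<lambda>(i, j). coeff (mrem (u j) m) i)"

text \<open>For a modulus with distinct roots this is the alternant of the \<open>u j\<close>
  divided by the Vandermonde product of the roots (\<open>det_poly_eval\<close>); division with
  remainder makes it available for multiple roots and zero divisors as well.\<close>

definition rdet :: "(nat \<Rightarrow> 'a::comm_ring_1 poly) \<Rightarrow> 'a poly \<Rightarrow> 'a" where
  "rdet u m = det (rmat u m)"

text \<open>In \<open>mrem\<close> the remainder is described by vanishing coefficients instead of a
  degree bound, so that \<open>m = 1\<close> with remainder zero is no exception. Existence is
  Horner recursion on \<open>u\<close>.\<close>

lemma monic_division_exists:
  fixes u m :: "'a::comm_ring_1 poly"
  assumes "lead_coeff m = 1"
  shows "\<exists>r. (\<exists>q. u = m * q + r) \<and> (\<forall>i\<ge>degree m. coeff r i = 0)"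
proof (induction u)
  case 0
  show ?case by (intro exI[of _ 0] conjI exI[of _ 0]) auto
next
  case (pCons a u)
  then obtain q r where u: "u = m * q + r" and r: "\<And>i. i \<ge> degree m \<Longrightarrow> coeff r i = 0"
    by blast
  \<comment> \<open>Shifting the old remainder creates at most one coefficient too high, the one at
    \<open>degree m\<close>; subtracting \<open>c\<close> times the monic \<open>m\<close> removes
    it.\<close>
  define c where "c = coeff (pCons a r) (degree m)"
  have "pCons a u = m * (pCons 0 q + [:c:]) + (pCons a r - smult c m)"
    by (simp add: u algebra_simps)
  moreover have "coeff (pCons a r - smult c m) i = 0" if "i \<ge> degree m" for i
  proof (cases "i = degree m")
    case True
    then show ?thesis using assms by (simp add: c_def)
  next
    case False
    with that have "i > degree m" by simp
    then show ?thesis using r[of "i - 1"] by (cases i) (auto simp: coeff_eq_0)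
  qed
  ultimately show ?case by blast
qed

lemma monic_division_unique:
  fixes m :: "'a::comm_ring_1 poly"
  assumes "lead_coeff m = 1" and "m * q + r = m * q' + r'"
    and "\<And>i. i \<ge> degree m \<Longrightarrow> coeff r i = 0" and "\<And>i. i \<ge> degree m \<Longrightarrow> coeff r' i = 0"
  shows "r = r'"
proof -
  have *: "m * (q - q') = r' - r"
    using assms(2) by (simp add: algebra_simps)
  \<comment> \<open>Since \<open>m\<close> is monic, the top coefficient of
    \<open>m * (q - q')\<close> is that of \<open>q - q'\<close>, even in the presence of zero
    divisors.\<close>
  have "q - q' = 0"
  proof (rule ccontr)
    assume "q - q' \<noteq> 0"
    then have "lead_coeff (q - q') \<noteq> 0" by (simp only: leading_coeff_0_iff not_False_eq_True)
    then have "coeff (m * (q - q')) (degree m + degree (q - q')) \<noteq> 0"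
      by (simp only: coeff_mult_degree_sum assms(1) mult_1 not_False_eq_True)
    then show False
      using assms(3,4)[of "degree m + degree (q - q')"] by (simp add: *)
  qed
  then show ?thesis using * by simp
qed

lemma mrem_spec:
  fixes m :: "'a::comm_ring_1 poly"
  assumes "lead_coeff m = 1"
  obtains q where "u = m * q + mrem u m" and "\<And>i. i \<ge> degree m \<Longrightarrow> coeff (mrem u m) i = 0"
  using someI_ex[OF monic_division_exists[OF assms, of u]] unfolding mrem_def[symmetric] by blast

lemma mrem_unique:
  fixes m :: "'a::comm_ring_1 poly"
  assumes "lead_coeff m = 1" and "u = m * q + r" and "\<And>i. i \<ge> degree m \<Longrightarrow> coeff r i = 0"
  shows "mrem u m = r"
proof -
  obtain q' where "u = m * q' + mrem u m" and "\<And>i. i \<ge> degree m \<Longrightarrow> coeff (mrem u m) i = 0"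
    using mrem_spec[OF assms(1)] by blast
  then show ?thesis
    using monic_division_unique[OF assms(1), of q' "mrem u m" q r] assms(2,3) by metis
qed

lemma rmat_carrier [simp]: "rmat u m \<in> carrier_mat (degree m) (degree m)"
  by (simp add: rmat_def)

lemma map_poly_hom_monic:
  fixes h :: "'a::comm_ring_1 \<Rightarrow> 'b::comm_ring_1"
  assumes "comm_ring_hom h" and "lead_coeff m = 1"
  shows "degree (map_poly h m) = degree m" and "lead_coeff (map_poly h m) = 1"
proof -
  interpret comm_ring_hom h by fact
  show *: "degree (map_poly h m) = degree m"
    by (rule antisym[OF degree_map_poly_le], rule le_degree) (simp add: assms(2))
  show "lead_coeff (map_poly h m) = 1" using assms(2) by (simp add: *)
qed

lemma mrem_hom:
  fixes h :: "'a::comm_ring_1 \<Rightarrow> 'b::comm_ring_1"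
  assumes "comm_ring_hom h" and "lead_coeff m = 1"
  shows "mrem (map_poly h u) (map_poly h m) = map_poly h (mrem u m)"
proof -
  interpret comm_ring_hom h by fact
  interpret hp: map_poly_comm_ring_hom h ..
  obtain q where q: "u = m * q + mrem u m" and r: "\<And>i. i \<ge> degree m \<Longrightarrow> coeff (mrem u m) i = 0"
    using mrem_spec[OF assms(2)] by blast
  show ?thesis
  proof (rule mrem_unique)
    show "lead_coeff (map_poly h m) = 1" using map_poly_hom_monic[OF assms] by simp
    show "map_poly h u = map_poly h m * map_poly h q + map_poly h (mrem u m)"
      by (subst q) (simp add: hp.hom_mult hp.hom_add)
    show "coeff (map_poly h (mrem u m)) i = 0" if "i \<ge> degree (map_poly h m)" for i
      using that r map_poly_hom_monic[OF assms] by simp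
  qed
qed

text \<open>Every specialisation below rests on this: an identity known for indeterminate or
  perturbed nodes is carried to the actual ones.\<close>

lemma rdet_hom:
  fixes h :: "'a::comm_ring_1 \<Rightarrow> 'b::comm_ring_1"
  assumes "comm_ring_hom h" and "lead_coeff m = 1"
  shows "h (rdet u m) = rdet (\<lambda>j. map_poly h (u j)) (map_poly h m)"
proof -
  interpret comm_ring_hom h by fact
  have "rmat (\<lambda>j. map_poly h (u j)) (map_poly h m) = map_mat h (rmat u m)"
    by (rule eq_matI) (auto simp: rmat_def mrem_hom[OF assms] map_poly_hom_monic[OF assms])
  then show ?thesis by (simp add: rdet_def)
qed

lemma mrem_sum_smult:
  fixes m :: "'a::comm_ring_1 poly"
  assumes "lead_coeff m = 1"
  shows "mrem (\<Sum>i\<in>A. smult (c i) (u i)) m = (\<Sum>i\<in>A. smult (c i) (mrem (u i) m))"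
proof -
  have "\<forall>i. \<exists>q. u i = m * q + mrem (u i) m" using mrem_spec[OF assms] by metis
  then obtain q where q: "\<And>i. u i = m * q i + mrem (u i) m" by metis
  have r: "\<And>i k. k \<ge> degree m \<Longrightarrow> coeff (mrem (u i) m) k = 0" using mrem_spec[OF assms] by metis
  show ?thesis
  proof (rule mrem_unique[OF assms])
    have "(\<Sum>i\<in>A. smult (c i) (u i)) = (\<Sum>i\<in>A. smult (c i) (m * q i + mrem (u i) m))"
      using q by simp
    then show "(\<Sum>i\<in>A. smult (c i) (u i)) =
        m * (\<Sum>i\<in>A. smult (c i) (q i)) + (\<Sum>i\<in>A. smult (c i) (mrem (u i) m))"
      by (simp add: smult_add_right sum.distrib sum_distrib_left)
  qed (simp add: coeff_sum r)
qed

text \<open>Taking remainders is linear, so column operations on the family multiply the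
  determinant. The matrices \<open>B\<close> used later are unitriangular and leave it
  unchanged.\<close>

lemma rdet_linear_combination:
  fixes m :: "'a::comm_ring_1 poly"
  assumes "lead_coeff m = 1" and N: "N = degree m"
    and v: "\<And>j. j < N \<Longrightarrow> v j = (\<Sum>i<N. smult (B i j) (u i))"
  shows "rdet v m = rdet u m * det (mat N N (\<lambda>(i, j). B i j))"
proof -
  have "rmat v m = rmat u m * mat N N (\<lambda>(i, j). B i j)"
  proof (rule eq_matI)
    fix i j assume "i < dim_row (rmat u m * mat N N (\<lambda>(i, j). B i j))"
      "j < dim_col (rmat u m * mat N N (\<lambda>(i, j). B i j))"
    then have ij: "i < N" "j < N" by (auto simp: rmat_def N)
    then show "rmat v m $$ (i, j) = (rmat u m * mat N N (\<lambda>(i, j). B i j)) $$ (i, j)"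
      using v[of j] by (simp add: rmat_def N[symmetric] scalar_prod_def mrem_sum_smult[OF assms(1)]
          coeff_sum lessThan_atLeast0 mult.commute)
  qed (auto simp: rmat_def N)
  then show ?thesis
    unfolding rdet_def using det_mult[of "rmat u m" N "mat N N (\<lambda>(i, j). B i j)"] N by auto
qed

lemma det_upper_triangular_mat:
  assumes "\<And>i j. j < i \<Longrightarrow> i < n \<Longrightarrow> f i j = 0"
  shows "det (mat n n (\<lambda>(i, j). f i j)) = (\<Prod>i<n. f i i :: 'a::comm_ring_1)"
proof -
  have "upper_triangular (mat n n (\<lambda>(i, j). f i j))" using assms by auto
  then have "det (mat n n (\<lambda>(i, j). f i j)) = prod_list (diag_mat (mat n n (\<lambda>(i, j). f i j)))"
    by (rule det_upper_triangular) (rule mat_carrier)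
  then show ?thesis by (simp add: prod_list_diag_prod lessThan_atLeast0)
qed

lemma det_lower_triangular_mat:
  assumes "\<And>i j. i < j \<Longrightarrow> j < n \<Longrightarrow> f i j = 0"
  shows "det (mat n n (\<lambda>(i, j). f i j)) = (\<Prod>i<n. f i i :: 'a::comm_ring_1)"
proof -
  have "det (mat n n (\<lambda>(i, j). f i j)) = prod_list (diag_mat (mat n n (\<lambda>(i, j). f i j)))"
    by (rule det_lower_triangular[OF _ mat_carrier]) (use assms in auto)
  then show ?thesis by (simp add: prod_list_diag_prod lessThan_atLeast0)
qed

lemma mat_mult_fun:
  "mat n n (\<lambda>(i, j). f i j) * mat n n (\<lambda>(i, j). g i j) =
     mat n n (\<lambda>(i, j). \<Sum>k<n. f i k * (g k j :: 'a::comm_ring_1))"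
  by (rule eq_matI) (auto simp: scalar_prod_def lessThan_atLeast0)

lemma det_mat_mult_fun:
  "det (mat n n (\<lambda>(i, j). \<Sum>k<n. f i k * (g k j :: 'a::comm_ring_1))) =
     det (mat n n (\<lambda>(i, j). f i j)) * det (mat n n (\<lambda>(i, j). g i j))"
  unfolding mat_mult_fun[symmetric] by (rule det_mult) auto

lemma poly_as_sum_monom:
  fixes r :: "'a::comm_ring_1 poly"
  assumes "\<And>i. i \<ge> N \<Longrightarrow> coeff r i = 0"
  shows "r = (\<Sum>k<N. smult (coeff r k) (monom 1 k))"
proof (rule poly_eqI)
  fix i
  have "(\<Sum>k<N. coeff r k * (if k = i then 1 else 0)) = (\<Sum>k<N. if k = i then coeff r k else 0)"
    by (intro sum.cong) auto
  then show "coeff r i = coeff (\<Sum>k<N. smult (coeff r k) (monom 1 k)) i"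
    using assms[of i] by (auto simp: coeff_sum sum.delta not_less)
qed

text \<open>Both the Vandermonde determinant and its confluent analogue are computed by evaluating
  the functionals on a Newton basis, where their matrix is triangular.\<close>

lemma det_functionals:
  fixes m :: "'a::comm_ring_1 poly" and L :: "nat \<Rightarrow> 'a poly \<Rightarrow> 'a"
  assumes m: "lead_coeff m = 1" "degree m = N"
    and vanish: "\<And>i q. i < N \<Longrightarrow> L i (m * q) = 0"
    and add: "\<And>i f g. L i (f + g) = L i f + L i g"
    and smult: "\<And>i c f. L i (smult c f) = c * L i f"
    and b: "\<And>k. k < N \<Longrightarrow> lead_coeff (b k) = 1" "\<And>k. k < N \<Longrightarrow> degree (b k) = k"
    and tri: "\<And>i k. i < k \<Longrightarrow> k < N \<Longrightarrow> L i (b k) = 0"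
  shows "det (mat N N (\<lambda>(i, j). L i (u j))) = (\<Prod>i<N. L i (b i)) * rdet u m"
proof -
  have L0: "L i 0 = 0" for i using smult[of i 0 0] by simp
  have Lsum: "L i (\<Sum>k\<in>A. f k) = (\<Sum>k\<in>A. L i (f k))" for i A and f :: "nat \<Rightarrow> 'a poly"
    by (induction A rule: infinite_finite_induct) (auto simp: L0 add)
  have expand: "L i r = (\<Sum>k<N. L i (monom 1 k) * coeff r k)"
    if "\<And>i. i \<ge> N \<Longrightarrow> coeff r i = 0" for i r
    by (subst poly_as_sum_monom[of N r]) (use that in \<open>auto simp: Lsum smult mult.commute\<close>)
  have "L i (u j) = (\<Sum>k<N. L i (monom 1 k) * coeff (mrem (u j) m) k)" if "i < N" for i j
  proof -
    obtain q where q: "u j = m * q + mrem (u j) m" and r: "\<And>i. i \<ge> N \<Longrightarrow> coeff (mrem (u j) m) i = 0"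
      using mrem_spec[OF m(1), of "u j"] m(2) by metis
    have "L i (u j) = L i (mrem (u j) m)" by (subst q) (simp add: add vanish that)
    with expand[of "mrem (u j) m"] r show ?thesis by simp
  qed
  then have "mat N N (\<lambda>(i, j). L i (u j)) =
      mat N N (\<lambda>(i, j). \<Sum>k<N. L i (monom 1 k) * coeff (mrem (u j) m) k)"
    by (intro cong_mat) auto
  then have 1: "det (mat N N (\<lambda>(i, j). L i (u j))) =
      det (mat N N (\<lambda>(i, j). L i (monom 1 j))) * rdet u m"
    by (simp add: det_mat_mult_fun rdet_def rmat_def m(2))
  have bz: "coeff (b k) i = 0" if "k < N" "i \<ge> N" for k i using b(2)[OF that(1)] that
    by (simp add: coeff_eq_0)
  \<comment> \<open>The same factorisation is now applied to the monic basis \<open>b\<close>, whose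
    coefficient matrix is unitriangular; this evaluates the functionals on the monomials without any
    division.\<close>
  have "(\<Prod>i<N. L i (b i)) = det (mat N N (\<lambda>(i, k). L i (b k)))"
    by (rule det_lower_triangular_mat[symmetric]) (use tri in auto)
  also have "mat N N (\<lambda>(i, k). L i (b k)) =
      mat N N (\<lambda>(i, j). \<Sum>k<N. L i (monom 1 k) * coeff (b j) k)"
    using expand[of "b _"] bz by (intro cong_mat) auto
  also have "det \<dots> = det (mat N N (\<lambda>(i, j). L i (monom 1 j))) *
      det (mat N N (\<lambda>(i, j). coeff (b j) i))"
    by (rule det_mat_mult_fun)
  also have "det (mat N N (\<lambda>(i, j). coeff (b j) i)) = 1"
  proof (subst det_upper_triangular_mat)
    show "coeff (b j) i = 0" if "j < i" "i < N" for i j using b(2)[of j] that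
      by (simp add: coeff_eq_0)
    show "(\<Prod>i<N. coeff (b i) i) = 1" using b by simp
  qed
  finally show ?thesis using 1 by simp
qed

section \<open>Evaluation and Taylor functionals at the roots of the modulus\<close>

definition linpoly :: "'a::comm_ring_1 list \<Rightarrow> 'a poly" where
  "linpoly ts = (\<Prod>t\<leftarrow>ts. [:-t, 1:])"

lemma linpoly_simps [simp]:
  "linpoly [] = 1" "linpoly (t # ts) = [:-t, 1:] * linpoly ts"
  "linpoly (ts @ us) = linpoly ts * linpoly us"
  "linpoly (replicate k t) = [:-t, 1:] ^ k"
  by (simp_all add: linpoly_def)

lemma monic_mult:
  fixes a b :: "'a::comm_ring_1 poly"
  assumes "lead_coeff a = 1" "lead_coeff b = 1"
  shows "degree (a * b) = degree a + degree b" "lead_coeff (a * b) = 1"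
proof -
  have "coeff (a * b) (degree a + degree b) = 1" by (simp add: coeff_mult_degree_sum assms)
  then show "degree (a * b) = degree a + degree b"
    by (intro antisym[OF degree_mult_le le_degree]) simp
  with \<open>coeff (a * b) (degree a + degree b) = 1\<close> show "lead_coeff (a * b) = 1" by simp
qed

lemma linpoly_monic [simp]:
  "lead_coeff (linpoly (ts :: 'a::comm_ring_1 list)) = 1" "degree (linpoly ts) = length ts"
proof -
  have "lead_coeff (linpoly ts) = 1 \<and> degree (linpoly ts) = length ts"
  proof (induction ts)
    case (Cons t ts)
    have "lead_coeff [:-t, 1:] = 1" by simp
    from monic_mult[OF this, of "linpoly ts"] Cons show ?case
      unfolding linpoly_simps by (auto simp del: mult_pCons_left)
  qed simp
  then show "lead_coeff (linpoly ts) = 1" "degree (linpoly ts) = length ts" by auto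
qed

lemma map_poly_linpoly:
  fixes h :: "'a::comm_ring_1 \<Rightarrow> 'b::comm_ring_1"
  assumes "comm_ring_hom h"
  shows "map_poly h (linpoly ts) = linpoly (map h ts)"
proof -
  interpret comm_ring_hom h by fact
  interpret hp: map_poly_comm_ring_hom h ..
  show ?thesis
    by (induction ts) (simp_all only: list.map linpoly_simps hp.hom_one hp.hom_mult
        map_poly_pCons_hom hom_uminus hom_one map_poly_0 )
qed

definition vand :: "'a::comm_ring_1 list \<Rightarrow> 'a" where
  "vand ts = (\<Prod>j<length ts. \<Prod>i<j. ts ! j - ts ! i)"

lemma poly_linpoly: "poly (linpoly ts) x = (\<Prod>i<length ts. x - ts ! i)"
  by (induction ts) (simp_all add: prod.lessThan_Suc_shift algebra_simps del: prod.lessThan_Suc)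

lemma det_poly_eval:
  fixes ts :: "'a::comm_ring_1 list"
  assumes "length ts = N"
  shows "det (mat N N (\<lambda>(i, j). poly (u j) (ts ! i))) = vand ts * rdet u (linpoly ts)"
proof (subst det_functionals[where m = "linpoly ts" and b = "\<lambda>k. linpoly (take k ts)"
    and L = "\<lambda>i f. poly f (ts ! i)"])
  show "poly (linpoly ts * q) (ts ! i) = 0" if "i < N" for i q
    using that assms by (subst poly_mult, subst poly_linpoly, subst prod_zero) auto
  show "lead_coeff (linpoly ts) = 1" by (rule linpoly_monic)
  show "lead_coeff (linpoly (take k ts)) = 1" for k by (rule linpoly_monic)
  show "poly (linpoly (take k ts)) (ts ! i) = 0" if "i < k" "k < N" for i k
    using that assms by (auto simp: poly_linpoly intro!: prod_zero bexI[of _ i])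
  have "poly (linpoly (take i ts)) (ts ! i) = (\<Prod>k<i. ts ! i - ts ! k)" if "i < N" for i
    using that assms by (simp add: poly_linpoly min_def)
  then show "(\<Prod>i<N. poly (linpoly (take i ts)) (ts ! i)) * rdet u (linpoly ts) =
      vand ts * rdet u (linpoly ts)"
    using assms by (simp add: vand_def)
qed (use assms in auto)

text \<open>With \<open>x\<close> the power series variable this converts divisibility after the
  substitution \<open>c + x t\<close> into orders of vanishing of Taylor coefficients at
  \<open>c\<close>.\<close>

lemma coeff_pcompose_linear_shift:
  fixes f :: "'a::comm_ring_1 poly"
  shows "coeff (pcompose f [:c, x:]) i = x ^ i * coeff (pcompose f [:c, 1:]) i"
proof -
  have "pcompose f [:c, x:] = pcompose (pcompose f [:c, 1:]) [:0, x:]"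
    by (simp add: pcompose_assoc[symmetric] pcompose_pCons)
  moreover have "coeff (pcompose g [:0, x:]) i = x ^ i * coeff g i" for g :: "'a poly"
    by (induction g arbitrary: i) (auto simp: pcompose_pCons coeff_pCons split: nat.splits)
  ultimately show ?thesis by simp
qed

text \<open>The functionals of Hermite interpolation with multiplicity \<open>a\<close> at
  \<open>c\<close> and the remaining ones at \<open>d\<close>. Taylor coefficients replace
  derivatives, so no factorials enter.\<close>

definition hermite :: "nat \<Rightarrow> 'a::comm_ring_1 \<Rightarrow> 'a \<Rightarrow> nat \<Rightarrow> 'a poly \<Rightarrow> 'a" where
  "hermite a c d i f = (if i < a then coeff (pcompose f [:c, 1:]) i
     else coeff (pcompose f [:d, 1:]) (i - a))"

lemma coeff_mult_X_power:
  fixes f :: "'a::comm_ring_1 poly"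
  shows "coeff ([:0, 1:] ^ k * f) i = (if i < k then 0 else coeff f (i - k))"
  by (simp add: monom_altdef[of 1, simplified, symmetric] coeff_monom_mult)

lemma pcompose_power_hom:
  fixes f :: "'a::comm_ring_1 poly"
  shows "pcompose (f ^ k) g = pcompose f g ^ k"
  by (induction k) (simp_all add: pcompose_mult)

text \<open>The power of \<open>d - c\<close> is the confluent Vandermonde determinant: on the
  Newton basis each of the \<open>a\<close> rows at \<open>c\<close> has diagonal entry 1, and each
  of the \<open>b\<close> rows at \<open>d\<close> has diagonal entry
  \<open>(d - c) ^ a\<close>.\<close>

lemma det_hermite:
  fixes c d :: "'a::comm_ring_1"
  assumes "N = a + b"
  shows "det (mat N N (\<lambda>(i, j). hermite a c d i (u j))) =
    (d - c) ^ (a * b) * rdet u (linpoly (replicate a c @ replicate b d))"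
proof -
  let ?m = "linpoly (replicate a c @ replicate b d)"
  let ?b = "\<lambda>k. linpoly (replicate (min k a) c @ replicate (k - a) d)"
  have shift: "pcompose (linpoly (replicate k c @ replicate l d)) [:c, 1:] =
      [:0, 1:] ^ k * [:c - d, 1:] ^ l" 
    "pcompose (linpoly (replicate k c @ replicate l d)) [:d, 1:] =
      [:0, 1:] ^ l * [:d - c, 1:] ^ k" for k l
    by (simp_all add: pcompose_mult pcompose_power_hom pcompose_pCons algebra_simps)
  have "det (mat N N (\<lambda>(i, j). hermite a c d i (u j))) =
      (\<Prod>i<N. hermite a c d i (?b i)) * rdet u ?m"
  proof (rule det_functionals)
    show "hermite a c d i (?m * q) = 0" if "i < N" for i q
      using that assms
      by (auto simp: hermite_def pcompose_mult shift mult.assoc coeff_mult_X_power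
          simp del: linpoly_simps)
    show "hermite a c d i (?b k) = 0" if "i < k" "k < N" for i k
      using that assms
      by (auto simp: hermite_def shift coeff_mult_X_power simp del: linpoly_simps)
    show "lead_coeff ?m = 1" by (rule linpoly_monic)
    show "lead_coeff (?b k) = 1" for k by (rule linpoly_monic)
  qed (use assms in \<open>auto simp: hermite_def pcompose_add pcompose_smult simp del: linpoly_simps\<close>)
  also have "(\<Prod>i<N. hermite a c d i (?b i)) = (\<Prod>i<N. if i < a then 1 else (d - c) ^ a)"
  proof (intro prod.cong refl)
    fix i assume "i \<in> {..<N}"
    then show "hermite a c d i (?b i) = (if i < a then 1 else (d - c) ^ a)"
      unfolding hermite_def shift using coeff_mult_X_power[of i 1 i]
      by (auto simp: coeff_mult_X_power coeff_0_power)
  qed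
  also have "\<dots> = (d - c) ^ (a * b)"
    unfolding assms by (induction b) (auto simp: power_add intro!: prod.neutral)
  finally show ?thesis .
qed

text \<open>Zooming in on a point \<open>c\<close> near which all nodes lie. Uniqueness of monic
  division shows that the substitution \<open>c + x t\<close> commutes with taking remainders up to
  the stated powers of \<open>x\<close>. The powers stay on both sides because \<open>x\<close> may
  be a zero divisor.\<close>

lemma rdet_rescale:
  fixes m :: "'a::comm_ring_1 poly"
  assumes m: "lead_coeff m = 1" "degree m = N" and m': "lead_coeff m' = 1" "degree m' = N"
    and mm': "pcompose m [:c, x:] = smult (x ^ N) m'"
    and uv: "\<And>j. j < N \<Longrightarrow> pcompose (u j) [:c, x:] = smult (x ^ w j) (v j)"
  shows "x ^ (\<Sum>i<N. i) * rdet u m = x ^ (\<Sum>j<N. w j) * rdet v m'"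
proof -
  have key: "pcompose (mrem (u j) m) [:c, x:] = smult (x ^ w j) (mrem (v j) m')" if "j < N" for j
  proof -
    obtain q where q: "u j = m * q + mrem (u j) m" and r: "\<And>i. i \<ge> N \<Longrightarrow> coeff (mrem (u j) m) i = 0"
      using mrem_spec[OF m(1), of "u j"] m(2) by metis
    obtain q' where q': "v j = m' * q' + mrem (v j) m'"
      and r': "\<And>i. i \<ge> N \<Longrightarrow> coeff (mrem (v j) m') i = 0"
      using mrem_spec[OF m'(1), of "v j"] m'(2) by metis
    have "smult (x ^ w j) (v j) = smult (x ^ N) m' * pcompose q [:c, x:] +
        pcompose (mrem (u j) m) [:c, x:]"
      unfolding uv[OF that, symmetric] mm'[symmetric]
      by (subst q) (simp add: pcompose_add pcompose_mult)
    then have "m' * smult (x ^ N) (pcompose q [:c, x:]) + pcompose (mrem (u j) m) [:c, x:] =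
        m' * smult (x ^ w j) q' + smult (x ^ w j) (mrem (v j) m')"
      by (subst (asm) (1) q') (simp add: smult_add_right)
    then show ?thesis
    proof (rule monic_division_unique[OF m'(1)])
      show "coeff (pcompose (mrem (u j) m) [:c, x:]) i = 0" if i: "i \<ge> degree m'" for i
      proof (cases "mrem (u j) m = 0")
        case False
        then have "degree (mrem (u j) m) < N" using r[of "degree (mrem (u j) m)"]
          by (metis leading_coeff_0_iff not_le)
        moreover have "degree (pcompose (mrem (u j) m) [:c, x:]) \<le> degree (mrem (u j) m)"
          using degree_pcompose_le[of "mrem (u j) m" "[:c, x:]"]
          by (metis degree_pCons_le degree_pCons_0 le_trans mult.right_neutral mult_le_mono2 One_nat_def)
        ultimately show ?thesis using i m'(2) by (simp add: coeff_eq_0)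
      qed simp
    qed (use r' m'(2) in auto)
  qed
  \<comment> \<open>On polynomials of degree below N the substitution is upper triangular with
    diagonal entries \<open>x ^ i\<close>, the source of the exponent on the left of the
    claim.\<close>
  have tri: "coeff ([:c, x:] ^ k) i = (if i = k then x ^ k else 0)" if "k \<le> i" for i k
  proof -
    have "degree ([:c, x:] ^ k) \<le> k"
      using degree_power_le[of "[:c, x:]" k]
      by (metis degree_pCons_le degree_pCons_0 le_trans mult_1 mult_le_mono1 One_nat_def)
    moreover have "coeff ([:c, x:] ^ k) k = x ^ k"
    proof (induction k)
      case (Suc k)
      have "coeff ([:c, x:] ^ k) (Suc k) = 0"
        using degree_power_le[of "[:c, x:]" k]
        by (metis (no_types) coeff_eq_0 degree_pCons_le degree_pCons_0 le_imp_less_Suc le_trans mult_1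
          mult_le_mono1 One_nat_def)
      then show ?case using Suc by simp
    qed simp
    ultimately show ?thesis using that by (auto simp: coeff_eq_0)
  qed
  have "det (mat N N (\<lambda>(i, j). coeff (smult (x ^ w j) (mrem (v j) m')) i)) =
      x ^ (\<Sum>j<N. w j) * rdet v m'"
  proof -
    have "det (mat N N (\<lambda>(i, j). coeff (smult (x ^ w j) (mrem (v j) m')) i)) =
      det (mat N N (\<lambda>(i, j). \<Sum>k<N. coeff (mrem (v k) m') i * (if k = j then x ^ w j else 0)))"
      by (intro arg_cong[of _ _ det] cong_mat) (auto simp: sum.delta mult.commute
          if_distrib[of "\<lambda>x. _ * x"] cong: if_cong)
    then show ?thesis
      by (simp add: det_mat_mult_fun det_upper_triangular_mat power_sum rdet_def rmat_def m'(2)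
          mult.commute)
  qed
  moreover have "det (mat N N (\<lambda>(i, j). coeff (pcompose (mrem (u j) m) [:c, x:]) i)) =
      x ^ (\<Sum>i<N. i) * rdet u m"
  proof -
    have "coeff (pcompose (mrem (u j) m) [:c, x:]) i =
        (\<Sum>k<N. coeff ([:c, x:] ^ k) i * coeff (mrem (u j) m) k)" for i j
    proof -
      have r: "\<And>i. i \<ge> N \<Longrightarrow> coeff (mrem (u j) m) i = 0"
        using mrem_spec[OF m(1), of "u j"] m(2) by metis
      have "mrem (u j) m = (\<Sum>k<N. smult (coeff (mrem (u j) m) k) (monom 1 k))"
        by (rule poly_as_sum_monom) (rule r)
      from arg_cong[OF this, of "\<lambda>f. pcompose f [:c, x:]"]
      have "pcompose (mrem (u j) m) [:c, x:] =
          (\<Sum>k<N. smult (coeff (mrem (u j) m) k) (pcompose (monom 1 k) [:c, x:]))"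
        by (simp only: pcompose_sum pcompose_smult)
      moreover have "pcompose (monom 1 k) [:c, x:] = [:c, x:] ^ k" for k
        by (induction k) (simp_all add: monom_Suc pcompose_pCons)
      ultimately show ?thesis by (simp add: coeff_sum mult.commute)
    qed
    then show ?thesis
      using tri by (simp add: det_mat_mult_fun det_upper_triangular_mat power_sum rdet_def rmat_def m(2))
  qed
  moreover have "mat N N (\<lambda>(i, j). coeff (pcompose (mrem (u j) m) [:c, x:]) i) =
      mat N N (\<lambda>(i, j). coeff (smult (x ^ w j) (mrem (v j) m')) i)"
    using key by (intro cong_mat) auto
  ultimately show ?thesis by simp
qed

section \<open>The Desnanot-Jacobi identity and a Cauchy-type determinant\<close>

lemma det_block_lower_mat:
  fixes f :: "nat \<Rightarrow> nat \<Rightarrow> 'a::idom"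
  assumes "\<And>i j. i < a \<Longrightarrow> a \<le> j \<Longrightarrow> j < a + b \<Longrightarrow> f i j = 0"
  shows "det (mat (a + b) (a + b) (\<lambda>(i, j). f i j)) =
    det (mat a a (\<lambda>(i, j). f i j)) * det (mat b b (\<lambda>(i, j). f (a + i) (a + j)))"
proof -
  have "mat (a + b) (a + b) (\<lambda>(i, j). f i j) = four_block_mat (mat a a (\<lambda>(i, j). f i j)) (0\<^sub>m a b)
      (mat b a (\<lambda>(i, j). f (a + i) j)) (mat b b (\<lambda>(i, j). f (a + i) (a + j)))"
    by (rule eq_matI) (auto simp: assms)
  then show ?thesis by (simp add: det_four_block_mat_upper_right_zero[of _ a _ b])
qed

lemma det_block_upper_mat:
  fixes f :: "nat \<Rightarrow> nat \<Rightarrow> 'a::idom"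
  assumes "\<And>i j. a \<le> i \<Longrightarrow> j < a \<Longrightarrow> i < a + b \<Longrightarrow> f i j = 0"
  shows "det (mat (a + b) (a + b) (\<lambda>(i, j). f i j)) =
    det (mat a a (\<lambda>(i, j). f i j)) * det (mat b b (\<lambda>(i, j). f (a + i) (a + j)))"
proof -
  have "mat (a + b) (a + b) (\<lambda>(i, j). f i j) = four_block_mat (mat a a (\<lambda>(i, j). f i j))
      (mat a b (\<lambda>(i, j). f i (a + j))) (0\<^sub>m b a) (mat b b (\<lambda>(i, j). f (a + i) (a + j)))"
    by (rule eq_matI) (auto simp: assms)
  then show ?thesis by (simp add: det_four_block_mat_lower_left_zero[of _ a _ b])
qed

lemma det_scale_rows_cols:
  fixes f :: "nat \<Rightarrow> nat \<Rightarrow> 'a::comm_ring_1"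
  shows "det (mat n n (\<lambda>(i, j). r i * f i j * c j)) =
    (\<Prod>i<n. r i) * (\<Prod>j<n. c j) * det (mat n n (\<lambda>(i, j). f i j))"
proof -
  have "mat n n (\<lambda>(i, j). r i * f i j * c j) =
      mat n n (\<lambda>(i, j). \<Sum>k<n. (r i * f i k) * (if k = j then c j else 0))"
    by (intro cong_mat) (auto simp: if_distrib[of "\<lambda>x. _ * x"] cong: if_cong)
  then have 1: "det (mat n n (\<lambda>(i, j). r i * f i j * c j)) =
      det (mat n n (\<lambda>(i, j). r i * f i j)) * det (mat n n (\<lambda>(k, j). if k = j then c j else 0))"
    by (simp only: det_mat_mult_fun)
  have "mat n n (\<lambda>(i, j). r i * f i j) =
      mat n n (\<lambda>(i, j). \<Sum>l<n. (if l = i then r i else 0) * f l j)"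
    by (intro cong_mat) (auto simp: if_distrib[of "\<lambda>x. x * _"] cong: if_cong)
  then have 2: "det (mat n n (\<lambda>(i, j). r i * f i j)) =
      det (mat n n (\<lambda>(i, l). if l = i then r i else 0)) * det (mat n n (\<lambda>(i, j). f i j))"
    by (simp only: det_mat_mult_fun)
  show ?thesis unfolding 1 2 by (simp add: det_upper_triangular_mat mult_ac)
qed

lemma det_2: "det (mat 2 2 (\<lambda>(i, j). f i j)) = f 0 0 * f 1 1 - f 0 1 * (f 1 0 :: 'a::comm_ring_1)"
proof -
  have "det (mat 2 2 (\<lambda>(i, j). f i j)) =
      (\<Sum>i<2. mat 2 2 (\<lambda>(i, j). f i j) $$ (i, 0) * cofactor (mat 2 2 (\<lambda>(i, j). f i j)) i 0)"
    by (rule laplace_expansion_column) auto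
  then show ?thesis
    by (simp add: numeral_2_eq_2 cofactor_def mat_delete_def det_single algebra_simps)
qed

text \<open>The vector \<open>y j\<close> expresses the upper part of column \<open>j\<close>
  through the first \<open>m\<close> columns; subtracting that combination clears the upper right
  block, and no inverse matrix has to be formed.\<close>

lemma det_schur_complement:
  fixes c :: "nat \<Rightarrow> nat \<Rightarrow> 'a::idom"
  assumes "\<And>i j. i < m \<Longrightarrow> m \<le> j \<Longrightarrow> j < m + r \<Longrightarrow> (\<Sum>k<m. c i k * y j k) = c i j"
  shows "det (mat (m + r) (m + r) (\<lambda>(i, j). c i j)) = det (mat m m (\<lambda>(i, j). c i j)) *
    det (mat r r (\<lambda>(i, j). c (m + i) (m + j) - (\<Sum>k<m. c (m + i) k * y (m + j) k)))"
proof -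
  define B where "B k j = (if j < m \<or> m \<le> k then if k = j then 1 else 0 else - y j k)" for k j
  have B: "(\<Sum>k<m + r. c i k * B k j) = (if j < m then c i j else c i j - (\<Sum>k<m. c i k * y j k))"
    if "j < m + r" for i j
  proof -
    have "(\<Sum>k<m + r. c i k * B k j) = (\<Sum>k<m. c i k * B k j) + (\<Sum>k=m..<m + r. c i k * B k j)"
      by (metis lessThan_atLeast0 le_add1 sum.atLeastLessThan_concat zero_le)
    moreover have "(\<Sum>k<m. c i k * B k j) = (if j < m then c i j else - (\<Sum>k<m. c i k * y j k))"
      by (auto simp: B_def if_distrib[of "\<lambda>x. _ * x"] sum_negf cong: if_cong)
    moreover have "(\<Sum>k=m..<m + r. c i k * B k j) = (if j < m then 0 else c i j)"
      using that by (auto simp: B_def if_distrib[of "\<lambda>x. _ * x"] cong: if_cong intro!: sum.neutral)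
    ultimately show ?thesis by simp
  qed
  have "det (mat (m + r) (m + r) (\<lambda>(i, j). B i j)) = 1"
    by (subst det_upper_triangular_mat) (auto simp: B_def intro!: prod.neutral)
  then have "det (mat (m + r) (m + r) (\<lambda>(i, j). c i j)) =
      det (mat (m + r) (m + r) (\<lambda>(i, j). \<Sum>k<m + r. c i k * B k j))"
    by (simp add: det_mat_mult_fun)
  also have "\<dots> = det (mat (m + r) (m + r)
      (\<lambda>(i, j). if j < m then c i j else c i j - (\<Sum>k<m. c i k * y j k)))"
    using B by (intro arg_cong[of _ _ det] cong_mat) auto
  also have "\<dots> = det (mat m m (\<lambda>(i, j). c i j)) *
    det (mat r r (\<lambda>(i, j). c (m + i) (m + j) - (\<Sum>k<m. c (m + i) k * y (m + j) k)))"
    by (subst det_block_lower_mat)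
      (auto simp: assms intro!: arg_cong2[of _ _ _ _ "(*)"] arg_cong[of _ _ det] cong_mat)
  finally show ?thesis .
qed

text \<open>Instead of deleting an index, the surviving one of \<open>m\<close> and
  \<open>m + 1\<close> is put into position \<open>m\<close>, so that all four minors have the same
  shape.\<close>

definition skip_index :: "nat \<Rightarrow> nat \<Rightarrow> nat \<Rightarrow> nat" where
  "skip_index m a i = (if i < m then i else a)"

text \<open>With an invertible central block every bordered minor is its determinant times an entry
  of the Schur complement, and the identity becomes the formula for a 2 by 2 determinant.\<close>

lemma desnanot_jacobi_regular:
  fixes c :: "nat \<Rightarrow> nat \<Rightarrow> 'a::field" and m :: nat
  assumes "det (mat m m (\<lambda>(i, j). c i j)) \<noteq> 0"
  defines "minor \<equiv> \<lambda>a b. det (mat (m + 1) (m + 1) (\<lambda>(i, j). c (skip_index m a i) (skip_index m b j)))"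
  shows "det (mat (m + 2) (m + 2) (\<lambda>(i, j). c i j)) * det (mat m m (\<lambda>(i, j). c i j)) =
    minor m m * minor (m + 1) (m + 1) - minor m (m + 1) * minor (m + 1) m"
proof -
  let ?M = "mat m m (\<lambda>(i, j). c i j)"
  have adj: "adj_mat ?M \<in> carrier_mat m m" "?M * adj_mat ?M = det ?M \<cdot>\<^sub>m 1\<^sub>m m"
    using adj_mat[of ?M m] by auto
  \<comment> \<open>Cramer's rule for column \<open>j\<close> relative to the central block.\<close>
  define y where "y j k = (\<Sum>l<m. adj_mat ?M $$ (k, l) * c l j) / det ?M" for j k
  have y: "(\<Sum>k<m. c i k * y j k) = c i j" if "i < m" for i j
  proof -
    have "(\<Sum>k<m. c i k * adj_mat ?M $$ (k, l)) = (if i = l then det ?M else 0)" if "l < m" for l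
    proof -
      have "(?M * adj_mat ?M) $$ (i, l) = (if i = l then det ?M else 0)"
        using that \<open>i < m\<close> adj by simp
      then show ?thesis using that \<open>i < m\<close> adj(1) by (simp add: scalar_prod_def lessThan_atLeast0)
    qed note inv = this
    have "(\<Sum>k<m. c i k * y j k) = (\<Sum>k<m. \<Sum>l<m. c i k * adj_mat ?M $$ (k, l) * c l j) / det ?M"
      by (simp add: y_def sum_distrib_left sum_divide_distrib mult.assoc)
    also have "\<dots> = (\<Sum>l<m. (\<Sum>k<m. c i k * adj_mat ?M $$ (k, l)) * c l j) / det ?M"
      by (subst sum.swap) (simp add: sum_distrib_right)
    also have "\<dots> = (\<Sum>l<m. if i = l then det ?M * c l j else 0) / det ?M"
      using inv by (intro arg_cong2[of _ _ _ _ "(/)"] sum.cong) auto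
    finally show ?thesis using that assms(1) by simp
  qed
  define s where "s i j = c i j - (\<Sum>k<m. c i k * y j k)" for i j
  have "minor a b = det ?M * s a b" for a b
  proof -
    have "minor a b = det (mat m m (\<lambda>(i, j). c (skip_index m a i) (skip_index m b j))) *
      det (mat 1 1 (\<lambda>(i, j). c (skip_index m a (m + i)) (skip_index m b (m + j)) -
        (\<Sum>k<m. c (skip_index m a (m + i)) (skip_index m b k) * y (skip_index m b (m + j)) k)))"
      unfolding minor_def
      by (rule det_schur_complement) (simp add: skip_index_def y)
    also have "mat m m (\<lambda>(i, j). c (skip_index m a i) (skip_index m b j)) = ?M"
      by (rule cong_mat) (auto simp: skip_index_def)
    finally show ?thesis by (simp add: det_single skip_index_def s_def)
  qed
  moreover have "det (mat (m + 2) (m + 2) (\<lambda>(i, j). c i j)) =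
      det ?M * (s m m * s (m + 1) (m + 1) - s m (m + 1) * s (m + 1) m)"
    using det_schur_complement[of m 2 c y] y by (simp add: det_2 s_def)
  ultimately show ?thesis by (simp only:) (simp only: right_diff_distrib left_diff_distrib mult_ac)
qed

lemma to_fract_comm_ring_hom: "inj_idom_hom (to_fract :: 'a::idom \<Rightarrow> 'a fract)"
  by unfold_locales auto

lemma poly_eval_comm_ring_hom: "comm_ring_hom (\<lambda>f. poly f (x :: 'a::comm_ring_1))"
  by unfold_locales auto

lemma hom_det_fun:
  assumes "comm_ring_hom h"
  shows "h (det (mat n n (\<lambda>(i, j). f i j))) = det (mat n n (\<lambda>(i, j). h (f i j)))"
proof -
  interpret comm_ring_hom h by fact
  have "map_mat h (mat n n (\<lambda>(i, j). f i j)) = mat n n (\<lambda>(i, j). h (f i j))"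
    by (rule eq_matI) auto
  then show ?thesis by (simp add: hom_det[symmetric] del: hom_det)
qed

text \<open>The general case follows from the regular one by adding an indeterminate to the diagonal
  entries of the central block.\<close>

lemma desnanot_jacobi:
  fixes c :: "nat \<Rightarrow> nat \<Rightarrow> 'a::field" and m :: nat
  defines "minor \<equiv> \<lambda>a b. det (mat (m + 1) (m + 1) (\<lambda>(i, j). c (skip_index m a i) (skip_index m b j)))"
  shows "det (mat (m + 2) (m + 2) (\<lambda>(i, j). c i j)) * det (mat m m (\<lambda>(i, j). c i j)) =
    minor m m * minor (m + 1) (m + 1) - minor m (m + 1) * minor (m + 1) m"
proof -
  define d :: "nat \<Rightarrow> nat \<Rightarrow> 'a poly"
    where "d i j = [:c i j:] + (if i = j \<and> i < m then [:0, 1:] else 0)" for i j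
  define M where "M k f g = det (mat k k (\<lambda>(i, j). d (f i) (g j)))" for k and f g :: "nat \<Rightarrow> nat"
  interpret h: inj_idom_hom "to_fract :: 'a poly \<Rightarrow> 'a poly fract" by (rule to_fract_comm_ring_hom)
  have tf: "comm_ring_hom (to_fract :: 'a poly \<Rightarrow> 'a poly fract)" ..
  have ev: "comm_ring_hom (\<lambda>f :: 'a poly. poly f 0)" by (rule poly_eval_comm_ring_hom)
  \<comment> \<open>The perturbed central block is a characteristic matrix, so its determinant is a
    monic polynomial and in particular nonzero.\<close>
  have "mat m m (\<lambda>(i, j). d i j) = char_poly_matrix (mat m m (\<lambda>(i, j). - c i j))"
    by (rule eq_matI) (auto simp: char_poly_matrix_def d_def)
  then have "det (mat m m (\<lambda>(i, j). d i j)) = char_poly (mat m m (\<lambda>(i, j). - c i j))"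
    by (simp add: char_poly_def)
  then have "det (mat m m (\<lambda>(i, j). d i j)) \<noteq> 0"
    using degree_monic_char_poly[of "mat m m (\<lambda>(i, j). - c i j)" m] by auto
  then have "det (mat m m (\<lambda>(i, j). to_fract (d i j))) \<noteq> 0"
    by (simp add: hom_det_fun[OF tf, symmetric])
  from desnanot_jacobi_regular[OF this]
  have "to_fract (M (m + 2) id id * M m id id) =
      to_fract (M (m + 1) (skip_index m m) (skip_index m m) *
          M (m + 1) (skip_index m (m + 1)) (skip_index m (m + 1)) -
        M (m + 1) (skip_index m m) (skip_index m (m + 1)) *
          M (m + 1) (skip_index m (m + 1)) (skip_index m m))"
    by (simp add: M_def hom_det_fun[OF tf])
  then have "M (m + 2) id id * M m id id =
      M (m + 1) (skip_index m m) (skip_index m m) *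
          M (m + 1) (skip_index m (m + 1)) (skip_index m (m + 1)) -
        M (m + 1) (skip_index m m) (skip_index m (m + 1)) *
          M (m + 1) (skip_index m (m + 1)) (skip_index m m)"
    by (simp only: to_fract_eq_iff)
  from arg_cong[OF this, of "\<lambda>f. poly f 0"] show ?thesis
    by (simp add: M_def hom_det_fun[OF ev] minor_def d_def if_distrib[of "\<lambda>f. poly f 0"] cong: if_cong)
qed

section \<open>Vandermonde and Cauchy-type determinants\<close>

lemma det_vandermonde:
  "det (mat n n (\<lambda>(i, j). f i ^ j)) = (\<Prod>j<n. \<Prod>i<j. f j - (f i :: 'a::comm_ring_1))"
proof -
  define ts where "ts = map f [0..<n]"
  have [simp]: "length ts = n" by (simp add: ts_def)
  \<comment> \<open>Below the degree of the modulus monomials are their own remainders, so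
    \<open>rdet\<close> is 1 and \<open>det_poly_eval\<close> leaves just the Vandermonde
    product.\<close>
  have "mrem (monom 1 j) (linpoly ts) = monom 1 j" if "j < n" for j
    by (rule mrem_unique[where q = 0, OF linpoly_monic(1)]) (use that in auto)
  then have "rmat (monom 1) (linpoly ts) = 1\<^sub>m n"
    by (intro eq_matI) (auto simp: rmat_def)
  then have "rdet (monom 1) (linpoly ts) = 1" by (simp add: rdet_def)
  moreover have "mat n n (\<lambda>(i, j). f i ^ j) = mat n n (\<lambda>(i, j). poly (monom 1 j) (ts ! i))"
    by (intro cong_mat) (auto simp: ts_def poly_monom)
  moreover have "vand ts = (\<Prod>j<n. \<Prod>i<j. f j - f i)"
    unfolding vand_def by (auto simp: ts_def intro!: prod.cong)
  ultimately show ?thesis using det_poly_eval[of ts n "monom 1"] by simp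
qed

text \<open>Every unordered pair contributes two factors of opposite sign, as in the
  discriminant.\<close>

lemma prod_differences_off_diagonal:
  "(\<Prod>k<n. \<Prod>l\<in>{..<n} - {k}. f k - (f l :: 'a::comm_ring_1)) =
     (-1) ^ (\<Sum>l<n. l) * (\<Prod>j<n. \<Prod>i<j. f j - f i)\<^sup>2"
proof (induction n)
  case (Suc n)
  have "(\<Prod>k<n. \<Prod>l\<in>{..<Suc n} - {k}. f k - f l) =
      (\<Prod>k<n. (f k - f n) * (\<Prod>l\<in>{..<n} - {k}. f k - f l))"
  proof (intro prod.cong refl)
    fix k assume "k \<in> {..<n}"
    then have "{..<Suc n} - {k} = insert n ({..<n} - {k})" by auto
    then show "(\<Prod>l\<in>{..<Suc n} - {k}. f k - f l) = (f k - f n) * (\<Prod>l\<in>{..<n} - {k}. f k - f l)"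
      by simp
  qed
  moreover have "{..<Suc n} - {n} = {..<n}" by auto
  moreover have "(\<Prod>k<n. f k - f n) = (-1) ^ n * (\<Prod>k<n. f n - f k)"
  proof -
    have "(\<Prod>k<n. f k - f n) = (\<Prod>k<n. (-1) * (f n - f k))" by simp
    then show ?thesis by (simp only: prod.distrib prod_constant card_lessThan)
  qed
  ultimately show ?case
    using Suc by (simp add: prod.distrib power_add power2_eq_square mult_ac)
qed simp

lemma poly_eq_sum_lessThan:
  assumes "degree f < N"
  shows "poly f x = (\<Sum>i<N. coeff f i * (x::'a::comm_ring_1) ^ i)"
proof -
  have "poly f x = poly (\<Sum>k<N. smult (coeff f k) (monom 1 k)) x"
    by (subst poly_as_sum_monom[of N f]) (use assms in \<open>auto simp: coeff_eq_0\<close>)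
  then show ?thesis by (simp add: poly_sum poly_monom)
qed

lemma sum_split_lessThan:
  "(\<Sum>k<a + b. f k) = (\<Sum>k<a. f k) + (\<Sum>i<b. f (a + i :: nat) :: 'a::comm_monoid_add)"
  by (induction b) (simp_all add: add.assoc)

text \<open>Rows \<open>0,\<dots>,n-1\<close> of the large matrix belong to the nodes \<open>y\<close>,
  row \<open>n\<close> to \<open>z\<close>, the others to \<open>x\<close>. The column operation replaces the functions \<open>g f\<^sup>k\<close> by
  combinations that vanish at all the nodes \<open>y\<close> and \<open>z\<close>.\<close>

lemma det_cauchy_type:
  fixes f g :: "nat \<Rightarrow> 'a::field"
  assumes dist: "\<And>i j. i < j \<Longrightarrow> j \<le> n \<Longrightarrow> f i \<noteq> f j"
  shows "det (mat (2 * n + 1) (2 * n + 1)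
      (\<lambda>(r, c). if c \<le> n then f r ^ c else g r * f r ^ (c - n - 1))) =
    (-1) ^ (\<Sum>l\<le>n. l) * det (mat n n (\<lambda>(i, k). (\<Prod>l\<in>{..<n} - {k}. f (n + 1 + i) - f l) *
      ((f k - f n) * g (n + 1 + i) - g k * (f (n + 1 + i) - f n) + g n * (f (n + 1 + i) - f k))))"
proof (cases "n = 0")
  case True
  then show ?thesis by (simp add: det_single)
next
  case False
  let ?N = "(n + 1) + n"
  define P where "P k = linpoly (map f (filter (\<lambda>l. l \<noteq> k) [0..<n]))" for k
  have degP: "degree (P k) = n - 1" if "k < n" for k
  proof -
    have "length (filter (\<lambda>l. l \<noteq> k) [0..<n]) = card ({..<n} - {k})"
      using distinct_card[of "filter (\<lambda>l. l \<noteq> k) [0..<n]"] by (simp add: set_diff_eq lessThan_def)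
    then show ?thesis using that by (simp add: P_def)
  qed
  have polyP: "poly (P k) t = (\<Prod>l\<in>{..<n} - {k}. t - f l)" for k t
  proof -
    have "poly (P k) t = prod_list (map (\<lambda>l. t - f l) (filter (\<lambda>l. l \<noteq> k) [0..<n]))"
      by (simp add: P_def linpoly_def poly_prod_list o_def)
    also have "\<dots> = (\<Prod>l\<in>set (filter (\<lambda>l. l \<noteq> k) [0..<n]). t - f l)"
      by (subst prod.distinct_set_conv_list) auto
    also have "set (filter (\<lambda>l. l \<noteq> k) [0..<n]) = {..<n} - {k}" by auto
    finally show ?thesis .
  qed
  \<comment> \<open>\<open>Q k\<close> has degree at most n, hence lies in the span of the first n +
    1 columns; it supplies the terms of \<open>E\<close> below that are free of
    \<open>g r\<close>.\<close>
  define Q where "Q k = P k * [:g k * f n - g n * f k, g n - g k:]" for k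
  have degQ: "degree (Q k) < n + 1" if "k < n" for k
  proof -
    have "degree (Q k) \<le> degree (P k) + degree [:g k * f n - g n * f k, g n - g k:]"
      unfolding Q_def by (rule degree_mult_le)
    also have "\<dots> \<le> (n - 1) + 1" using degP[OF that] by simp
    finally show ?thesis using False by simp
  qed
  define D where "D r c = (if c \<le> n then f r ^ c else g r * f r ^ (c - n - 1))" for r c
  define B where "B c j = (if j \<le> n then if c = j then 1 else 0
     else if c \<le> n then coeff (Q (j - n - 1)) c
     else (f (j - n - 1) - f n) * coeff (P (j - n - 1)) (c - n - 1))" for c j
  \<comment> \<open>Up to sign the second factor is the 3 by 3 determinant with rows (1, f, g) at
    the nodes r, k, n. It vanishes at r = k and r = n, while \<open>P k\<close> vanishes at the
    other nodes y.\<close>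
  define E where "E r k = poly (P k) (f r) *
      ((f k - f n) * g r - g k * (f r - f n) + g n * (f r - f k))" for r k
  define V where "V = (\<Prod>j<n. \<Prod>i<j. f j - f i)"
  have V: "V \<noteq> 0" unfolding V_def using dist by (fastforce simp: dest: sym)
  have DB: "(\<Sum>k<?N. D r k * B k j) = (if j \<le> n then f r ^ j else E r (j - n - 1))"
    if j: "j < ?N" for r j
  proof -
    have split: "(\<Sum>k<?N. D r k * B k j) = (\<Sum>k<n + 1. D r k * B k j) + (\<Sum>i<n. D r (n + 1 + i) * B (n + 1 + i) j)"
      by (rule sum_split_lessThan)
    show ?thesis
    proof (cases "j \<le> n")
      case True
      then show ?thesis unfolding split
        by (auto simp: D_def B_def if_distrib[of "\<lambda>x. _ * x"] cong: if_cong)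
    next
      case False
      define k where "k = j - n - 1"
      have k: "k < n" "j = n + 1 + k" using False j by (auto simp: k_def)
      have "(\<Sum>i<n + 1. D r i * B i j) = poly (Q k) (f r)"
        unfolding poly_eq_sum_lessThan[OF degQ[OF k(1)]]
        by (intro sum.cong) (auto simp: D_def B_def k)
      moreover have "(\<Sum>i<n. D r (n + 1 + i) * B (n + 1 + i) j) = (f k - f n) * g r * poly (P k) (f r)"
      proof -
        have "degree (P k) < n" using degP[OF k(1)] k(1) by simp
        then show ?thesis
          unfolding poly_eq_sum_lessThan[OF \<open>degree (P k) < n\<close>] sum_distrib_left
          by (intro sum.cong) (auto simp: D_def B_def k mult_ac)
      qed
      ultimately have "(\<Sum>k<?N. D r k * B k j) =
          poly (Q k) (f r) + (f k - f n) * g r * poly (P k) (f r)"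
        unfolding split by (simp only:)
      then show ?thesis by (simp add: E_def Q_def k(2) algebra_simps)
    qed
  qed
  have Ez: "E r k = 0" if "r \<le> n" "k < n" for r k
  proof (cases "r < n \<and> r \<noteq> k")
    case True
    then have "poly (P k) (f r) = 0" unfolding polyP by (intro prod_zero) auto
    then show ?thesis by (simp add: E_def)
  next
    case False
    then have "r = k \<or> r = n" using that by auto
    then show ?thesis by (auto simp: E_def algebra_simps)
  qed
  have detDB: "det (mat ?N ?N (\<lambda>(r, j). D r j)) * det (mat ?N ?N (\<lambda>(r, j). B r j)) =
      V * (\<Prod>l<n. f n - f l) * det (mat n n (\<lambda>(i, k). E (n + 1 + i) k))"
  proof -
    have "det (mat ?N ?N (\<lambda>(r, j). D r j)) * det (mat ?N ?N (\<lambda>(r, j). B r j)) =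
        det (mat ?N ?N (\<lambda>(r, j). if j \<le> n then f r ^ j else E r (j - n - 1)))"
      unfolding det_mat_mult_fun[symmetric] using DB
      by (intro arg_cong[of _ _ det] cong_mat) auto
    also have "\<dots> = det (mat (n + 1) (n + 1) (\<lambda>(r, j). f r ^ j)) * det (mat n n (\<lambda>(i, k). E (n + 1 + i) k))"
      using Ez by (subst det_block_lower_mat)
        (auto intro!: arg_cong2[of _ _ _ _ "(*)"] arg_cong[of _ _ det] cong_mat)
    finally show ?thesis by (simp only: det_vandermonde V_def Suc_eq_plus1[symmetric] prod.lessThan_Suc)
  qed
  have detB: "det (mat ?N ?N (\<lambda>(r, j). B r j)) = (-1) ^ (\<Sum>l<n. l) * V * (\<Prod>k<n. f k - f n)"
  proof -
    have "det (mat ?N ?N (\<lambda>(r, j). B r j)) = det (mat (n + 1) (n + 1) (\<lambda>(r, j). if r = j then 1 else 0 :: 'a)) *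
        det (mat n n (\<lambda>(i, k). (f k - f n) * coeff (P k) i))"
      by (subst det_block_upper_mat)
        (auto simp: B_def intro!: arg_cong2[of _ _ _ _ "(*)"] arg_cong[of _ _ det] cong_mat)
    also have "det (mat (n + 1) (n + 1) (\<lambda>(r, j). if r = j then 1 else 0 :: 'a)) = 1"
      by (subst det_upper_triangular_mat) auto
    also have "det (mat n n (\<lambda>(i, k). (f k - f n) * coeff (P k) i)) =
        (\<Prod>k<n. f k - f n) * det (mat n n (\<lambda>(i, k). coeff (P k) i))"
      using det_scale_rows_cols[of n "\<lambda>_. 1" "\<lambda>i k. coeff (P k) i" "\<lambda>k. f k - f n"]
      by (simp add: mult.commute)
    \<comment> \<open>The coefficient determinant is found from values: times a Vandermonde matrix
      it becomes the matrix of values \<open>poly (P k) (f r)\<close>, which vanish off the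
      diagonal.\<close>
    also have "V * det (mat n n (\<lambda>(i, k). coeff (P k) i)) = V * ((-1) ^ (\<Sum>l<n. l) * V)"
    proof -
      have "V * det (mat n n (\<lambda>(i, k). coeff (P k) i)) =
          det (mat n n (\<lambda>(r, k). \<Sum>i<n. f r ^ i * coeff (P k) i))"
        by (simp add: det_mat_mult_fun V_def det_vandermonde)
      also have "\<dots> = det (mat n n (\<lambda>(r, k). poly (P k) (f r)))"
        using degP False by (intro arg_cong[of _ _ det] cong_mat)
          (auto simp: poly_eq_sum_lessThan[of _ n] mult.commute)
      also have "\<dots> = (\<Prod>k<n. poly (P k) (f k))"
        by (rule det_lower_triangular_mat) (auto simp: polyP intro!: prod_zero)
      finally show ?thesis
        by (simp add: polyP prod_differences_off_diagonal V_def power2_eq_square mult_ac)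
    qed
    then have "det (mat n n (\<lambda>(i, k). coeff (P k) i)) = (-1) ^ (\<Sum>l<n. l) * V" using V by simp
    finally show ?thesis by (simp add: mult_ac)
  qed
  have "(\<Prod>l<n. f n - f l) = (\<Prod>l<n. (-1) * (f l - f n))" by simp
  then have neg: "(\<Prod>l<n. f n - f l) = (-1) ^ n * (\<Prod>l<n. f l - f n)"
    by (simp only: prod.distrib prod_constant card_lessThan)
  have nz: "(\<Prod>l<n. f l - f n) \<noteq> 0" using dist by auto
  have "V * (\<Prod>k<n. f k - f n) * ((-1) ^ (\<Sum>l<n. l) * det (mat ?N ?N (\<lambda>(r, j). D r j))) =
     V * (\<Prod>k<n. f k - f n) * ((-1) ^ n * det (mat n n (\<lambda>(i, k). E (n + 1 + i) k)))"
    using detDB unfolding detB neg by (simp only: mult_ac)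
  then have "(-1) ^ (\<Sum>l<n. l) * det (mat ?N ?N (\<lambda>(r, j). D r j)) =
      (-1) ^ n * det (mat n n (\<lambda>(i, k). E (n + 1 + i) k))"
    using V nz by simp
  then have "(-1) ^ (\<Sum>l<n. l) * ((-1) ^ (\<Sum>l<n. l) * det (mat ?N ?N (\<lambda>(r, j). D r j))) =
      (-1) ^ (\<Sum>l<n. l) * ((-1) ^ n * det (mat n n (\<lambda>(i, k). E (n + 1 + i) k)))" by simp
  then have "det (mat ?N ?N (\<lambda>(r, j). D r j)) =
      (-1) ^ (\<Sum>l\<le>n. l) * det (mat n n (\<lambda>(i, k). E (n + 1 + i) k))"
    by (simp add: lessThan_Suc_atMost[symmetric] power_add mult.assoc[symmetric]
        power_mult_distrib[symmetric])
  moreover have "?N = 2 * n + 1" by simp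
  ultimately show ?thesis unfolding D_def E_def polyP by (simp only:)
qed

section \<open>The polynomials \<open>S\<^sub>n\<close> as remainder determinants\<close>

definition phi :: "'a::comm_ring_1 \<Rightarrow> 'a poly" where "phi \<zeta> = [:0, 0, -(2 * \<zeta> + 1), 1:]"
definition psi :: "'a::comm_ring_1 \<Rightarrow> 'a poly" where "psi \<zeta> = [:-\<zeta>, \<zeta> + 2:]"
definition chi :: "'a::comm_ring_1 poly" where "chi = [:0, 1, 1:]"

text \<open>The monomials of degree n in f, g, h that are at most linear in h: n + 1 without h and n
  with h, as many as there are nodes.\<close>

definition ufam :: "nat \<Rightarrow> 'a::comm_ring_1 poly \<Rightarrow> 'a poly \<Rightarrow> 'a poly \<Rightarrow> nat \<Rightarrow> 'a poly" where
  "ufam n f g h j = (if j \<le> n then f ^ j * g ^ (n - j) else h * f ^ (j - n - 1) * g ^ (2 * n - j))"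

text \<open>The sign compensates the one in \<open>det_cauchy_type\<close>, which makes
  \<open>Sg\<close> agree with \<open>S\<close> exactly.\<close>

definition Sg :: "nat \<Rightarrow> 'a::comm_ring_1 \<Rightarrow> 'a list \<Rightarrow> 'a" where
  "Sg n \<zeta> ts = (-1) ^ (\<Sum>l\<le>n. l) * rdet (ufam n (phi \<zeta>) (psi \<zeta>) chi) (linpoly ts)"

lemma G_eq_wedge:
  "poly (phi \<zeta>) x * poly (psi \<zeta>) y - poly (phi \<zeta>) y * poly (psi \<zeta>) x = G \<zeta> x y * (x - y)"
  by (simp add: phi_def psi_def G_def algebra_simps power2_eq_square)

lemma F_eq_wedge:
  "(poly (phi \<zeta>) y * poly (psi \<zeta>) z - poly (phi \<zeta>) z * poly (psi \<zeta>) y) * poly chi x -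
    poly chi y * (poly (phi \<zeta>) x * poly (psi \<zeta>) z - poly (phi \<zeta>) z * poly (psi \<zeta>) x) +
    poly chi z * (poly (phi \<zeta>) x * poly (psi \<zeta>) y - poly (phi \<zeta>) y * poly (psi \<zeta>) x) =
   F \<zeta> x y z * ((y - x) * (z - x) * (z - y))"
  by (simp add: phi_def psi_def chi_def F_def algebra_simps power2_eq_square)

lemma G_commute: "G \<zeta> x y = G \<zeta> y x"
  by (simp add: G_def algebra_simps)

lemma prod_split_lessThan:
  "(\<Prod>k<a + b. f k) = (\<Prod>k<a. f k) * (\<Prod>i<b. f (a + i :: nat) :: 'a::comm_monoid_mult)"
  by (induction b) (simp_all add: mult.assoc)

text \<open>The nodes come in the order y, z, x, matching the rows of
  \<open>det_cauchy_type\<close>; \<open>Sg_linpoly\<close> makes the order immaterial in the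
  end.\<close>

definition pts :: "nat \<Rightarrow> (nat \<Rightarrow> 'a) \<Rightarrow> (nat \<Rightarrow> 'a) \<Rightarrow> 'a \<Rightarrow> nat \<Rightarrow> 'a" where
  "pts n x y z r = (if r < n then y r else if r = n then z else x (r - n - 1))"

lemma prod_pts:
  "(\<Prod>r<2 * n + 1. h (pts n x y z r)) = (\<Prod>r<n. h (y r)) * h z * (\<Prod>r<n. h (x r) :: 'a::comm_monoid_mult)"
proof -
  have "2 * n + 1 = n + (1 + n)" by simp
  then show ?thesis unfolding \<open>2 * n + 1 = _\<close> prod_split_lessThan by (simp add: pts_def mult.assoc)
qed

lemma vand_pts:
  fixes x y :: "nat \<Rightarrow> 'a::comm_ring_1"
  shows "vand (map (pts n x y z) [0..<2 * n + 1]) =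
    (\<Prod>j<n. \<Prod>i<j. y j - y i) * (\<Prod>k<n. z - y k) *
    ((\<Prod>i<n. \<Prod>l<n. x i - y l) * (\<Prod>i<n. x i - z) * (\<Prod>j<n. \<Prod>i<j. x j - x i))"
proof -
  let ?t = "pts n x y z"
  have "vand (map ?t [0..<2 * n + 1]) = (\<Prod>j<2 * n + 1. \<Prod>i<j. ?t j - ?t i)"
    unfolding vand_def by (auto intro!: prod.cong simp del: upt_Suc)
  also have "(\<Prod>j<2 * n + 1. \<Prod>i<j. ?t j - ?t i) =
      (\<Prod>j<n. \<Prod>i<j. y j - y i) * ((\<Prod>k<n. z - y k) *
      (\<Prod>i<n. (\<Prod>l<n. x i - y l) * (x i - z) * (\<Prod>k<i. x i - x k)))"
  proof -
    have "(\<Prod>j<n. \<Prod>i<j. ?t j - ?t i) = (\<Prod>j<n. \<Prod>i<j. y j - y i)"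
      by (auto simp: pts_def intro!: prod.cong)
    moreover have "(\<Prod>k<n. ?t n - ?t k) = (\<Prod>k<n. z - y k)"
      by (auto simp: pts_def intro!: prod.cong)
    moreover have "(\<Prod>k<n + (1 + i). ?t (n + (1 + i)) - ?t k) =
        (\<Prod>l<n. x i - y l) * (x i - z) * (\<Prod>k<i. x i - x k)" for i
      unfolding prod_split_lessThan[of _ n] prod_split_lessThan[of _ 1] by (simp add: pts_def)
    moreover have "2 * n + 1 = n + (1 + n)" by simp
    ultimately show ?thesis
      unfolding \<open>2 * n + 1 = _\<close> prod_split_lessThan[of _ n "1 + n"] prod_split_lessThan[of _ 1 n] by simp
  qed
  finally show ?thesis by (simp only: prod.distrib mult_ac)
qed

text \<open>Exactly what allows divisions in the Cauchy argument: \<open>psi\<close> must be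
  invertible at the nodes, and by \<open>G_eq_wedge\<close> the quotients phi/psi differ at two
  nodes when these are distinct with nonzero G.\<close>

definition generic :: "'a::field \<Rightarrow> nat \<Rightarrow> (nat \<Rightarrow> 'a) \<Rightarrow> (nat \<Rightarrow> 'a) \<Rightarrow> 'a \<Rightarrow> bool" where
  "generic \<zeta> n x y z \<longleftrightarrow> poly (psi \<zeta>) z \<noteq> 0 \<and>
     (\<forall>i<n. poly (psi \<zeta>) (x i) \<noteq> 0 \<and> poly (psi \<zeta>) (y i) \<noteq> 0 \<and>
        x i \<noteq> z \<and> y i \<noteq> z \<and> G \<zeta> (y i) z \<noteq> 0 \<and>
        (\<forall>j<n. x i \<noteq> y j \<and> G \<zeta> (x i) (y j) \<noteq> 0 \<and>
          (i \<noteq> j \<longrightarrow> x i \<noteq> x j \<and> y i \<noteq> y j \<and> G \<zeta> (y i) (y j) \<noteq> 0)))"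

text \<open>Dividing each row of the alternant by the n-th power of \<open>psi\<close> gives the
  matrix of \<open>det_cauchy_type\<close> for f = phi/psi and g = chi/psi. The wedge identities
  turn the resulting entries into F/G up to row and column factors; comparing these with the
  Vandermonde product of all nodes leaves the differences among the x and among the y.\<close>

lemma Sg_cauchy:
  fixes x y :: "nat \<Rightarrow> 'a::field"
  assumes gen: "generic \<zeta> n x y z"
  shows "Sg n \<zeta> (map (pts n x y z) [0..<2 * n + 1]) * (\<Prod>j<n. \<Prod>i<j. (x j - x i) * (y j - y i)) =
    (\<Prod>i<n. \<Prod>j<n. G \<zeta> (x i) (y j)) *
    det (mat n n (\<lambda>(i, j). F \<zeta> (x i) (y j) z / G \<zeta> (x i) (y j)))"
proof -
  let ?N = "2 * n + 1"
  let ?sg = "(-1) ^ (\<Sum>l\<le>n. l) :: 'a"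
  let ?M = "mat n n (\<lambda>(i, j). F \<zeta> (x i) (y j) z / G \<zeta> (x i) (y j))"
  define t where "t = pts n x y z"
  define ps where "ps s = poly (psi \<zeta>) s" for s
  define f where "f s = poly (phi \<zeta>) s / ps s" for s
  define g where "g s = poly chi s / ps s" for s
  define U where "U = ufam n (phi \<zeta>) (psi \<zeta>) chi"
  have ps: "ps z \<noteq> 0" "i < n \<Longrightarrow> ps (x i) \<noteq> 0" "i < n \<Longrightarrow> ps (y i) \<noteq> 0" for i
    using gen by (auto simp: generic_def ps_def)
  have tps: "ps (t r) \<noteq> 0" if "r < ?N" for r
    using that ps by (auto simp: t_def pts_def)
  have fdiff: "f a - f b = G \<zeta> a b * (a - b) / (ps a * ps b)" if "ps a \<noteq> 0" "ps b \<noteq> 0" for a b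
    using G_eq_wedge[of \<zeta> a b] that by (simp add: f_def ps_def field_simps)
  have ftdist: "f (t i) \<noteq> f (t j)" if "i < j" "j \<le> n" for i j
  proof -
    have "G \<zeta> (t i) (t j) * (t i - t j) / (ps (t i) * ps (t j)) \<noteq> 0"
      using that gen ps by (auto simp: t_def pts_def generic_def)
    then show ?thesis using fdiff[of "t i" "t j"] tps[of i] tps[of j] that by auto
  qed
  have "det (mat ?N ?N (\<lambda>(r, j). poly (U j) (t r))) =
      det (mat ?N ?N (\<lambda>(r, j). ps (t r) ^ n * (if j \<le> n then f (t r) ^ j else g (t r) * f (t r) ^ (j - n - 1)) * 1))"
  proof (intro arg_cong[of _ _ det] cong_mat refl, clarify)
    fix r j assume rj: "r < ?N" "j < ?N"
    show "poly (U j) (t r) =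
        ps (t r) ^ n * (if j \<le> n then f (t r) ^ j else g (t r) * f (t r) ^ (j - n - 1)) * 1"
    proof (cases "j \<le> n")
      case True
      then have "ps (t r) ^ n = ps (t r) ^ j * ps (t r) ^ (n - j)" by (simp add: power_add[symmetric])
      then show ?thesis using True tps[OF rj(1)]
        by (simp add: U_def ufam_def f_def ps_def[symmetric] power_divide)
    next
      case False
      then have "n = Suc ((j - n - 1) + (2 * n - j))" using rj by simp
      then have "ps (t r) ^ n = ps (t r) * (ps (t r) ^ (j - n - 1) * ps (t r) ^ (2 * n - j))"
        by (metis power_Suc power_add)
      then show ?thesis using False tps[OF rj(1)]
        by (simp add: U_def ufam_def f_def g_def ps_def[symmetric] power_divide)
    qed
  qed
  also have "\<dots> = (\<Prod>r<?N. ps (t r) ^ n) * det (mat ?N ?N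
      (\<lambda>(r, j). if j \<le> n then f (t r) ^ j else g (t r) * f (t r) ^ (j - n - 1)))"
    by (subst det_scale_rows_cols) simp
  also have "det (mat ?N ?N (\<lambda>(r, j). if j \<le> n then f (t r) ^ j else g (t r) * f (t r) ^ (j - n - 1))) =
    ?sg * det (mat n n (\<lambda>(i, k). (\<Prod>l\<in>{..<n} - {k}. f (t (n + 1 + i)) - f (t l)) *
      ((f (t k) - f (t n)) * g (t (n + 1 + i)) - g (t k) * (f (t (n + 1 + i)) - f (t n)) +
       g (t n) * (f (t (n + 1 + i)) - f (t k)))))"
    by (rule det_cauchy_type) (rule ftdist)
  also have "mat n n (\<lambda>(i, k). (\<Prod>l\<in>{..<n} - {k}. f (t (n + 1 + i)) - f (t l)) *
      ((f (t k) - f (t n)) * g (t (n + 1 + i)) - g (t k) * (f (t (n + 1 + i)) - f (t n)) +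
       g (t n) * (f (t (n + 1 + i)) - f (t k)))) =
    mat n n (\<lambda>(i, k). ((\<Prod>l<n. f (x i) - f (y l)) * (x i - z) / ps z) *
      (F \<zeta> (x i) (y k) z / G \<zeta> (x i) (y k)) * (z - y k))"
  proof (intro cong_mat refl, clarify)
    fix i k assume ik: "i < n" "k < n"
    have t: "t (n + 1 + i) = x i" "t k = y k" "t n = z" "\<And>l. l < n \<Longrightarrow> t l = y l"
      using ik by (auto simp: t_def pts_def)
    \<comment> \<open>Completing the product by its factor at k makes it a factor of the whole row.
      The entry must then be divided by \<open>f (x i) - f (y k)\<close>, which is where the
      denominator G arises.\<close>
    have P: "(\<Prod>l<n. f (x i) - f (y l)) = (f (x i) - f (y k)) * (\<Prod>l\<in>{..<n} - {k}. f (x i) - f (t l))"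
      using ik t(4) by (subst prod.remove[of _ k]) auto
    have "((f (y k) - f z) * g (x i) - g (y k) * (f (x i) - f z) + g z * (f (x i) - f (y k))) *
        (ps (x i) * ps (y k) * ps z) =
        F \<zeta> (x i) (y k) z * ((y k - x i) * (z - x i) * (z - y k))"
      unfolding F_eq_wedge[symmetric] ps_def[symmetric] using ps ik
      by (simp add: f_def g_def field_simps)
    moreover have "(f (x i) - f (y k)) * (ps (x i) * ps (y k)) = G \<zeta> (x i) (y k) * (x i - y k)"
      using fdiff[of "x i" "y k"] ps ik by simp
    moreover have "G \<zeta> (x i) (y k) \<noteq> 0" using gen ik by (auto simp: generic_def)
    ultimately have "((f (y k) - f z) * g (x i) - g (y k) * (f (x i) - f z) + g z * (f (x i) - f (y k))) =
       (f (x i) - f (y k)) * ((x i - z) / ps z * (F \<zeta> (x i) (y k) z / G \<zeta> (x i) (y k)) * (z - y k))"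
      (is "?D = ?E * _")
    proof -
      let ?g = "G \<zeta> (x i) (y k)" and ?F = "F \<zeta> (x i) (y k) z"
      assume D: "?D * (ps (x i) * ps (y k) * ps z) = ?F * ((y k - x i) * (z - x i) * (z - y k))"
        and E: "?E * (ps (x i) * ps (y k)) = ?g * (x i - y k)" and g0: "?g \<noteq> 0"
      have nz: "ps (x i) * ps (y k) * ps z \<noteq> 0" using ps ik by simp
      have "?E * ((x i - z) / ps z * (?F / ?g) * (z - y k)) * (ps (x i) * ps (y k) * ps z) =
          (?E * (ps (x i) * ps (y k))) * ((x i - z) * (?F / ?g) * (z - y k))"
        using ps(1) by simp
      also have "\<dots> = (x i - y k) * ((x i - z) * ?F * (z - y k))"
        unfolding E using g0 by simp
      also have "\<dots> = ?D * (ps (x i) * ps (y k) * ps z)" unfolding D by (simp add: algebra_simps)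
      finally show ?thesis using nz by (metis mult_right_cancel)
    qed
    then show "(\<Prod>l\<in>{..<n} - {k}. f (t (n + 1 + i)) - f (t l)) *
      ((f (t k) - f (t n)) * g (t (n + 1 + i)) - g (t k) * (f (t (n + 1 + i)) - f (t n)) +
       g (t n) * (f (t (n + 1 + i)) - f (t k))) =
      ((\<Prod>l<n. f (x i) - f (y l)) * (x i - z) / ps z) *
      (F \<zeta> (x i) (y k) z / G \<zeta> (x i) (y k)) * (z - y k)"
      unfolding t P by (simp add: mult_ac)
  qed
  also have "det \<dots> = (\<Prod>i<n. (\<Prod>l<n. f (x i) - f (y l)) * (x i - z) / ps z) * (\<Prod>k<n. z - y k) * det ?M"
    by (rule det_scale_rows_cols)
  also have "(\<Prod>i<n. (\<Prod>l<n. f (x i) - f (y l)) * (x i - z) / ps z) =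
      (\<Prod>i<n. \<Prod>l<n. f (x i) - f (y l)) * (\<Prod>i<n. x i - z) / ps z ^ n"
    by (simp add: prod_dividef prod.distrib)
  also have "(\<Prod>i<n. \<Prod>l<n. f (x i) - f (y l)) =
      (\<Prod>i<n. \<Prod>l<n. G \<zeta> (x i) (y l) * (x i - y l) / (ps (x i) * ps (y l)))"
    using ps by (intro prod.cong refl fdiff) auto
  also have "\<dots> = (\<Prod>i<n. \<Prod>l<n. G \<zeta> (x i) (y l)) * (\<Prod>i<n. \<Prod>l<n. x i - y l) /
      ((\<Prod>i<n. ps (x i)) ^ n * (\<Prod>l<n. ps (y l)) ^ n)"
    by (simp add: prod_dividef prod.distrib prod_power_distrib)
  also have "(\<Prod>r<?N. ps (t r) ^ n) = (\<Prod>i<n. ps (y i)) ^ n * ps z ^ n * (\<Prod>l<n. ps (x l)) ^ n"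
    unfolding t_def prod_pts[of "\<lambda>s. ps s ^ n"] by (simp add: prod_power_distrib)
  finally have det1: "det (mat ?N ?N (\<lambda>(r, j). poly (U j) (t r))) =
      ?sg * ((\<Prod>i<n. \<Prod>l<n. G \<zeta> (x i) (y l)) * (\<Prod>i<n. \<Prod>l<n. x i - y l) *
      (\<Prod>i<n. x i - z) * (\<Prod>k<n. z - y k) * det ?M)"
    using ps by (simp add: field_simps)
  have det2: "det (mat ?N ?N (\<lambda>(r, j). poly (U j) (t r))) =
      vand (map t [0..<?N]) * rdet U (linpoly (map t [0..<?N]))"
  proof -
    have "mat ?N ?N (\<lambda>(r, j). poly (U j) (t r)) =
        mat ?N ?N (\<lambda>(r, j). poly (U j) (map t [0..<?N] ! r))"
      by (intro cong_mat) (auto simp del: upt_Suc)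
    then show ?thesis using det_poly_eval[of "map t [0..<?N]" ?N U] by (simp del: upt_Suc)
  qed
  have "(\<Prod>i<n. \<Prod>l<n. x i - y l) * (\<Prod>i<n. x i - z) * (\<Prod>k<n. z - y k) \<noteq> 0" (is "?c \<noteq> 0")
    using gen by (auto simp: generic_def)
  moreover have "?c * (Sg n \<zeta> (map t [0..<?N]) * (\<Prod>j<n. \<Prod>i<j. (x j - x i) * (y j - y i))) =
      ?c * ((\<Prod>i<n. \<Prod>j<n. G \<zeta> (x i) (y j)) * det ?M)"
  proof -
    have sg: "?sg * ?sg = 1" by (simp add: power_mult_distrib[symmetric])
    have "?sg * det (mat ?N ?N (\<lambda>(r, j). poly (U j) (t r))) =
        ?c * ((\<Prod>i<n. \<Prod>j<n. G \<zeta> (x i) (y j)) * det ?M)"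
      unfolding det1 mult.assoc[symmetric] sg by (simp add: mult_ac)
    then show ?thesis
      unfolding det2 unfolding t_def vand_pts Sg_def U_def by (simp only: prod.distrib mult_ac)
  qed
  ultimately have "Sg n \<zeta> (map t [0..<?N]) * (\<Prod>j<n. \<Prod>i<j. (x j - x i) * (y j - y i)) =
      (\<Prod>i<n. \<Prod>j<n. G \<zeta> (x i) (y j)) * det ?M" by (simp only: mult_cancel_left) simp
  then show ?thesis by (simp only: t_def)
qed

text \<open>The Jacobi identity for the matrix F/G. Each determinant is an \<open>Sg\<close> up to
  G-products and Vandermonde products, and these agree in all three terms except for factors
  involving only the two corner indices.\<close>

lemma Sg_desnanot:
  fixes x y :: "nat \<Rightarrow> 'a::field"
  assumes gen: "generic \<zeta> (m + 2) x y z"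
  defines "T \<equiv> \<lambda>k a b. map (pts k (x \<circ> skip_index m a) (y \<circ> skip_index m b) z) [0..<2 * k + 1]"
  shows "(x (m + 1) - x m) * (y (m + 1) - y m) *
      Sg (m + 2) \<zeta> (map (pts (m + 2) x y z) [0..<2 * (m + 2) + 1]) *
      Sg m \<zeta> (map (pts m x y z) [0..<2 * m + 1]) =
    G \<zeta> (x m) (y (m + 1)) * G \<zeta> (x (m + 1)) (y m) *
      Sg (m + 1) \<zeta> (T (m + 1) m m) * Sg (m + 1) \<zeta> (T (m + 1) (m + 1) (m + 1)) -
    G \<zeta> (x m) (y m) * G \<zeta> (x (m + 1)) (y (m + 1)) *
      Sg (m + 1) \<zeta> (T (m + 1) m (m + 1)) * Sg (m + 1) \<zeta> (T (m + 1) (m + 1) m)"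
proof -
  define c where "c i j = F \<zeta> (x i) (y j) z / G \<zeta> (x i) (y j)" for i j
  define g where "g i j = G \<zeta> (x i) (y j)" for i j
  define V where "V h k = (\<Prod>j<k. \<Prod>i<j. h j - h i :: 'a)" for h :: "nat \<Rightarrow> 'a" and k
  define W where "W h a = (\<Prod>i<m. h a - h i :: 'a)" for h :: "nat \<Rightarrow> 'a" and a
  define P where "P = (\<Prod>i<m. \<Prod>j<m. g i j)"
  define R where "R a = (\<Prod>j<m. g a j)" for a
  define C where "C b = (\<Prod>i<m. g i b)" for b
  define M where "M a b = det (mat (m + 1) (m + 1) (\<lambda>(i, j). c (skip_index m a i) (skip_index m b j)))" for a b
  define M0 where "M0 = det (mat m m (\<lambda>(i, j). c i j))"
  define M2 where "M2 = det (mat (m + 2) (m + 2) (\<lambda>(i, j). c i j))"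
  define S1 where "S1 a b = Sg (m + 1) \<zeta> (T (m + 1) a b)" for a b
  define S0 where "S0 = Sg m \<zeta> (map (pts m x y z) [0..<2 * m + 1])"
  define S2 where "S2 = Sg (m + 2) \<zeta> (map (pts (m + 2) x y z) [0..<2 * (m + 2) + 1])"
  define dx where "dx = x (m + 1) - x m"
  define dy where "dy = y (m + 1) - y m"
  have jac: "M2 * M0 = M m m * M (m + 1) (m + 1) - M m (m + 1) * M (m + 1) m"
    unfolding M_def M0_def M2_def by (rule desnanot_jacobi)
  have gen0: "generic \<zeta> m x y z" using gen by (auto simp: generic_def)
  have gen1: "generic \<zeta> (m + 1) (x \<circ> skip_index m a) (y \<circ> skip_index m b) z"
    if "a \<in> {m, m + 1}" "b \<in> {m, m + 1}" for a b
  proof -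
    have "skip_index m a i < m + 2" "skip_index m b i < m + 2" for i
      using that by (auto simp: skip_index_def)
    moreover have "skip_index m a i \<noteq> skip_index m a j" "skip_index m b i \<noteq> skip_index m b j"
      if "i < m + 1" "j < m + 1" "i \<noteq> j" for i j
      using that \<open>a \<in> _\<close> \<open>b \<in> _\<close> by (auto simp: skip_index_def)
    ultimately show ?thesis using gen unfolding generic_def o_def by metis
  qed
  have e0: "S0 * (V x m * V y m) = P * M0"
    using Sg_cauchy[OF gen0] by (simp add: S0_def V_def P_def M0_def c_def g_def prod.distrib)
  have e2: "S2 * (V x m * W x m * (W x (m + 1) * dx) * (V y m * W y m * (W y (m + 1) * dy))) =
      P * (R m * C m * g m m) * (R (m + 1) * C (m + 1) * g m (m + 1) * g (m + 1) m * g (m + 1) (m + 1)) * M2"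
    using Sg_cauchy[OF gen]
    by (simp add: S2_def V_def W_def P_def M2_def c_def g_def R_def C_def dx_def dy_def
        prod.distrib mult_ac del: upt_Suc)
  have e1: "S1 a b * (V x m * W x a * (V y m * W y b)) = P * R a * C b * g a b * M a b"
    if "a \<in> {m, m + 1}" "b \<in> {m, m + 1}" for a b
  proof -
    have "(\<Prod>j<m + 1. \<Prod>i<j. (x \<circ> skip_index m a) j - (x \<circ> skip_index m a) i) = V x m * W x a"
      "(\<Prod>j<m + 1. \<Prod>i<j. (y \<circ> skip_index m b) j - (y \<circ> skip_index m b) i) = V y m * W y b"
      by (auto simp: V_def W_def skip_index_def intro!: arg_cong2[of _ _ _ _ "(*)"] prod.cong)
    moreover have "(\<Prod>i<m + 1. \<Prod>j<m + 1. G \<zeta> ((x \<circ> skip_index m a) i) ((y \<circ> skip_index m b) j)) =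
        P * R a * C b * g a b"
      by (simp add: P_def R_def C_def g_def skip_index_def prod.distrib mult_ac)
    ultimately show ?thesis
      using Sg_cauchy[OF gen1[OF that]]
      by (simp only: S1_def M_def T_def c_def prod.distrib o_def)
  qed
  have nz: "V x m * W x m * W x (m + 1) \<noteq> 0" "V y m * W y m * W y (m + 1) \<noteq> 0" "V x m \<noteq> 0" "V y m \<noteq> 0"
    using gen by (auto simp: V_def W_def generic_def)
  \<comment> \<open>\<open>?K\<close> collects the Vandermonde factors and \<open>?Q\<close> the
    G-factors common to the three terms.\<close>
  let ?K = "V x m * W x m * W x (m + 1) * (V y m * W y m * W y (m + 1)) * (V x m * V y m)"
  let ?Q = "P * R m * R (m + 1) * C m * C (m + 1) * P * g m m * g m (m + 1) * g (m + 1) m * g (m + 1) (m + 1)"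
  have "?K * (dx * dy * S2 * S0) =
      (S2 * (V x m * W x m * (W x (m + 1) * dx) * (V y m * W y m * (W y (m + 1) * dy)))) * (S0 * (V x m * V y m))"
    by (simp only: mult_ac)
  also have "\<dots> = ?Q * (M2 * M0)" unfolding e0 e2 by (simp only: mult_ac)
  also have "\<dots> = ?Q * (M m m * M (m + 1) (m + 1)) - ?Q * (M m (m + 1) * M (m + 1) m)"
    unfolding jac by (simp only: right_diff_distrib)
  also have "?Q * (M m m * M (m + 1) (m + 1)) = g m (m + 1) * g (m + 1) m *
      ((P * R m * C m * g m m * M m m) *
       (P * R (m + 1) * C (m + 1) * g (m + 1) (m + 1) * M (m + 1) (m + 1)))"
    by (simp only: mult_ac)
  also have "\<dots> = ?K * (g m (m + 1) * g (m + 1) m * S1 m m * S1 (m + 1) (m + 1))"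
    unfolding e1[OF insertI1 insertI1, symmetric] e1[OF insertI2 insertI2, OF insertI1 insertI1, symmetric]
    by (simp only: mult_ac)
  also have "?Q * (M m (m + 1) * M (m + 1) m) = g m m * g (m + 1) (m + 1) *
      ((P * R m * C (m + 1) * g m (m + 1) * M m (m + 1)) *
       (P * R (m + 1) * C m * g (m + 1) m * M (m + 1) m))"
    by (simp only: mult_ac)
  also have "\<dots> = ?K * (g m m * g (m + 1) (m + 1) * S1 m (m + 1) * S1 (m + 1) m)"
    unfolding e1[OF insertI1 insertI2, OF insertI1, symmetric] e1[OF insertI2 insertI1, OF insertI1, symmetric]
    by (simp only: mult_ac)
  finally have "?K * (dx * dy * S2 * S0) = ?K * (g m (m + 1) * g (m + 1) m * S1 m m * S1 (m + 1) (m + 1) -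
      g m m * g (m + 1) (m + 1) * S1 m (m + 1) * S1 (m + 1) m)"
    by (simp only: right_diff_distrib)
  moreover have "?K \<noteq> 0" using nz by simp
  ultimately have "dx * dy * S2 * S0 = g m (m + 1) * g (m + 1) m * S1 m m * S1 (m + 1) (m + 1) -
      g m m * g (m + 1) (m + 1) * S1 m (m + 1) * S1 (m + 1) m"
    by (simp only: mult_cancel_left) simp
  then show ?thesis by (simp only: dx_def dy_def S2_def S0_def g_def S1_def)
qed

section \<open>Base change and symmetry of the remainder determinants\<close>

lemma map_poly_phi_psi_chi:
  assumes "comm_ring_hom h"
  shows "map_poly h (phi \<zeta>) = phi (h \<zeta>)" "map_poly h (psi \<zeta>) = psi (h \<zeta>)" "map_poly h chi = chi"
proof -
  interpret comm_ring_hom h by fact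
  have "h 2 = 2" using hom_add[of 1 1] by simp
  then show "map_poly h (phi \<zeta>) = phi (h \<zeta>)" "map_poly h (psi \<zeta>) = psi (h \<zeta>)" "map_poly h chi = chi"
    by (simp_all add: phi_def psi_def chi_def map_poly_pCons_hom hom_distribs)
qed

lemma map_poly_ufam:
  assumes "comm_ring_hom h"
  shows "map_poly h (ufam n f g c j) = ufam n (map_poly h f) (map_poly h g) (map_poly h c) j"
proof -
  interpret comm_ring_hom h by fact
  interpret hp: map_poly_comm_ring_hom h ..
  show ?thesis unfolding ufam_def if_distrib[of "map_poly h"] by (simp only: hp.hom_mult hp.hom_power)
qed

lemma Sg_hom:
  fixes h :: "'a::comm_ring_1 \<Rightarrow> 'b::comm_ring_1"
  assumes "comm_ring_hom h"
  shows "h (Sg n \<zeta> ts) = Sg n (h \<zeta>) (map h ts)"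
proof -
  interpret comm_ring_hom h by fact
  have "h (rdet (ufam n (phi \<zeta>) (psi \<zeta>) chi) (linpoly ts)) =
      rdet (ufam n (phi (h \<zeta>)) (psi (h \<zeta>)) chi) (linpoly (map h ts))"
    unfolding rdet_hom[OF assms linpoly_monic(1)]
    by (simp only: map_poly_linpoly[OF assms] map_poly_ufam[OF assms] map_poly_phi_psi_chi[OF assms])
  then show ?thesis unfolding Sg_def by (simp only: hom_mult hom_power hom_uminus hom_one)
qed

text \<open>The symmetry of \<open>S\<close> in all its variables: only the multiset of nodes
  enters.\<close>

lemma Sg_linpoly: "linpoly ts = linpoly us \<Longrightarrow> Sg n \<zeta> ts = Sg n \<zeta> us"
  by (simp add: Sg_def)

section \<open>Evaluation of multivariate polynomials and identification with
  \<open>S\<close>\<close>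

lemma poly_mapping_eq_sum_single:
  "P = (\<Sum>m\<in>Poly_Mapping.keys P. Poly_Mapping.single m (Poly_Mapping.lookup P m))"
proof (rule poly_mapping_eqI)
  fix k
  have "(\<Sum>m\<in>Poly_Mapping.keys P. Poly_Mapping.lookup P m when m = k) =
      (\<Sum>m\<in>Poly_Mapping.keys P. if m = k then Poly_Mapping.lookup P m else 0)"
    by (intro sum.cong) (auto simp: when_def)
  then show "Poly_Mapping.lookup P k =
      Poly_Mapping.lookup (\<Sum>m\<in>Poly_Mapping.keys P. Poly_Mapping.single m (Poly_Mapping.lookup P m)) k"
    by (auto simp: lookup_sum lookup_single in_keys_iff)
qed

definition mon_eval :: "(nat \<Rightarrow> 'a::comm_monoid_mult) \<Rightarrow> (nat \<Rightarrow>\<^sub>0 nat) \<Rightarrow> 'a" where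
  "mon_eval v m = (\<Prod>i\<in>Poly_Mapping.keys m. v i ^ Poly_Mapping.lookup m i)"

lemma mon_eval_superset:
  assumes "finite A" "Poly_Mapping.keys m \<subseteq> A"
  shows "mon_eval v m = (\<Prod>i\<in>A. v i ^ Poly_Mapping.lookup m i)"
  unfolding mon_eval_def using assms by (intro prod.mono_neutral_left) (auto simp: in_keys_iff)

lemma mon_eval_add: "mon_eval v (m + m') = mon_eval v m * mon_eval v m'"
proof -
  let ?A = "Poly_Mapping.keys m \<union> Poly_Mapping.keys m'"
  have "mon_eval v (m + m') = (\<Prod>i\<in>?A. v i ^ Poly_Mapping.lookup (m + m') i)"
    using keys_add[of m m'] by (intro mon_eval_superset) auto
  also have "\<dots> = mon_eval v m * mon_eval v m'"
    by (simp add: mon_eval_superset[of ?A] lookup_add power_add prod.distrib)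
  finally show ?thesis .
qed

lemma meval_superset:
  assumes "finite A" "Poly_Mapping.keys P \<subseteq> A"
  shows "meval v P = (\<Sum>m\<in>A. to_fract (Poly_Mapping.lookup P m) * mon_eval v m)"
  unfolding meval_def mon_eval_def[symmetric] using assms
  by (intro sum.mono_neutral_left) (auto simp: in_keys_iff)

lemma meval_add: "meval v (P + Q) = meval v P + meval v Q"
proof -
  let ?A = "Poly_Mapping.keys P \<union> Poly_Mapping.keys Q"
  have "meval v (P + Q) = (\<Sum>m\<in>?A. to_fract (Poly_Mapping.lookup (P + Q) m) * mon_eval v m)"
    using keys_add[of P Q] by (intro meval_superset) auto
  also have "\<dots> = meval v P + meval v Q"
    by (simp add: meval_superset[of ?A] lookup_add distrib_right sum.distrib)
  finally show ?thesis .
qed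

lemma meval_single: "meval v (Poly_Mapping.single m c) = to_fract c * mon_eval v m"
  by (subst meval_superset[of "{m}"]) auto

lemma meval_sum: "meval v (\<Sum>k\<in>A. f k) = (\<Sum>k\<in>A. meval v (f k))"
  by (induction A rule: infinite_finite_induct) (auto simp: meval_add, simp_all add: meval_def)

lemma meval_comm_ring_hom: "comm_ring_hom (meval v)"
proof unfold_locales
  fix P Q :: mpoly
  let ?s = "\<lambda>P m. Poly_Mapping.single m (Poly_Mapping.lookup P m)"
  have "P * Q = (\<Sum>m\<in>Poly_Mapping.keys P. ?s P m) * (\<Sum>k\<in>Poly_Mapping.keys Q. ?s Q k)"
    by (rule arg_cong2[OF poly_mapping_eq_sum_single poly_mapping_eq_sum_single])
  then have "meval v (P * Q) = (\<Sum>m\<in>Poly_Mapping.keys P. \<Sum>k\<in>Poly_Mapping.keys Q. meval v (?s P m * ?s Q k))"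
    by (simp add: sum_product meval_sum)
  also have "\<dots> = (\<Sum>m\<in>Poly_Mapping.keys P. \<Sum>k\<in>Poly_Mapping.keys Q.
      (to_fract (Poly_Mapping.lookup P m) * mon_eval v m) * (to_fract (Poly_Mapping.lookup Q k) * mon_eval v k))"
    by (simp add: mult_single meval_single mon_eval_add mult_ac)
  also have "\<dots> = meval v P * meval v Q"
    unfolding meval_def mon_eval_def[symmetric] by (simp only: sum_product)
  finally show "meval v (P * Q) = meval v P * meval v Q" .
  have "meval v 1 = meval v (Poly_Mapping.single 0 1)" by simp
  also have "\<dots> = 1" unfolding meval_single by (simp add: mon_eval_def)
  finally show "meval v 1 = 1" .
qed (simp add: meval_def, rule meval_add)

lemma meval_mconst [simp]: "meval v (mconst c) = to_fract c"
  by (simp add: mconst_def meval_single mon_eval_def)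

lemma meval_mvar [simp]: "meval v (mvar i) = v i"
  by (simp add: mvar_def meval_single mon_eval_def)

lemma hom_F_G:
  assumes "comm_ring_hom h"
  shows "h (F \<zeta> x y z) = F (h \<zeta>) (h x) (h y) (h z)" "h (G \<zeta> x y) = G (h \<zeta>) (h x) (h y)"
    "h (poly (psi \<zeta>) x) = poly (psi (h \<zeta>)) (h x)"
proof -
  interpret comm_ring_hom h by fact
  have h2: "h 2 = 2" using hom_add[of 1 1] by simp
  have h3: "h 3 = 3" using hom_add[of 2 1] h2 by simp
  show "h (F \<zeta> x y z) = F (h \<zeta>) (h x) (h y) (h z)"
    by (simp add: F_def hom_distribs h2)
  show "h (G \<zeta> x y) = G (h \<zeta>) (h x) (h y)" by (simp add: G_def hom_distribs h2 h3)
  show "h (poly (psi \<zeta>) x) = poly (psi (h \<zeta>)) (h x)"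
    using poly_map_poly[of "psi \<zeta>" x] by (simp add: map_poly_phi_psi_chi[OF assms])
qed

definition zeta :: "rat poly fract" where "zeta = to_fract [:0, 1:]"

text \<open>This shows that \<open>S_fract\<close> lies in the polynomial ring, so
  \<open>of_fract\<close> in the definition of \<open>S\<close> returns a genuine preimage.\<close>

lemma S_fract_eq:
  "S_fract n = to_fract (Sg n (mconst [:0, 1:])
     (map (pts n mvar (\<lambda>j. mvar (n + j)) (mvar (2 * n))) [0..<2 * n + 1]))"
proof -
  let ?h = "to_fract :: mpoly \<Rightarrow> mpoly fract"
  let ?\<zeta> = "mconst [:0, 1:]"
  let ?x = "\<lambda>i. ?h (mvar i)" and ?y = "\<lambda>j. ?h (mvar (n + j))" and ?z = "?h (mvar (2 * n))"
  interpret h: inj_idom_hom ?h by (rule to_fract_comm_ring_hom)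
  have tf: "comm_ring_hom ?h" ..
  \<comment> \<open>Each genericity condition is a nonvanishing statement about a polynomial and is
    certified by one evaluation.\<close>
  have nz: "P \<noteq> 0" if "meval v P \<noteq> 0" for v P using that by (auto simp: meval_def)
  have z0: "zeta \<noteq> 0" by (simp add: zeta_def)
  have psi: "poly (psi ?\<zeta>) (mvar i) \<noteq> 0" for i
    by (rule nz[of "\<lambda>_. 0"]) (simp add: hom_F_G[OF meval_comm_ring_hom], simp add: psi_def)
  have neq: "mvar i \<noteq> mvar j" if "i \<noteq> j" for i j
  proof
    assume "mvar i = mvar j"
    then have "meval (\<lambda>k. if k = i then 0 else 1) (mvar i) = meval (\<lambda>k. if k = i then 0 else 1) (mvar j)" by simp
    then show False using that by simp
  qed
  have G: "G ?\<zeta> (mvar i) (mvar j) \<noteq> 0" if "i \<noteq> j" for i j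
  proof (rule nz[of "\<lambda>k. if k = i then 0 else 1"])
    have "G (to_fract [:0, 1:]) 0 (1 :: rat poly fract) = 2 * zeta\<^sup>2"
      by (simp add: G_def zeta_def power2_eq_square algebra_simps)
    then show "meval (\<lambda>k. if k = i then 0 else 1) (G ?\<zeta> (mvar i) (mvar j)) \<noteq> 0"
      using that z0 by (simp add: hom_F_G[OF meval_comm_ring_hom])
  qed
  have gen: "generic (?h ?\<zeta>) n ?x ?y ?z"
    unfolding generic_def hom_F_G(3)[OF tf, symmetric] hom_F_G(2)[OF tf, symmetric]
    using psi neq G by auto
  have map: "map (pts n ?x ?y ?z) [0..<2 * n + 1] =
      map ?h (map (pts n mvar (\<lambda>j. mvar (n + j)) (mvar (2 * n))) [0..<2 * n + 1])"
    by (auto simp: pts_def)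
  have V: "(\<Prod>j<n. \<Prod>i<j. (?x j - ?x i) * (?y j - ?y i)) \<noteq> 0" (is "?V \<noteq> 0")
    using neq by (auto simp: to_fract_diff[symmetric] simp del: to_fract_diff)
  have cancel: "a / b * c = d" if "b \<noteq> 0" "d * b = a * c" for a b c d :: "mpoly fract"
    using that by (metis nonzero_mult_div_cancel_right times_divide_eq_left)
  show ?thesis
    unfolding S_fract_def Let_def Sg_hom[OF tf] map[symmetric] by (rule cancel[OF V Sg_cauchy[OF gen]])
qed

lemma meval_S: "meval v (S n) = Sg n zeta (map v [0..<2 * n + 1])"
proof -
  have "meval v (S n) = Sg n zeta (map (meval v) (map (pts n mvar (\<lambda>j. mvar (n + j)) (mvar (2 * n))) [0..<2 * n + 1]))"
    unfolding S_def S_fract_eq of_fract_to_fract Sg_hom[OF meval_comm_ring_hom] by (simp add: zeta_def)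
  also have "map (meval v) (map (pts n mvar (\<lambda>j. mvar (n + j)) (mvar (2 * n))) [0..<2 * n + 1]) =
      map (pts n v (\<lambda>j. v (n + j)) (v (2 * n))) [0..<2 * n + 1]"
    by (auto simp: pts_def)
  \<comment> \<open>The variables are numbered x, y, z while \<open>pts\<close> lists y, z, x; both
    lists have the same linear factors.\<close>
  also have "linpoly \<dots> = linpoly (map v [0..<2 * n + 1])"
  proof -
    have l: "linpoly (map t [0..<k]) = (\<Prod>r<k. [:- t r, 1:])" for t :: "nat \<Rightarrow> rat poly fract" and k
      by (induction k) (simp_all add: mult.commute del: mult_pCons_left mult_pCons_right)
    define L where "L i = [:- v i, 1:]" for i
    have "(\<Prod>r<2 * n + 1. L r) = (\<Prod>r<n. L r) * (\<Prod>r<n. L (n + r)) * L (2 * n)"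
      using prod_split_lessThan[of L n n] by (simp add: mult_2)
    then show ?thesis unfolding l prod_pts[of "\<lambda>t. [:- t, 1:]"] L_def by (simp only: mult_ac)
  qed
  from Sg_linpoly[OF this] show ?thesis unfolding calculation .
qed

section \<open>Coinciding nodes and the recurrence for two values\<close>

lemma linpoly_map_upt: "linpoly (map t [0..<k]) = (\<Prod>r<k. [:- t r, 1:])"
  by (induction k) (simp_all add: mult.commute del: mult_pCons_left mult_pCons_right)

lemma map_pts: "map h (map (pts k x y z) l) = map (pts k (h \<circ> x) (h \<circ> y) (h z)) l"
  by (auto simp: pts_def)

text \<open>The nodes need not be distinct: perturb them to first order in a new indeterminate.\<close>

lemma Sg_desnanot_confluent:
  fixes x y :: "nat \<Rightarrow> 'a::field_char_0" and m :: nat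
  assumes "\<zeta> + 2 \<noteq> 0"
    and Gnz: "\<And>i j. G \<zeta> (x i) (y j) \<noteq> 0" "\<And>i j. G \<zeta> (y i) (y j) \<noteq> 0" "\<And>i. G \<zeta> (y i) z \<noteq> 0"
  defines "T \<equiv> \<lambda>k a b. map (pts k (x \<circ> skip_index m a) (y \<circ> skip_index m b) z) [0..<2 * k + 1]"
  shows "(x (m + 1) - x m) * (y (m + 1) - y m) *
      Sg (m + 2) \<zeta> (map (pts (m + 2) x y z) [0..<2 * (m + 2) + 1]) *
      Sg m \<zeta> (map (pts m x y z) [0..<2 * m + 1]) =
    G \<zeta> (x m) (y (m + 1)) * G \<zeta> (x (m + 1)) (y m) *
      Sg (m + 1) \<zeta> (T (m + 1) m m) * Sg (m + 1) \<zeta> (T (m + 1) (m + 1) (m + 1)) -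
    G \<zeta> (x m) (y m) * G \<zeta> (x (m + 1)) (y (m + 1)) *
      Sg (m + 1) \<zeta> (T (m + 1) m (m + 1)) * Sg (m + 1) \<zeta> (T (m + 1) (m + 1) m)"
proof -
  define L :: "'a \<Rightarrow> nat \<Rightarrow> 'a poly" where "L c k = [:c, of_nat k:]" for c k
  \<comment> \<open>The slopes 1..m+2, m+3..2m+4 and 2m+10 of the nodes concerned are distinct,
    which separates the nodes, and positive, which keeps \<open>psi\<close> from vanishing on them
    because zeta + 2 is nonzero.\<close>
  define X where "X i = L (x i) (i + 1)" for i
  define Y where "Y i = L (y i) (m + 3 + i)" for i
  define Z where "Z = L z (2 * m + 10)"
  have Lne: "L c k \<noteq> L d l" if "k \<noteq> l" for c d k l using that by (simp add: L_def)
  let ?h = "to_fract :: 'a poly \<Rightarrow> 'a poly fract"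
  interpret h: inj_idom_hom ?h by (rule to_fract_comm_ring_hom)
  have tf: "comm_ring_hom ?h" ..
  have ev: "comm_ring_hom (\<lambda>f :: 'a poly. poly f 0)" by (rule poly_eval_comm_ring_hom)
  have ev': "poly (X i) 0 = x i" "poly (Y i) 0 = y i" "poly Z 0 = z" for i
    by (simp_all add: X_def Y_def Z_def L_def)
  have psi: "poly (psi [:\<zeta>:]) (L c k) \<noteq> 0" if "k > 0" for c k
  proof -
    have "poly (psi [:\<zeta>:]) (L c k) = [:(\<zeta> + 2) * c - \<zeta>, (\<zeta> + 2) * of_nat k:]"
      by (simp add: L_def psi_def one_pCons numeral_poly algebra_simps)
    then show ?thesis using that assms(1) by simp
  qed
  have G0: "G [:\<zeta>:] A B \<noteq> 0" if "G \<zeta> (poly A 0) (poly B 0) \<noteq> 0" for A B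
    using that hom_F_G(2)[OF ev, of "[:\<zeta>:]" A B] by auto
  have gen: "generic (?h [:\<zeta>:]) (m + 2) (?h \<circ> X) (?h \<circ> Y) (?h Z)"
    unfolding generic_def hom_F_G(3)[OF tf, symmetric] hom_F_G(2)[OF tf, symmetric] o_def
    using Gnz by (auto intro!: G0 simp: ev' simp del: to_fract_0)
      (auto simp: X_def Y_def Z_def psi Lne)
  have Gh: "?h (G [:\<zeta>:] A B) = G (?h [:\<zeta>:]) (?h A) (?h B)" for A B by (rule hom_F_G(2)[OF tf])
  note d = Sg_desnanot[OF gen]
  define R where "R k A B = Sg k [:\<zeta>:] (map (pts k A B Z) [0..<2 * k + 1])" for k A B
  have "?h ((X (m + 1) - X m) * (Y (m + 1) - Y m) * R (m + 2) X Y * R m X Y) =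
    ?h (G [:\<zeta>:] (X m) (Y (m + 1)) * G [:\<zeta>:] (X (m + 1)) (Y m) *
      R (m + 1) (X \<circ> skip_index m m) (Y \<circ> skip_index m m) *
      R (m + 1) (X \<circ> skip_index m (m + 1)) (Y \<circ> skip_index m (m + 1)) -
    G [:\<zeta>:] (X m) (Y m) * G [:\<zeta>:] (X (m + 1)) (Y (m + 1)) *
      R (m + 1) (X \<circ> skip_index m m) (Y \<circ> skip_index m (m + 1)) *
      R (m + 1) (X \<circ> skip_index m (m + 1)) (Y \<circ> skip_index m m))"
    unfolding h.hom_mult h.hom_minus R_def Sg_hom[OF tf] map_pts Gh
    using d by (simp only: o_def)
  then have "(X (m + 1) - X m) * (Y (m + 1) - Y m) * R (m + 2) X Y * R m X Y =
    G [:\<zeta>:] (X m) (Y (m + 1)) * G [:\<zeta>:] (X (m + 1)) (Y m) *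
      R (m + 1) (X \<circ> skip_index m m) (Y \<circ> skip_index m m) *
      R (m + 1) (X \<circ> skip_index m (m + 1)) (Y \<circ> skip_index m (m + 1)) -
    G [:\<zeta>:] (X m) (Y m) * G [:\<zeta>:] (X (m + 1)) (Y (m + 1)) *
      R (m + 1) (X \<circ> skip_index m m) (Y \<circ> skip_index m (m + 1)) *
      R (m + 1) (X \<circ> skip_index m (m + 1)) (Y \<circ> skip_index m m)"
    by (simp only: to_fract_eq_iff)
  note e = arg_cong[OF this, of "\<lambda>f. poly f 0"]
  have R0: "poly (R k (X \<circ> f) (Y \<circ> g)) 0 = Sg k \<zeta> (map (pts k (x \<circ> f) (y \<circ> g) z) [0..<2 * k + 1])"
    "poly (R k X Y) 0 = Sg k \<zeta> (map (pts k x y z) [0..<2 * k + 1])" for k f g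
    unfolding R_def Sg_hom[OF ev] map_pts by (simp_all add: o_def ev')
  have G0: "poly (G [:\<zeta>:] A B) 0 = G \<zeta> (poly A 0) (poly B 0)" for A B
    using hom_F_G(2)[OF ev, of "[:\<zeta>:]" A B] by simp
  show ?thesis
    using e unfolding poly_mult poly_diff R0 G0 ev' T_def .
qed

definition St :: "nat \<Rightarrow> 'a::comm_ring_1 \<Rightarrow> 'a \<Rightarrow> 'a \<Rightarrow> nat \<Rightarrow> 'a" where
  "St n \<zeta> c d a = Sg n \<zeta> (replicate a c @ replicate (2 * n + 1 - a) d)"

lemma Sg_pts_two_values:
  assumes "\<And>r. r < n \<Longrightarrow> x r = c \<or> x r = d" "\<And>r. r < n \<Longrightarrow> y r = c \<or> y r = d" "z = c \<or> z = d"
    and "a = card {r. r < n \<and> x r = c} + card {r. r < n \<and> y r = c} + of_bool (z = c)" "c \<noteq> d"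
  shows "Sg n \<zeta> (map (pts n x y z) [0..<2 * n + 1]) = St n \<zeta> c d a"
proof -
  let ?C = "[:-c, 1:]" and ?D = "[:-d, 1:]"
  have *: "(\<Prod>r<n. [:- w r, 1:]) = ?C ^ card {r. r < n \<and> w r = c} * ?D ^ (n - card {r. r < n \<and> w r = c})"
    if "\<And>r. r < n \<Longrightarrow> w r = c \<or> w r = d" for w
  proof -
    let ?A = "{r. r < n \<and> w r = c}"
    have cd: "card ({..<n} - ?A) = n - card ?A" by (subst card_Diff_subset) auto
    have "(\<Prod>r<n. [:- w r, 1:]) = (\<Prod>r\<in>?A. [:- w r, 1:]) * (\<Prod>r\<in>{..<n} - ?A. [:- w r, 1:])"
      by (subst prod.subset_diff[of ?A]) (auto simp: mult.commute)
    also have "(\<Prod>r\<in>?A. [:- w r, 1:]) = (\<Prod>r\<in>?A. ?C)" by (intro prod.cong) auto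
    also have "(\<Prod>r\<in>{..<n} - ?A. [:- w r, 1:]) = (\<Prod>r\<in>{..<n} - ?A. ?D)"
      using that by (intro prod.cong) auto
    finally show ?thesis by (simp only: prod_constant cd)
  qed
  have le: "card {r. r < n \<and> w r = c} \<le> n" for w
    using card_mono[of "{..<n}" "{r. r < n \<and> w r = c}"] by auto
  let ?kx = "card {r. r < n \<and> x r = c}" and ?ky = "card {r. r < n \<and> y r = c}"
  have "linpoly (map (pts n x y z) [0..<2 * n + 1]) =
      (?C ^ ?ky * ?D ^ (n - ?ky)) * [:-z, 1:] * (?C ^ ?kx * ?D ^ (n - ?kx))"
    unfolding linpoly_map_upt prod_pts[of "\<lambda>t. [:- t, 1:]"] using *[OF assms(1)] *[OF assms(2)] by simp
  also have "\<dots> = ?C ^ a * ?D ^ (2 * n + 1 - a)"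
  proof (cases "z = c")
    case True
    then have "a = ?ky + 1 + ?kx" "2 * n + 1 - a = (n - ?ky) + (n - ?kx)"
      using assms(4) le[of x] le[of y] by auto
    then show ?thesis using True by (simp only: power_add power_one_right mult_ac)
  next
    case False
    then have "z = d" "a = ?ky + ?kx" "2 * n + 1 - a = (n - ?ky) + 1 + (n - ?kx)"
      using assms(3,4) le[of x] le[of y] by auto
    then show ?thesis by (simp only: power_add power_one_right mult_ac)
  qed
  also have "\<dots> = linpoly (replicate a c @ replicate (2 * n + 1 - a) d)" by simp
  finally show ?thesis unfolding St_def by (rule Sg_linpoly)
qed

text \<open>With equal corner pairs for x and y the two mixed minors coincide and produce the
  square, while the remaining minors have one copy of \<open>c\<close> more and one less.\<close>

lemma St_desnanot:
  fixes \<zeta> c d :: "'a::field_char_0"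
  assumes "\<zeta> + 2 \<noteq> 0" "c \<noteq> d" "G \<zeta> c c \<noteq> 0" "G \<zeta> c d \<noteq> 0" "G \<zeta> d d \<noteq> 0"
  shows "(d - c)\<^sup>2 * St (m + 2) \<zeta> c d (m + 3) * St m \<zeta> c d (m + 1) =
    (G \<zeta> c d)\<^sup>2 * St (m + 1) \<zeta> c d (m + 3) * St (m + 1) \<zeta> c d (m + 1) -
    G \<zeta> c c * G \<zeta> d d * (St (m + 1) \<zeta> c d (m + 2))\<^sup>2"
proof -
  \<comment> \<open>Inner nodes are x = c and y = d, the corners are c at \<open>m\<close> and d at
    \<open>m + 1\<close> on both sides, and z = c. Counting copies of c gives m + 3 for the full
    matrix, m + 1 for the centre, and m + 3, m + 1, m + 2, m + 2 for the four minors.\<close>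
  define x where "x i = (if i \<le> m then c else d)" for i
  define y where "y j = (if j = m then c else d)" for j
  have G: "G \<zeta> d c \<noteq> 0" using assms(4) by (simp add: G_commute)
  have xs: "{r. r < m + 2 \<and> x r = c} = {..m}" "{r. r < m \<and> x r = c} = {..<m}"
    "{r. r < m + 1 \<and> (x \<circ> skip_index m m) r = c} = {..m}"
    "{r. r < m + 1 \<and> (x \<circ> skip_index m (m + 1)) r = c} = {..<m}"
    and ys: "{r. r < m + 2 \<and> y r = c} = {m}" "{r. r < m \<and> y r = c} = {}"
    "{r. r < m + 1 \<and> (y \<circ> skip_index m m) r = c} = {m}"
    "{r. r < m + 1 \<and> (y \<circ> skip_index m (m + 1)) r = c} = {}"
    using assms(2) by (auto simp: x_def y_def skip_index_def split: if_splits)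
  have xy: "x r = c \<or> x r = d" "y r = c \<or> y r = d" "(x \<circ> f) r = c \<or> (x \<circ> f) r = d"
    "(y \<circ> f) r = c \<or> (y \<circ> f) r = d" for f r by (auto simp: x_def y_def)
  note S0 = Sg_pts_two_values[OF xy(1) xy(2) disjI1[OF refl] _ assms(2)]
  note S1 = Sg_pts_two_values[OF xy(3) xy(4) disjI1[OF refl] _ assms(2)]
  have e2: "Sg (m + 2) \<zeta> (map (pts (m + 2) x y c) [0..<2 * (m + 2) + 1]) = St (m + 2) \<zeta> c d (m + 3)"
    by (rule S0) (simp only: xs ys, simp)
  have e0: "Sg m \<zeta> (map (pts m x y c) [0..<2 * m + 1]) = St m \<zeta> c d (m + 1)"
    by (rule S0) (simp only: xs ys, simp)
  have e1: "Sg (m + 1) \<zeta> (map (pts (m + 1) (x \<circ> skip_index m m) (y \<circ> skip_index m m) c)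
      [0..<2 * (m + 1) + 1]) = St (m + 1) \<zeta> c d (m + 3)"
    "Sg (m + 1) \<zeta> (map (pts (m + 1) (x \<circ> skip_index m (m + 1)) (y \<circ> skip_index m (m + 1)) c)
      [0..<2 * (m + 1) + 1]) = St (m + 1) \<zeta> c d (m + 1)"
    "Sg (m + 1) \<zeta> (map (pts (m + 1) (x \<circ> skip_index m m) (y \<circ> skip_index m (m + 1)) c)
      [0..<2 * (m + 1) + 1]) = St (m + 1) \<zeta> c d (m + 2)"
    "Sg (m + 1) \<zeta> (map (pts (m + 1) (x \<circ> skip_index m (m + 1)) (y \<circ> skip_index m m) c)
      [0..<2 * (m + 1) + 1]) = St (m + 1) \<zeta> c d (m + 2)"
    by (rule S1, simp only: xs ys, simp)+
  have v: "x m = c" "x (m + 1) = d" "y m = c" "y (m + 1) = d" by (auto simp: x_def y_def)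
  have "(x (m + 1) - x m) * (y (m + 1) - y m) *
      Sg (m + 2) \<zeta> (map (pts (m + 2) x y c) [0..<2 * (m + 2) + 1]) *
      Sg m \<zeta> (map (pts m x y c) [0..<2 * m + 1]) =
    G \<zeta> (x m) (y (m + 1)) * G \<zeta> (x (m + 1)) (y m) *
      Sg (m + 1) \<zeta> (map (pts (m + 1) (x \<circ> skip_index m m) (y \<circ> skip_index m m) c)
        [0..<2 * (m + 1) + 1]) *
      Sg (m + 1) \<zeta> (map (pts (m + 1) (x \<circ> skip_index m (m + 1)) (y \<circ> skip_index m (m + 1)) c)
        [0..<2 * (m + 1) + 1]) -
    G \<zeta> (x m) (y m) * G \<zeta> (x (m + 1)) (y (m + 1)) *
      Sg (m + 1) \<zeta> (map (pts (m + 1) (x \<circ> skip_index m m) (y \<circ> skip_index m (m + 1)) c)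
        [0..<2 * (m + 1) + 1]) *
      Sg (m + 1) \<zeta> (map (pts (m + 1) (x \<circ> skip_index m (m + 1)) (y \<circ> skip_index m m) c)
        [0..<2 * (m + 1) + 1])"
    by (rule Sg_desnanot_confluent[OF assms(1)]) (use assms(3-5) G in \<open>auto simp: x_def y_def\<close>)
  then show ?thesis
    unfolding e0 e1 e2 v G_commute[of \<zeta> d c] power2_eq_square by (simp only: mult_ac)
qed

section \<open>The symmetry under inversion\<close>

lemma det_permute_cols:
  fixes f :: "nat \<Rightarrow> nat \<Rightarrow> 'a::comm_ring_1"
  assumes "\<pi> permutes {0..<n}"
  shows "det (mat n n (\<lambda>(i, j). f i (\<pi> j))) = signof \<pi> * det (mat n n (\<lambda>(i, j). f i j))"
proof -
  have tr: "det (mat n n (\<lambda>(i, j). g i j)) = det (mat n n (\<lambda>(i, j). g j i))" for g :: "nat \<Rightarrow> nat \<Rightarrow> 'a"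
  proof -
    have "transpose_mat (mat n n (\<lambda>(i, j). g i j)) = mat n n (\<lambda>(i, j). g j i)"
      by (rule eq_matI) auto
    then show ?thesis using det_transpose[of "mat n n (\<lambda>(i, j). g i j)" n] by simp
  qed
  have "det (mat n n (\<lambda>(i, j). f i (\<pi> j))) = det (mat n n (\<lambda>(i, j). mat n n (\<lambda>(i, j). f j i) $$ (\<pi> i, j)))"
    unfolding tr[of "\<lambda>i j. f i (\<pi> j)"] using permutes_in_image[OF assms]
    by (intro arg_cong[of _ _ det] cong_mat) auto
  also have "\<dots> = signof \<pi> * det (mat n n (\<lambda>(i, j). f j i))"
    by (rule det_permute_rows[OF _ assms]) auto
  finally show ?thesis using tr[of f] by simp
qed

lemma prod_pairs:
  "(\<Prod>j<n. \<Prod>i<j. s i * s j) * (\<Prod>i<n. s i) = (\<Prod>i<n. s i :: 'a::comm_monoid_mult) ^ n"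
proof (induction n)
  case (Suc n)
  have "(\<Prod>j<Suc n. \<Prod>i<j. s i * s j) * (\<Prod>i<Suc n. s i) =
      ((\<Prod>j<n. \<Prod>i<j. s i * s j) * (\<Prod>i<n. s i)) * ((\<Prod>i<n. s i) * s n ^ n * s n)"
    by (simp add: prod.distrib mult_ac)
  also have "\<dots> = (\<Prod>i<Suc n. s i) ^ Suc n"
    unfolding Suc by (simp add: power_mult_distrib mult_ac)
  finally show ?case .
qed simp

lemma ufam_a: "j \<le> n \<Longrightarrow> ufam n f g h j = f ^ j * g ^ (n - j)"
  by (simp add: ufam_def)

lemma ufam_b: "k < n \<Longrightarrow> ufam n f g h (n + 1 + k) = h * f ^ k * g ^ (n - 1 - k)"
  by (simp add: ufam_def)

text \<open>Reversing coefficients as cubics maps \<open>psi\<close> to -zeta times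
  \<open>phi\<close> at 1/zeta, maps \<open>phi\<close> to the corresponding multiple of
  \<open>psi\<close>, and fixes \<open>chi\<close>. Inverses are expressed by equations so that this
  applies in rings of power series.\<close>

lemma reflect_values:
  fixes \<zeta> \<zeta>' s t :: "'a::comm_ring_1"
  assumes "\<zeta> * \<zeta>' = 1" "t * s = 1"
  shows "poly (phi \<zeta>') s = - \<zeta>' * s ^ 3 * poly (psi \<zeta>) t"
    and "poly (psi \<zeta>') s = - \<zeta>' * s ^ 3 * poly (phi \<zeta>) t"
    and "poly chi s = s ^ 3 * poly chi t"
proof -
  have s1: "s ^ 3 * t = s\<^sup>2" "s ^ 3 * t\<^sup>2 = s" "s ^ 3 * t ^ 3 = 1"
  proof -
    have "s ^ 3 * t = s * s * (t * s)" "s ^ 3 * t\<^sup>2 = s * (t * s) * (t * s)"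
      "s ^ 3 * t ^ 3 = (t * s) * (t * s) * (t * s)"
      by (simp_all only: power2_eq_square power3_eq_cube mult_ac)
    then show "s ^ 3 * t = s\<^sup>2" "s ^ 3 * t\<^sup>2 = s" "s ^ 3 * t ^ 3 = 1"
      by (simp_all only: assms(2) mult_1_right power2_eq_square)
  qed
  have vals: "poly (phi z) x = x ^ 3 - (2 * z + 1) * x\<^sup>2" "poly (psi z) x = (z + 2) * x - z"
    "poly chi x = x\<^sup>2 + x" for z x :: 'a
    by (simp_all add: phi_def psi_def chi_def power2_eq_square power3_eq_cube algebra_simps)
  have "- \<zeta>' * s ^ 3 * poly (psi \<zeta>) t =
      - (\<zeta> * \<zeta>') * (s ^ 3 * t) - 2 * \<zeta>' * (s ^ 3 * t) + (\<zeta> * \<zeta>') * s ^ 3"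
    unfolding vals by (simp add: algebra_simps)
  then show "poly (phi \<zeta>') s = - \<zeta>' * s ^ 3 * poly (psi \<zeta>) t"
    unfolding s1 assms(1) vals by (simp add: algebra_simps)
  have "- \<zeta>' * s ^ 3 * poly (phi \<zeta>) t =
      - \<zeta>' * (s ^ 3 * t ^ 3) + (2 * (\<zeta> * \<zeta>') + \<zeta>') * (s ^ 3 * t\<^sup>2)"
    unfolding vals by (simp add: algebra_simps)
  then show "poly (psi \<zeta>') s = - \<zeta>' * s ^ 3 * poly (phi \<zeta>) t"
    unfolding s1 assms(1) vals by (simp add: algebra_simps)
  have "s ^ 3 * poly chi t = s ^ 3 * t\<^sup>2 + s ^ 3 * t" unfolding vals by (simp add: algebra_simps)
  then show "poly chi s = s ^ 3 * poly chi t" unfolding s1 vals by simp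
qed

text \<open>Exchanging \<open>phi\<close> and \<open>psi\<close> reverses both blocks of
  \<open>ufam\<close>, so the two alternants differ by row factors, column factors and a
  permutation. Its sign is left open: only the absolute value of the constant will matter.\<close>

lemma Sg_reflect_distinct:
  fixes \<zeta> \<zeta>' :: "'a::idom" and s t :: "nat \<Rightarrow> 'a"
  assumes "\<zeta> * \<zeta>' = 1" and ts: "\<And>i. i < 2 * n + 1 \<Longrightarrow> t i * s i = 1"
    and dist: "\<And>i j. i < j \<Longrightarrow> j < 2 * n + 1 \<Longrightarrow> t i \<noteq> t j"
  shows "\<exists>e\<in>{1, -1}. Sg n \<zeta>' (map s [0..<2 * n + 1]) =
    e * \<zeta>' ^ (2 * n\<^sup>2) * (\<Prod>i<2 * n + 1. s i) ^ n * Sg n \<zeta> (map t [0..<2 * n + 1])"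
proof -
  let ?N = "2 * n + 1"
  let ?u = "ufam n (phi \<zeta>) (psi \<zeta>) chi" and ?v = "ufam n (phi \<zeta>') (psi \<zeta>') chi"
  \<comment> \<open>Reversal of 0..n and of n+1..2n, where 3n + 1 is the sum of the end points of
    the second range.\<close>
  define \<pi> where "\<pi> j = (if j \<le> n then n - j else if j \<le> 2 * n then 3 * n + 1 - j else j)" for j
  have \<pi>: "\<pi> permutes {0..<?N}"
  proof (rule bij_imp_permutes)
    have inv: "\<pi> (\<pi> j) = j" for j by (auto simp: \<pi>_def)
    have "\<pi> j \<in> {0..<?N}" if "j \<in> {0..<?N}" for j using that by (auto simp: \<pi>_def)
    then show "bij_betw \<pi> {0..<?N} {0..<?N}" using inv by (intro bij_betwI[where g = \<pi>]) auto
  qed (auto simp: \<pi>_def)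
  \<comment> \<open>Each factor \<open>phi\<close> or \<open>psi\<close> brings -1/zeta while
    \<open>chi\<close> brings none, hence n factors in the first block and n - 1 in the
    second.\<close>
  define c where "c j = (- \<zeta>') ^ (if j \<le> n then n else n - 1)" for j
  have entry: "poly (?v j) (s i) = s i ^ (3 * n) * poly (?u (\<pi> j)) (t i) * c j" if "i < ?N" "j < ?N" for i j
  proof (cases "j \<le> n")
    case True
    then have ck: "c j * s i ^ (3 * n) = (- \<zeta>' * s i ^ 3) ^ j * (- \<zeta>' * s i ^ 3) ^ (n - j)"
      by (simp only: c_def if_True power_mult_distrib[symmetric] power_mult power_add[symmetric]
          le_add_diff_inverse)
    have v: "poly (?v j) (s i) = poly (phi \<zeta>') (s i) ^ j * poly (psi \<zeta>') (s i) ^ (n - j)"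
      using True by (simp add: ufam_def)
    have u: "poly (?u (\<pi> j)) (t i) = poly (phi \<zeta>) (t i) ^ (n - j) * poly (psi \<zeta>) (t i) ^ j"
      using True by (simp add: ufam_def \<pi>_def)
    have "poly (?v j) (s i) = (- \<zeta>' * s i ^ 3) ^ j * (- \<zeta>' * s i ^ 3) ^ (n - j) * poly (?u (\<pi> j)) (t i)"
      unfolding u v reflect_values[OF assms(1) ts[OF that(1)]] power_mult_distrib by (simp only: mult_ac)
    then show ?thesis unfolding ck[symmetric] by (simp only: mult_ac)
  next
    case False
    define k where "k = j - n - 1"
    have k: "j = n + 1 + k" "k < n" using False that by (auto simp: k_def)
    have "(- \<zeta>' * s i ^ 3) ^ k * (- \<zeta>' * s i ^ 3) ^ (n - 1 - k) = (- \<zeta>' * s i ^ 3) ^ (n - 1)"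
      unfolding power_add[symmetric] using k by simp
    moreover have "s i ^ (3 * n) = s i ^ 3 * (s i ^ 3) ^ (n - 1)"
    proof -
      have "3 * n = 3 + 3 * (n - 1)" using k by simp
      then show ?thesis by (metis power_add power_mult)
    qed
    ultimately have ck: "c j * s i ^ (3 * n) =
        s i ^ 3 * ((- \<zeta>' * s i ^ 3) ^ k * (- \<zeta>' * s i ^ 3) ^ (n - 1 - k))"
      using False by (simp only: c_def if_False power_mult_distrib mult_ac)
    have pj: "\<pi> j = n + 1 + (n - 1 - k)" and kk: "n - 1 - (n - 1 - k) = k" "n - 1 - k < n"
      using k by (auto simp: \<pi>_def)
    have v: "poly (?v j) (s i) = poly chi (s i) * poly (phi \<zeta>') (s i) ^ k * poly (psi \<zeta>') (s i) ^ (n - 1 - k)"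
      unfolding k(1) ufam_b[OF k(2)] by simp
    have u: "poly (?u (\<pi> j)) (t i) = poly chi (t i) * poly (phi \<zeta>) (t i) ^ (n - 1 - k) * poly (psi \<zeta>) (t i) ^ k"
      unfolding pj ufam_b[OF kk(2)] kk(1) by (simp only: poly_mult poly_power)
    have "poly (?v j) (s i) = s i ^ 3 * ((- \<zeta>' * s i ^ 3) ^ k * (- \<zeta>' * s i ^ 3) ^ (n - 1 - k)) * poly (?u (\<pi> j)) (t i)"
      unfolding u v reflect_values[OF assms(1) ts[OF that(1)]] power_mult_distrib by (simp only: mult_ac)
    then show ?thesis unfolding ck[symmetric] by (simp only: mult_ac)
  qed
  have cprod: "(\<Prod>j<?N. c j) = \<zeta>' ^ (2 * n\<^sup>2)"
  proof -
    have "?N = (n + 1) + n" by simp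
    then have "(\<Prod>j<?N. c j) = (\<Prod>j<n + 1. c j) * (\<Prod>j<n. c (n + 1 + j))"
      by (simp only: prod_split_lessThan)
    also have "(\<Prod>j<n + 1. c j) = (\<Prod>j<n + 1. (- \<zeta>') ^ n)" by (intro prod.cong) (auto simp: c_def)
    also have "(\<Prod>j<n. c (n + 1 + j)) = (\<Prod>j<n. (- \<zeta>') ^ (n - 1))" by (intro prod.cong) (auto simp: c_def)
    also have "(\<Prod>j<n + 1. (- \<zeta>') ^ n) * (\<Prod>j<n. (- \<zeta>') ^ (n - 1)) = (- \<zeta>') ^ (n * (n + 1) + (n - 1) * n)"
      by (simp only: prod_constant card_lessThan power_mult[symmetric] power_add[symmetric])
    also have "n * (n + 1) + (n - 1) * n = 2 * n\<^sup>2"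
      by (cases n) (auto simp: power2_eq_square algebra_simps)
    finally show ?thesis by (simp add: power_mult)
  qed
  have det: "det (mat ?N ?N (\<lambda>(i, j). poly (?v j) (s i))) = (\<Prod>i<?N. s i) ^ (3 * n) * \<zeta>' ^ (2 * n\<^sup>2) *
      (signof \<pi> * det (mat ?N ?N (\<lambda>(i, j). poly (?u j) (t i))))"
  proof -
    have "det (mat ?N ?N (\<lambda>(i, j). poly (?v j) (s i))) =
        det (mat ?N ?N (\<lambda>(i, j). s i ^ (3 * n) * poly (?u (\<pi> j)) (t i) * c j))"
      using entry by (intro arg_cong[of _ _ det] cong_mat) auto
    then show ?thesis
      unfolding det_scale_rows_cols det_permute_cols[OF \<pi>, of "\<lambda>i j. poly (?u j) (t i)"] cprod
      by (simp only: prod_power_distrib)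
  qed
  have ev: "det (mat ?N ?N (\<lambda>(i, j). poly (w j) (r i))) = vand (map r [0..<?N]) * rdet w (linpoly (map r [0..<?N]))"
    for w and r :: "nat \<Rightarrow> 'a"
  proof -
    have "mat ?N ?N (\<lambda>(i, j). poly (w j) (r i)) = mat ?N ?N (\<lambda>(i, j). poly (w j) (map r [0..<?N] ! i))"
      by (intro cong_mat) (auto simp del: upt_Suc)
    then show ?thesis using det_poly_eval[of "map r [0..<?N]" ?N w] by (simp del: upt_Suc)
  qed
  have vd: "vand (map r [0..<?N]) = (\<Prod>j<?N. \<Prod>i<j. r j - r i)" for r :: "nat \<Rightarrow> 'a"
    unfolding vand_def by (auto intro!: prod.cong simp del: upt_Suc)
  have vs: "vand (map s [0..<?N]) = (-1) ^ (\<Sum>j<?N. j) * (\<Prod>j<?N. \<Prod>i<j. s i * s j) * vand (map t [0..<?N])"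
  proof -
    have "s j - s i = (-1) * (s i * s j) * (t j - t i)" if "i < j" "j < ?N" for i j
    proof -
      have "s j - s i = (t i * s i) * s j - (t j * s j) * s i" using ts that by simp
      then show ?thesis by (simp add: algebra_simps)
    qed
    then have "(\<Prod>j<?N. \<Prod>i<j. s j - s i) = (\<Prod>j<?N. \<Prod>i<j. (-1) * (s i * s j) * (t j - t i))"
      by (intro prod.cong) auto
    then show ?thesis unfolding vd by (simp only: prod.distrib prod_constant card_lessThan power_sum)
  qed
  define p0 where "p0 = (\<Prod>i<?N. s i)"
  define e1 where "e1 = ((-1) ^ (\<Sum>j<?N. j) :: 'a)"
  define e2 where "e2 = (signof \<pi> :: 'a)"
  let ?V = "vand (map t [0..<?N])"
  have V: "?V \<noteq> 0" unfolding vd using dist by (fastforce dest: sym)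
  have "(\<Prod>i<?N. t i * s i) = 1" using ts by (intro prod.neutral) auto
  then have p0: "p0 \<noteq> 0" unfolding p0_def prod.distrib by (metis mult_zero_right zero_neq_one)
  have "p0 * (\<Prod>j<?N. \<Prod>i<j. s i * s j) = p0 ^ ?N" unfolding p0_def using prod_pairs[of s ?N] by (simp add: mult.commute)
  then have pp: "(\<Prod>j<?N. \<Prod>i<j. s i * s j) = p0 ^ (2 * n)" using p0 by simp
  have "e1 * p0 ^ (2 * n) * ?V * rdet ?v (linpoly (map s [0..<?N])) =
      p0 ^ (3 * n) * \<zeta>' ^ (2 * n\<^sup>2) * (e2 * (?V * rdet ?u (linpoly (map t [0..<?N]))))"
    using det unfolding ev vs pp e1_def[symmetric] e2_def[symmetric] p0_def[symmetric] by simp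
  \<comment> \<open>The rows give \<open>p0 ^ (3 * n)\<close>, and passing from the Vandermonde
    product of t to that of s uses up \<open>p0 ^ (2 * n)\<close>; the power n is what
    remains.\<close>
  moreover have "p0 ^ (3 * n) = p0 ^ (2 * n) * p0 ^ n" by (simp add: power_add[symmetric])
  ultimately have "(p0 ^ (2 * n) * ?V) * (e1 * rdet ?v (linpoly (map s [0..<?N]))) =
      (p0 ^ (2 * n) * ?V) * (e2 * p0 ^ n * \<zeta>' ^ (2 * n\<^sup>2) * rdet ?u (linpoly (map t [0..<?N])))"
    by (simp only: mult_ac)
  then have "e1 * rdet ?v (linpoly (map s [0..<?N])) =
      e2 * p0 ^ n * \<zeta>' ^ (2 * n\<^sup>2) * rdet ?u (linpoly (map t [0..<?N]))"
    using p0 V by (simp only: mult_cancel_left) simp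
  moreover have "e1 * e1 = 1" by (simp add: e1_def power_mult_distrib[symmetric])
  ultimately have "rdet ?v (linpoly (map s [0..<?N])) =
      (e1 * e2) * p0 ^ n * \<zeta>' ^ (2 * n\<^sup>2) * rdet ?u (linpoly (map t [0..<?N]))"
    by (metis (no_types, lifting) mult.assoc mult.left_neutral)
  moreover have "e1 * e2 \<in> {1, -1}"
    by (auto simp: e1_def e2_def sign_def minus_one_power_iff)
  ultimately show ?thesis
    unfolding Sg_def p0_def[symmetric] by (intro bexI[of _ "e1 * e2"]) (simp_all only: mult_ac)
qed

lemma fps_nth_0_hom: "comm_ring_hom (\<lambda>f :: 'a::comm_ring_1 fps. fps_nth f 0)"
  by unfold_locales auto

text \<open>Coinciding nodes are separated by adding \<open>i X\<close>. Power series serve here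
  instead of polynomials because the perturbed nodes have to be invertible.\<close>

lemma Sg_reflect:
  fixes \<zeta> :: "'a::field_char_0" and t :: "nat \<Rightarrow> 'a"
  assumes "\<zeta> \<noteq> 0" and t: "\<And>i. i < 2 * n + 1 \<Longrightarrow> t i \<noteq> 0"
  shows "\<exists>e\<in>{1, -1}. Sg n (inverse \<zeta>) (map (\<lambda>i. inverse (t i)) [0..<2 * n + 1]) =
    e * inverse \<zeta> ^ (2 * n\<^sup>2) * (\<Prod>i<2 * n + 1. inverse (t i)) ^ n * Sg n \<zeta> (map t [0..<2 * n + 1])"
proof -
  let ?N = "2 * n + 1"
  let ?h = "\<lambda>f :: 'a fps. fps_nth f 0"
  interpret h: comm_ring_hom ?h by (rule fps_nth_0_hom)
  define T where "T i = fps_const (t i) + fps_const (of_nat i) * fps_X" for i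
  have T0: "fps_nth (T i) 0 = t i" for i by (simp add: T_def)
  have "\<exists>e\<in>{1, -1}. Sg n (fps_const (inverse \<zeta>)) (map (\<lambda>i. inverse (T i)) [0..<?N]) =
    e * fps_const (inverse \<zeta>) ^ (2 * n\<^sup>2) * (\<Prod>i<?N. inverse (T i)) ^ n * Sg n (fps_const \<zeta>) (map T [0..<?N])"
  proof (rule Sg_reflect_distinct)
    show "fps_const \<zeta> * fps_const (inverse \<zeta>) = 1" using assms(1) by simp
    show "T i * inverse (T i) = 1" if "i < ?N" for i
      using t[OF that] T0 by (simp add: inverse_mult_eq_1')
    show "T i \<noteq> T j" if "i < j" "j < ?N" for i j
    proof
      assume "T i = T j"
      then have "fps_nth (T i) 1 = fps_nth (T j) 1" by simp
      then show False using that by (simp add: T_def)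
    qed
  qed
  then obtain e where e: "e \<in> {1, -1}" and eq: "Sg n (fps_const (inverse \<zeta>)) (map (\<lambda>i. inverse (T i)) [0..<?N]) =
    e * fps_const (inverse \<zeta>) ^ (2 * n\<^sup>2) * (\<Prod>i<?N. inverse (T i)) ^ n * Sg n (fps_const \<zeta>) (map T [0..<?N])"
    by blast
  have "?h e \<in> {1, -1}" using e by auto
  moreover have "?h (inverse (T i)) = inverse (t i)" for i by (simp add: T0)
  then have "?h (\<Prod>i<?N. inverse (T i)) = (\<Prod>i<?N. inverse (t i))"
    by (simp only: h.hom_prod)
  moreover have "?h (fps_const c) = c" for c by simp
  ultimately show ?thesis
    using arg_cong[OF eq, of ?h] \<open>\<And>i. ?h (inverse (T i)) = inverse (t i)\<close>
    unfolding h.hom_mult h.hom_power Sg_hom[OF fps_nth_0_hom] map_map o_def T0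
    by (intro bexI[of _ "?h e"]) (simp_all only:)
qed

section \<open>Orders of vanishing at \<open>-1\<close> and \<open>-1/2\<close>\<close>

lemma sum_split_2n1:
  fixes n :: nat
  shows
  "(\<Sum>j<2 * n + 1. f j) = (\<Sum>j\<le>n. f j) + (\<Sum>k<n. f (n + 1 + k) :: 'a::comm_monoid_add)"
proof -
  have "2 * n + 1 = (n + 1) + n" by simp
  then have "(\<Sum>j<2 * n + 1. f j) = (\<Sum>j<n + 1. f j) + (\<Sum>k<n. f (n + 1 + k))"
    by (metis sum_split_lessThan)
  moreover have "{..<n + 1} = {..n}" by auto
  ultimately show ?thesis by (simp only:)
qed

text \<open>By the binomial theorem this is a unitriangular column operation within each block. It
  allows \<open>phi\<close> to be replaced by a combination with a zero of higher order at a chosen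
  point.\<close>

lemma rdet_ufam_add_first:
  fixes m :: "'a::comm_ring_1 poly"
  assumes m: "lead_coeff m = 1" "degree m = 2 * n + 1"
  shows "rdet (ufam n (f + smult c g) g h) m = rdet (ufam n f g h) m"
proof -
  define B where "B i j = (if j \<le> n then (if i \<le> j then of_nat (j choose i) * c ^ (j - i) else 0)
     else if n < i \<and> i \<le> j then of_nat ((j - n - 1) choose (i - n - 1)) * c ^ (j - i) else 0)" for i j
  have binom: "(f + smult c g) ^ j = (\<Sum>i\<le>j. smult (of_nat (j choose i) * c ^ (j - i)) (f ^ i * g ^ (j - i)))" for j
    unfolding binomial_ring
    by (intro sum.cong) (auto simp: smult_power of_nat_poly mult_ac smult_smult)
  have "ufam n (f + smult c g) g h j = (\<Sum>i<2 * n + 1. smult (B i j) (ufam n f g h i))" if "j < 2 * n + 1" for j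
  proof (cases "j \<le> n")
    case True
    have "(\<Sum>i<2 * n + 1. smult (B i j) (ufam n f g h i)) = (\<Sum>i\<le>n. smult (B i j) (ufam n f g h i))"
      unfolding sum_split_2n1 using True by (simp add: B_def)
    also have "\<dots> = (\<Sum>i\<le>j. smult (of_nat (j choose i) * c ^ (j - i)) (f ^ i * g ^ (n - i)))"
      using True by (intro sum.mono_neutral_cong_right) (auto simp: B_def ufam_def)
    also have "\<dots> = (\<Sum>i\<le>j. smult (of_nat (j choose i) * c ^ (j - i)) (f ^ i * g ^ (j - i))) * g ^ (n - j)"
      unfolding sum_distrib_right
      by (intro sum.cong) (use True in \<open>auto simp: power_add[symmetric] mult.assoc\<close>)
    finally show ?thesis using True by (simp add: ufam_def binom)
  next
    case False
    define k where "k = j - n - 1"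
    have k: "j = n + 1 + k" "k < n" using False that by (auto simp: k_def)
    have "(\<Sum>i<2 * n + 1. smult (B i j) (ufam n f g h i)) =
        (\<Sum>i<n. smult (B (n + 1 + i) j) (ufam n f g h (n + 1 + i)))"
      unfolding sum_split_2n1 using False by (simp add: B_def)
    also have "\<dots> = (\<Sum>i\<le>k. smult (of_nat (k choose i) * c ^ (k - i)) (h * f ^ i * g ^ (n - 1 - i)))"
      using k by (intro sum.mono_neutral_cong_right) (auto simp: B_def ufam_def)
    also have "\<dots> = h * (\<Sum>i\<le>k. smult (of_nat (k choose i) * c ^ (k - i)) (f ^ i * g ^ (k - i))) * g ^ (n - 1 - k)"
      unfolding sum_distrib_right sum_distrib_left
      by (intro sum.cong) (use k in \<open>auto simp: power_add[symmetric] mult.assoc\<close>)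
    finally show ?thesis unfolding k(1) ufam_b[OF k(2)] by (simp only: binom)
  qed
  then have "rdet (ufam n (f + smult c g) g h) m =
      rdet (ufam n f g h) m * det (mat (2 * n + 1) (2 * n + 1) (\<lambda>(i, j). B i j))"
    by (rule rdet_linear_combination[OF m(1) m(2)[symmetric]])
  moreover have "det (mat (2 * n + 1) (2 * n + 1) (\<lambda>(i, j). B i j)) = 1"
    by (subst det_upper_triangular_mat) (auto simp: B_def intro!: prod.neutral)
  ultimately show ?thesis by simp
qed

text \<open>Each column of the second block changes by a multiple of a column of the first, since h
  is accompanied by one factor fewer. It serves to choose a version of \<open>chi\<close> adapted to
  a point.\<close>

lemma rdet_ufam_add_third:
  fixes m :: "'a::comm_ring_1 poly"
  assumes m: "lead_coeff m = 1" "degree m = 2 * n + 1"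
  shows "rdet (ufam n f g (h + smult c g)) m = rdet (ufam n f g h) m"
proof -
  define B :: "nat \<Rightarrow> nat \<Rightarrow> 'a"
    where "B i j = (if i = j then 1 else 0) + (if n < j \<and> i = j - n - 1 then c else 0)" for i j
  have "ufam n f g (h + smult c g) j = (\<Sum>i<2 * n + 1. smult (B i j) (ufam n f g h i))" if "j < 2 * n + 1" for j
  proof -
    have "(\<Sum>i<2 * n + 1. smult (B i j) (ufam n f g h i)) =
        (\<Sum>i<2 * n + 1. if i = j then ufam n f g h i else 0) +
        (\<Sum>i<2 * n + 1. if i = j - n - 1 then if n < j then smult c (ufam n f g h i) else 0 else 0)"
      unfolding sum.distrib[symmetric] by (intro sum.cong) (auto simp: B_def smult_add_left)
    also have "\<dots> = ufam n f g h j + (if n < j then smult c (ufam n f g h (j - n - 1)) else 0)"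
    proof -
      have "j \<in> {..<2 * n + 1}" "j - n - 1 \<in> {..<2 * n + 1}" using that by auto
      then show ?thesis by (simp only: sum.delta finite_lessThan if_True)
    qed
    also have "\<dots> = ufam n f g (h + smult c g) j"
    proof (cases "j \<le> n")
      case False
      define k where "k = j - n - 1"
      have k: "j = n + 1 + k" "k < n" using False that by (auto simp: k_def)
      then have "n - k = Suc (n - 1 - k)" by simp
      then have g: "g ^ (n - k) = g * g ^ (n - 1 - k)" by (simp only: power_Suc)
      have "n < j" "j - n - 1 = k" "k \<le> n" using k by auto
      then show ?thesis unfolding k(1) ufam_b[OF k(2)] by (simp add: ufam_a g algebra_simps)
    qed (simp add: ufam_def)
    finally show ?thesis by simp
  qed
  then have "rdet (ufam n f g (h + smult c g)) m =
      rdet (ufam n f g h) m * det (mat (2 * n + 1) (2 * n + 1) (\<lambda>(i, j). B i j))"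
    by (rule rdet_linear_combination[OF m(1) m(2)[symmetric]])
  moreover have "det (mat (2 * n + 1) (2 * n + 1) (\<lambda>(i, j). B i j)) = 1"
    by (subst det_upper_triangular_mat) (auto simp: B_def intro!: prod.neutral)
  ultimately show ?thesis by simp
qed

lemma pcompose_ufam: "pcompose (ufam n f g h j) q = ufam n (pcompose f q) (pcompose g q) (pcompose h q) j"
  by (simp add: ufam_def pcompose_mult pcompose_power_hom)

text \<open>The order gained by column j when f, g, h contribute orders k, l, r.\<close>

definition wt :: "nat \<Rightarrow> nat \<Rightarrow> nat \<Rightarrow> nat \<Rightarrow> nat \<Rightarrow> nat" where
  "wt n k l r j = (if j \<le> n then k * j + l * (n - j) else r + k * (j - n - 1) + l * (2 * n - j))"

lemma ufam_smult:
  "ufam n (smult (x ^ k) f) (smult (x ^ l) g) (smult (x ^ r) h) j =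
     smult (x ^ wt n k l r j) (ufam n f g h j)"
  by (simp add: ufam_def wt_def smult_power power_mult[symmetric] power_add mult_ac)

lemma fps_X_power_cancel:
  fixes f g :: "'a::idom fps"
  assumes "fps_X ^ k * f = fps_X ^ w * g" "w = k + l"
  shows "f = fps_X ^ l * g"
  using assms by (simp add: power_add mult.assoc)

lemma pcompose_linpoly:
  fixes c x :: "'a::comm_ring_1"
  shows "pcompose (linpoly (map (\<lambda>t. c + x * t) ts)) [:c, x:] = smult (x ^ length ts) (linpoly ts)"
proof (induction ts)
  case (Cons t ts)
  have "pcompose [:- (c + x * t), 1:] [:c, x:] = smult x [:- t, 1:]"
    by (simp add: pcompose_pCons)
  then show ?case
    by (simp only: list.map linpoly_simps pcompose_mult Cons length_Cons power_Suc
        mult_smult_left mult_smult_right smult_smult mult.commute[of x "x ^ length ts"])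
qed simp

text \<open>At zeta = -1 all special nodes collapse to -1, where \<open>phi\<close> and
  \<open>psi\<close> have simple zeros but their difference (t + 1)^2 (t - 1) has a double one.
  After zooming in, the three polynomials gain orders 2, 1, 1; the column weights exceed the sum of
  the row indices by n^2.\<close>

lemma Sg_order_minus_one:
  fixes ts :: "rat fps list"
  assumes "length ts = 2 * n + 1"
  shows "\<exists>g. Sg n (fps_X - 1) (map (\<lambda>t. -1 + fps_X * t) ts) = fps_X ^ (n\<^sup>2) * g"
proof -
  let ?X = "fps_X :: rat fps" and ?N = "2 * n + 1"
  let ?m = "linpoly (map (\<lambda>t. -1 + ?X * t) ts)"
  define \<zeta> where "\<zeta> = ?X - 1"
  define \<theta> where "\<theta> = phi \<zeta> + smult (-1) (psi \<zeta>)"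
  have m: "lead_coeff ?m = 1" "degree ?m = ?N" using assms linpoly_monic(1)[of "map (\<lambda>t. -1 + ?X * t) ts"] by auto
  have pc: "pcompose \<theta> [:-1, ?X:] = smult (?X ^ 2) [:0, 3, -2 - 2 * ?X, ?X:]"
    "pcompose (psi \<zeta>) [:-1, ?X:] = smult (?X ^ 1) [:-2, ?X + 1:]"
    "pcompose chi [:-1, ?X:] = smult (?X ^ 1) [:0, -1, ?X:]"
    by (simp_all add: \<theta>_def \<zeta>_def phi_def psi_def chi_def pcompose_pCons algebra_simps power2_eq_square)
  have "?X ^ (\<Sum>i<?N. i) * rdet (ufam n \<theta> (psi \<zeta>) chi) ?m =
      ?X ^ (\<Sum>j<?N. wt n 2 1 1 j) * rdet (ufam n [:0, 3, -2 - 2 * ?X, ?X:] [:-2, ?X + 1:] [:0, -1, ?X:]) (linpoly ts)"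
  proof (rule rdet_rescale[OF m])
    show "lead_coeff (linpoly ts) = 1" by (rule linpoly_monic)
    show "degree (linpoly ts) = ?N" using assms by simp
    show "pcompose ?m [:-1, ?X:] = smult (?X ^ ?N) (linpoly ts)" using pcompose_linpoly[of "-1" ?X ts] assms by simp
    show "pcompose (ufam n \<theta> (psi \<zeta>) chi j) [:-1, ?X:] = smult (?X ^ wt n 2 1 1 j)
        (ufam n [:0, 3, -2 - 2 * ?X, ?X:] [:-2, ?X + 1:] [:0, -1, ?X:] j)" for j
      unfolding pcompose_ufam pc ufam_smult ..
  qed
  moreover have "(\<Sum>j<?N. wt n 2 1 1 j) = (\<Sum>i<?N. i) + n\<^sup>2"
  proof -
    have "(\<Sum>j<?N. wt n 2 1 1 j) = (\<Sum>j\<le>n. n + j) + (\<Sum>k<n. n + k)"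
      unfolding sum_split_2n1 by (intro arg_cong2[of _ _ _ _ "(+)"] sum.cong) (auto simp: wt_def)
    moreover have "(\<Sum>i<?N. i) = (\<Sum>j\<le>n. j) + (\<Sum>k<n. n + k) + n"
      unfolding sum_split_2n1 by (simp add: sum_Suc)
    ultimately show ?thesis by (simp add: sum.distrib power2_eq_square)
  qed
  ultimately have "rdet (ufam n \<theta> (psi \<zeta>) chi) ?m = ?X ^ (n\<^sup>2) *
      rdet (ufam n [:0, 3, -2 - 2 * ?X, ?X:] [:-2, ?X + 1:] [:0, -1, ?X:]) (linpoly ts)"
    by (rule fps_X_power_cancel)
  moreover have "rdet (ufam n \<theta> (psi \<zeta>) chi) ?m = rdet (ufam n (phi \<zeta>) (psi \<zeta>) chi) ?m"
    unfolding \<theta>_def by (rule rdet_ufam_add_first[OF m])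
  ultimately have e: "rdet (ufam n (phi \<zeta>) (psi \<zeta>) chi) ?m = ?X ^ (n\<^sup>2) *
      rdet (ufam n [:0, 3, -2 - 2 * ?X, ?X:] [:-2, ?X + 1:] [:0, -1, ?X:]) (linpoly ts)"
    by (simp only:)
  show ?thesis
    unfolding Sg_def \<zeta>_def[symmetric] e by (rule exI) (rule mult.left_commute)
qed

lemma det_rescale:
  fixes H H' :: "nat \<Rightarrow> nat \<Rightarrow> 'a::idom"
  assumes "\<And>i j. i < N \<Longrightarrow> j < N \<Longrightarrow> x ^ \<rho> i * H i j = x ^ (\<rho>' i + \<sigma> j) * H' i j"
  shows "x ^ (\<Sum>i<N. \<rho> i) * det (mat N N (\<lambda>(i, j). H i j)) =
    x ^ ((\<Sum>i<N. \<rho>' i) + (\<Sum>j<N. \<sigma> j)) * det (mat N N (\<lambda>(i, j). H' i j))"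
proof -
  have "mat N N (\<lambda>(i, j). x ^ \<rho> i * H i j * 1) = mat N N (\<lambda>(i, j). x ^ \<rho>' i * H' i j * x ^ \<sigma> j)"
    using assms by (intro cong_mat) (auto simp: power_add mult_ac)
  from arg_cong[OF this, of det] show ?thesis
    unfolding det_scale_rows_cols by (simp add: power_sum power_add mult_ac)
qed

lemma sum_interleave:
  fixes n :: nat
  shows
  "(\<Sum>j\<le>n. f (2 * j)) + (\<Sum>k<n. f (2 * k + 1)) = (\<Sum>j<2 * n + 1. f j :: 'a::comm_monoid_add)"
  by (induction n) (simp_all add: add_ac)

text \<open>When the two nodes stay apart, \<open>St\<close> is a unit times a determinant of Taylor
  coefficients, and its order can be read off from that determinant. The parameter \<open>w\<close>
  permits adjusting \<open>chi\<close>.\<close>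

lemma St_unit_det:
  fixes c d \<zeta> :: "rat fps"
  assumes "fps_nth (d - c) 0 \<noteq> 0" "a \<le> 2 * n + 1"
  shows "St n \<zeta> c d a = (-1) ^ (\<Sum>l\<le>n. l) * inverse ((d - c) ^ (a * (2 * n + 1 - a))) *
    det (mat (2 * n + 1) (2 * n + 1) (\<lambda>(i, j). hermite a c d i (ufam n (phi \<zeta>) (psi \<zeta>) (chi + smult w (psi \<zeta>)) j)))"
proof -
  let ?m = "linpoly (replicate a c @ replicate (2 * n + 1 - a) d)"
  let ?e = "(d - c) ^ (a * (2 * n + 1 - a))"
  have "fps_nth ?e 0 \<noteq> 0" using assms(1) by (simp add: fps_power_zeroth)
  then have e: "inverse ?e * ?e = 1" by (rule inverse_mult_eq_1)
  have "det (mat (2 * n + 1) (2 * n + 1) (\<lambda>(i, j). hermite a c d i (ufam n (phi \<zeta>) (psi \<zeta>) (chi + smult w (psi \<zeta>)) j))) =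
      ?e * rdet (ufam n (phi \<zeta>) (psi \<zeta>) (chi + smult w (psi \<zeta>))) ?m"
    using assms(2) by (intro det_hermite) simp
  also have "rdet (ufam n (phi \<zeta>) (psi \<zeta>) (chi + smult w (psi \<zeta>))) ?m = rdet (ufam n (phi \<zeta>) (psi \<zeta>) chi) ?m"
    using assms(2) by (intro rdet_ufam_add_third[OF linpoly_monic(1)]) (auto simp del: linpoly_simps)
  finally have *: "det (mat (2 * n + 1) (2 * n + 1) (\<lambda>(i, j). hermite a c d i (ufam n (phi \<zeta>) (psi \<zeta>) (chi + smult w (psi \<zeta>)) j))) =
      ?e * rdet (ufam n (phi \<zeta>) (psi \<zeta>) chi) ?m" .
  have "inverse ?e * (?e * r) = r" for r by (simp only: mult.assoc[symmetric] e mult_1_left)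
  then show ?thesis unfolding * St_def Sg_def by (simp only: mult.assoc)
qed

text \<open>At zeta = -1/2 the node \<open>xi0\<close> tends to 0, where \<open>phi\<close> has a
  triple and \<open>chi\<close> a simple zero. The column orders in increasing sequence are 0, 1, 3,
  4, 6, ..., that is \<open>j + j div 2\<close>; the \<open>a\<close> Taylor rows at that node must
  use distinct columns, at best the \<open>a\<close> cheapest ones.\<close>

lemma St_order_minus_half:
  fixes d \<zeta> :: "rat fps"
  assumes \<zeta>: "2 * \<zeta> + 1 = fps_X" and d: "fps_nth d 0 \<noteq> 0" and a: "a \<le> 2 * n + 1"
  shows "\<exists>g. St n \<zeta> fps_X d a = fps_X ^ (\<Sum>j<a. j div 2) * g"
proof -
  let ?X = "fps_X :: rat fps" and ?N = "2 * n + 1"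
  define u where "u j = ufam n (phi \<zeta>) (psi \<zeta>) (chi + smult 0 (psi \<zeta>)) j" for j
  define v where "v j = ufam n [:0, 1, 2, 1:] (pcompose (psi \<zeta>) [:?X, ?X:]) [:1 + ?X, 1 + 2 * ?X, ?X:] j" for j
  have phi: "phi \<zeta> = [:0, 0, -?X, 1:]" unfolding phi_def \<zeta> ..
  have pc: "pcompose (phi \<zeta>) [:?X, ?X:] = smult (?X ^ 3) [:0, 1, 2, 1:]"
    "pcompose (psi \<zeta>) [:?X, ?X:] = smult (?X ^ 0) (pcompose (psi \<zeta>) [:?X, ?X:])"
    "pcompose (chi + smult 0 (psi \<zeta>)) [:?X, ?X:] = smult (?X ^ 1) [:1 + ?X, 1 + 2 * ?X, ?X:]"
    unfolding phi by (simp_all add: chi_def pcompose_pCons algebra_simps power3_eq_cube)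
  have scaled: "?X ^ i * coeff (pcompose (u j) [:?X, 1:]) i = ?X ^ wt n 3 0 1 j * coeff (v j) i" for i j
  proof -
    have "?X ^ i * coeff (pcompose (u j) [:?X, 1:]) i = coeff (pcompose (u j) [:?X, ?X:]) i"
      by (simp only: coeff_pcompose_linear_shift[of _ ?X ?X])
    also have "pcompose (u j) [:?X, ?X:] = smult (?X ^ wt n 3 0 1 j) (v j)"
      unfolding u_def v_def pcompose_ufam ufam_smult[symmetric] pc(1,3) by simp
    finally show ?thesis by simp
  qed
  \<comment> \<open>The smallest column order not among the \<open>a\<close> cheapest. Cutting
    column orders at \<open>c0\<close> and multiplying the rows at \<open>d\<close> by
    \<open>X ^ c0\<close> turns the minimum over column choices into a plain rescaling by rows and
    columns.\<close>
  define c0 where "c0 = a + a div 2"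
  define \<sigma> where "\<sigma> j = min (wt n 3 0 1 j) c0" for j
  define H' where "H' i j = (if i < a then ?X ^ (wt n 3 0 1 j - \<sigma> j) * coeff (v j) i
      else ?X ^ (c0 - \<sigma> j) * hermite a ?X d i (u j))" for i j
  have "?X ^ (\<Sum>i<?N. if i < a then i else c0) * det (mat ?N ?N (\<lambda>(i, j). hermite a ?X d i (u j))) =
      ?X ^ ((\<Sum>i<?N. 0) + (\<Sum>j<?N. \<sigma> j)) * det (mat ?N ?N (\<lambda>(i, j). H' i j))"
  proof (rule det_rescale)
    fix i j
    have "\<sigma> j + (wt n 3 0 1 j - \<sigma> j) = wt n 3 0 1 j" "\<sigma> j + (c0 - \<sigma> j) = c0" by (auto simp: \<sigma>_def)
    then show "?X ^ (if i < a then i else c0) * hermite a ?X d i (u j) = ?X ^ (0 + \<sigma> j) * H' i j"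
      using scaled[of i j] unfolding H'_def hermite_def
      by (auto simp: mult.assoc[symmetric] power_add[symmetric])
  qed
  moreover have "(\<Sum>i<?N. 0) + (\<Sum>j<?N. \<sigma> j) = (\<Sum>i<?N. if i < a then i else c0) + (\<Sum>j<a. j div 2)"
  proof -
    have N: "?N = a + (?N - a)" using a by simp
    \<comment> \<open>The first block has orders 3j and the second 3k + 1, the values of
      \<open>j + j div 2\<close> at even and at odd arguments.\<close>
    have "(\<Sum>j<?N. \<sigma> j) = (\<Sum>j\<le>n. min (2 * j + (2 * j) div 2) c0) + (\<Sum>k<n. min ((2 * k + 1) + (2 * k + 1) div 2) c0)"
      unfolding sum_split_2n1 by (intro arg_cong2[of _ _ _ _ "(+)"] sum.cong) (auto simp: \<sigma>_def wt_def)
    also have "\<dots> = (\<Sum>j<?N. min (j + j div 2) c0)" by (rule sum_interleave)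
    also have "\<dots> = (\<Sum>j<a. j + j div 2) + (\<Sum>j<?N - a. c0)"
    proof (subst N, subst sum_split_lessThan, intro arg_cong2[of _ _ _ _ "(+)"] sum.cong refl)
      show "min (k + k div 2) c0 = k + k div 2" if "k \<in> {..<a}" for k
        using that by (intro min_absorb1) (auto simp: c0_def intro!: add_mono div_le_mono)
      show "min (a + k + (a + k) div 2) c0 = c0" for k
        by (intro min_absorb2) (auto simp: c0_def intro!: add_mono div_le_mono)
    qed
    finally have 1: "(\<Sum>j<?N. \<sigma> j) = (\<Sum>j<a. j + j div 2) + (\<Sum>j<?N - a. c0)" .
    have "(\<Sum>i<?N. if i < a then i else c0) = (\<Sum>i<a. i) + (\<Sum>j<?N - a. c0)"
      by (subst N, subst sum_split_lessThan) auto
    with 1 show ?thesis by (simp add: sum.distrib)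
  qed
  ultimately have det: "det (mat ?N ?N (\<lambda>(i, j). hermite a ?X d i (u j))) =
      ?X ^ (\<Sum>j<a. j div 2) * det (mat ?N ?N (\<lambda>(i, j). H' i j))"
    by (rule fps_X_power_cancel)
  have "St n \<zeta> ?X d a = (-1) ^ (\<Sum>l\<le>n. l) * inverse ((d - ?X) ^ (a * (?N - a))) *
      det (mat ?N ?N (\<lambda>(i, j). hermite a ?X d i (u j)))"
    unfolding u_def by (rule St_unit_det) (use a d in auto)
  then show ?thesis unfolding det
    by (intro exI[of _ "(-1) ^ (\<Sum>l\<le>n. l) * inverse ((d - ?X) ^ (a * (?N - a))) * det (mat ?N ?N (\<lambda>(i, j). H' i j))"])
      (simp only: mult_ac)
qed

section \<open>The order of vanishing and the leading coefficient at \<open>0\<close>\<close>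

lemma wt_sum: "(\<Sum>j<2 * n + 1. wt n 1 0 0 j) = n\<^sup>2"
proof -
  have "(\<Sum>j<2 * n + 1. wt n 1 0 0 j) = (\<Sum>j\<le>n. j) + (\<Sum>k<n. k)"
    unfolding sum_split_2n1 by (intro arg_cong2[of _ _ _ _ "(+)"] sum.cong) (auto simp: wt_def)
  also have "\<dots> = n\<^sup>2" by (induction n) (auto simp: power2_eq_square)
  finally show ?thesis .
qed

lemma sum_Suc_n: "(\<Sum>i<n + 1. i) + (\<Sum>i<n. i) = n\<^sup>2" for n :: nat
  by (induction n) (auto simp: power2_eq_square)

locale at_zero =
  fixes n :: nat
begin

definition "c = 1 + 2 * (fps_X :: rat fps)"
definition "t1 = inverse (2 + fps_X :: rat fps)"
definition "d = fps_X * t1"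
text \<open>\<open>c\<close> and \<open>d\<close> are \<open>xi0\<close> and \<open>xi1\<close> for
  zeta = X and tend to 1 and 0. The adjusted third polynomial is (t - 1)(t - X), which becomes small
  near both.\<close>

definition "u = ufam n (phi fps_X) (psi fps_X) (chi + smult (-1) (psi (fps_X :: rat fps)))"
text \<open>The quotients after substituting \<open>c + X t\<close> here and \<open>d + X t\<close>
  in \<open>v0\<close>, with orders 1, 0, 0 and 2, 1, 1 taken out. The third polynomial here keeps a
  factor X, so it vanishes in the limit.\<close>

definition "v1 = ufam n [:0, c\<^sup>2, 2 * c * fps_X, fps_X\<^sup>2:] [:2 + 4 * fps_X + 2 * fps_X\<^sup>2, fps_X\<^sup>2 + 2 * fps_X:]
  [:2 * fps_X + 2 * fps_X\<^sup>2, fps_X + 3 * fps_X\<^sup>2, fps_X\<^sup>2:]"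
definition "v0 = ufam n ([:t1, 1:]\<^sup>2 * [:fps_X * t1 - c, fps_X:]) [:0, fps_X + 2:]
  ([:fps_X * t1 - 1, fps_X:] * [:t1 - 1, 1:])"

lemma t1: "(fps_X + 2) * t1 = 1"
  unfolding t1_def by (subst add.commute, rule inverse_mult_eq_1') simp

lemma t1_0: "fps_nth t1 0 = 1 / 2"
  by (simp add: t1_def inverse_eq_divide)

lemma unit: "fps_nth (d - c) 0 = -1"
  by (simp add: d_def c_def)

lemma scaled_one:
  "fps_X ^ i * coeff (pcompose (u j) [:c, 1:]) i = fps_X ^ wt n 1 0 0 j * coeff (v1 j) i"
proof -
  have pc: "pcompose (phi fps_X) [:c, fps_X:] = smult (fps_X ^ 1) [:0, c\<^sup>2, 2 * c * fps_X, fps_X\<^sup>2:]"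
    "pcompose (psi fps_X) [:c, fps_X:] = smult (fps_X ^ 0) [:2 + 4 * fps_X + 2 * fps_X\<^sup>2, fps_X\<^sup>2 + 2 * fps_X:]"
    "pcompose (chi + smult (-1) (psi fps_X)) [:c, fps_X:] =
      smult (fps_X ^ 0) [:2 * fps_X + 2 * fps_X\<^sup>2, fps_X + 3 * fps_X\<^sup>2, fps_X\<^sup>2:]"
    by (simp_all add: phi_def psi_def chi_def c_def pcompose_pCons power2_eq_square algebra_simps)
  have "fps_X ^ i * coeff (pcompose (u j) [:c, 1:]) i = coeff (pcompose (u j) [:c, fps_X:]) i"
    by (simp only: coeff_pcompose_linear_shift[of _ c fps_X])
  also have "pcompose (u j) [:c, fps_X:] = smult (fps_X ^ wt n 1 0 0 j) (v1 j)"
    unfolding u_def v1_def pcompose_ufam pc ufam_smult ..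
  finally show ?thesis by simp
qed

lemma scaled_zero:
  "fps_X ^ i * coeff (pcompose (u j) [:d, 1:]) i = fps_X ^ wt n 2 1 1 j * coeff (v0 j) i"
proof -
  have psi: "(fps_X + 2) * (fps_X * t1) = fps_X"
    using t1 by (metis mult.left_commute mult.right_neutral)
  have pc: "pcompose (phi fps_X) [:d, fps_X:] = smult (fps_X ^ 2) ([:t1, 1:]\<^sup>2 * [:fps_X * t1 - c, fps_X:])"
    "pcompose (psi fps_X) [:d, fps_X:] = smult (fps_X ^ 1) [:0, fps_X + 2:]"
  proof -
    show "pcompose (phi fps_X) [:d, fps_X:] = smult (fps_X ^ 2) ([:t1, 1:]\<^sup>2 * [:fps_X * t1 - c, fps_X:])"
      by (simp add: phi_def c_def d_def pcompose_pCons power2_eq_square algebra_simps)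
    have "pcompose (psi fps_X) [:d, fps_X:] = [:(fps_X + 2) * (fps_X * t1) - fps_X, (fps_X + 2) * fps_X:]"
      by (simp add: psi_def d_def pcompose_pCons algebra_simps)
    then show "pcompose (psi fps_X) [:d, fps_X:] = smult (fps_X ^ 1) [:0, fps_X + 2:]"
      unfolding psi by (simp add: mult.commute)
  qed
  have om: "chi + smult (-1) (psi fps_X) = [:fps_X, - fps_X - 1, 1 :: rat fps:]"
    by (simp add: chi_def psi_def algebra_simps)
  have pc': "pcompose (chi + smult (-1) (psi fps_X)) [:d, fps_X:] =
      smult (fps_X ^ 1) ([:fps_X * t1 - 1, fps_X:] * [:t1 - 1, 1:])"
    unfolding om by (simp add: pcompose_pCons d_def algebra_simps)
  have "fps_X ^ i * coeff (pcompose (u j) [:d, 1:]) i = coeff (pcompose (u j) [:d, fps_X:]) i"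
    by (simp only: coeff_pcompose_linear_shift[of _ d fps_X])
  also have "pcompose (u j) [:d, fps_X:] = smult (fps_X ^ wt n 2 1 1 j) (v0 j)"
    unfolding u_def v0_def pcompose_ufam pc pc' ufam_smult ..
  finally show ?thesis by simp
qed

text \<open>The column orders at the two nodes differ by the constant n, so they split into row and
  column contributions as \<open>det_rescale\<close> needs; this is why a factor X was left inside
  \<open>v1\<close>.\<close>

lemma wt_zero: "j < 2 * n + 1 \<Longrightarrow> wt n 2 1 1 j = n + wt n 1 0 0 j"
  by (auto simp: wt_def)

definition "H' a i j = (if i < a then coeff (v1 j) i else coeff (v0 j) (i - a))"

lemma det_hermite_zero:
  assumes "a + b = 2 * n + 1"
  shows "fps_X ^ ((\<Sum>i<a. i) + (\<Sum>i<b. i)) *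
      det (mat (2 * n + 1) (2 * n + 1) (\<lambda>(i, j). hermite a c d i (u j))) =
    fps_X ^ (n * b + n\<^sup>2) * det (mat (2 * n + 1) (2 * n + 1) (\<lambda>(i, j). H' a i j))"
proof -
  have "fps_X ^ (\<Sum>i<2 * n + 1. if i < a then i else i - a) *
      det (mat (2 * n + 1) (2 * n + 1) (\<lambda>(i, j). hermite a c d i (u j))) =
    fps_X ^ ((\<Sum>i<2 * n + 1. if i < a then 0 else n) + (\<Sum>j<2 * n + 1. wt n 1 0 0 j)) *
      det (mat (2 * n + 1) (2 * n + 1) (\<lambda>(i, j). H' a i j))"
  proof (rule det_rescale)
    fix i j assume "i < 2 * n + 1" "j < 2 * n + 1"
    then show "fps_X ^ (if i < a then i else i - a) * hermite a c d i (u j) =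
        fps_X ^ ((if i < a then 0 else n) + wt n 1 0 0 j) * H' a i j"
      using scaled_one[of i j] scaled_zero[of "i - a" j] wt_zero[of j]
      by (simp add: hermite_def H'_def)
  qed
  moreover have "(\<Sum>i<2 * n + 1. if i < a then i else i - a) = (\<Sum>i<a. i) + (\<Sum>i<b. i)"
    "(\<Sum>i<2 * n + 1. if i < a then 0 else n) = n * b"
    unfolding assms[symmetric] sum_split_lessThan by auto
  ultimately show ?thesis by (simp only: wt_sum)
qed

lemma St_eq:
  assumes "a \<le> 2 * n + 1"
  shows "St n fps_X c d a = (-1) ^ (\<Sum>l\<le>n. l) * inverse ((d - c) ^ (a * (2 * n + 1 - a))) *
    det (mat (2 * n + 1) (2 * n + 1) (\<lambda>(i, j). hermite a c d i (u j)))"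
  unfolding u_def using assms unit by (intro St_unit_det) auto

lemma order_p: "\<exists>g. St n fps_X c d (n + 1) = fps_X ^ n\<^sup>2 * g"
proof -
  have "det (mat (2 * n + 1) (2 * n + 1) (\<lambda>(i, j). hermite (n + 1) c d i (u j))) =
      fps_X ^ n\<^sup>2 * det (mat (2 * n + 1) (2 * n + 1) (\<lambda>(i, j). H' (n + 1) i j))"
    using det_hermite_zero[of "n + 1" n] unfolding sum_Suc_n
    by (rule fps_X_power_cancel) (auto simp: power2_eq_square)
  then have "St n fps_X c d (n + 1) = fps_X ^ n\<^sup>2 * ((-1) ^ (\<Sum>l\<le>n. l) *
      inverse ((d - c) ^ ((n + 1) * (2 * n + 1 - (n + 1)))) *
      det (mat (2 * n + 1) (2 * n + 1) (\<lambda>(i, j). H' (n + 1) i j)))"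
    using St_eq[of "n + 1"] by (simp only: mult.left_commute)
  then show ?thesis by blast
qed

text \<open>The cofactor is kept explicit because its constant term yields the leading coefficient
  of \<open>p\<close>.\<close>

lemma order_p_tilde:
  "St n fps_X c d n = fps_X ^ (n\<^sup>2 + n) * ((-1) ^ (\<Sum>l\<le>n. l) * inverse ((d - c) ^ (n * (n + 1))) *
     det (mat (2 * n + 1) (2 * n + 1) (\<lambda>(i, j). H' n i j)))"
proof -
  have s: "(\<Sum>i<n. i) + (\<Sum>i<n + 1. i) = n\<^sup>2" using sum_Suc_n[of n] by simp
  have "det (mat (2 * n + 1) (2 * n + 1) (\<lambda>(i, j). hermite n c d i (u j))) =
      fps_X ^ (n\<^sup>2 + n) * det (mat (2 * n + 1) (2 * n + 1) (\<lambda>(i, j). H' n i j))"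
    using det_hermite_zero[of n "n + 1"] unfolding s
    by (rule fps_X_power_cancel) (auto simp: power2_eq_square)
  moreover have "2 * n + 1 - n = n + 1" by simp
  ultimately show ?thesis using St_eq[of n] by (simp only: mult.left_commute)
qed

text \<open>\<open>d\<close> is an exact zero of \<open>psi\<close>, so each factor
  \<open>psi\<close> contributes a factor t to the substituted column.\<close>

lemma v0_low:
  assumes "j < 2 * n + 1" "i + wt n 1 0 0 j + 1 < n"
  shows "coeff (v0 j) i = 0"
proof -
  have z: "[:0, fps_X + 2 :: rat fps:] ^ e = [:0, 1:] ^ e * [:(fps_X + 2) ^ e:]" for e
    by (induction e) (auto simp: mult_ac)
  have *: "coeff (w * [:0, fps_X + 2 :: rat fps:] ^ e) i = 0" if "i < e" for w e
  proof -
    have "w * [:0, fps_X + 2 :: rat fps:] ^ e = [:0, 1:] ^ e * ([:(fps_X + 2) ^ e:] * w)"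
      unfolding z by (simp only: mult_ac)
    then show ?thesis using that by (simp only: coeff_mult_X_power if_True)
  qed
  show ?thesis
  proof (cases "j \<le> n")
    case True
    then show ?thesis unfolding v0_def ufam_a[OF True] using assms by (intro *) (auto simp: wt_def)
  next
    case False
    define k where "k = j - n - 1"
    have k: "j = n + 1 + k" "k < n" using False assms by (auto simp: k_def)
    show ?thesis unfolding v0_def k(1) ufam_b[OF k(2)] using assms k by (intro *) (auto simp: wt_def)
  qed
qed

text \<open>The uniform rescaling would give only n^2 - n - 2. Instead, row r at \<open>d\<close> is
  divisible by \<open>X ^ (2 * n - 1 - 2 * r)\<close>: by \<open>v0_low\<close> only columns of
  weight at least n - 1 - r contribute, and their order there is n plus the weight minus r. Over the
  n - 1 rows this sums to n^2 - 1.\<close>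

lemma order_Y:
  assumes "n \<ge> 1"
  shows "\<exists>g. St n fps_X c d (n + 2) = fps_X ^ (n\<^sup>2 - 1) * g"
proof -
  let ?N = "2 * n + 1"
  have "\<exists>g. hermite (n + 2) c d i (u j) = fps_X ^ (if i < n + 2 then 0 else 2 * n - 1 - 2 * (i - (n + 2))) * g"
    if ij: "i < ?N" "j < ?N" for i j
  proof (cases "i < n + 2")
    case True
    then show ?thesis by auto
  next
    case False
    define r where "r = i - (n + 2)"
    have r: "r + 1 < n" using False ij by (auto simp: r_def)
    have e: "fps_X ^ r * coeff (pcompose (u j) [:d, 1:]) r = fps_X ^ (n + wt n 1 0 0 j) * coeff (v0 j) r"
      using scaled_zero[of r j] wt_zero[OF ij(2)] by simp
    have "\<exists>g. coeff (pcompose (u j) [:d, 1:]) r = fps_X ^ (2 * n - 1 - 2 * r) * g"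
    proof (cases "r + wt n 1 0 0 j + 1 < n")
      case True
      then have "coeff (pcompose (u j) [:d, 1:]) r = 0" using e v0_low[OF ij(2) True] by simp
      then show ?thesis by auto
    next
      case False
      then have "n + wt n 1 0 0 j = r + ((2 * n - 1 - 2 * r) + (n + wt n 1 0 0 j - r - (2 * n - 1 - 2 * r)))"
        using r by simp
      from fps_X_power_cancel[OF e this]
      show ?thesis unfolding power_add mult.assoc by blast
    qed
    then show ?thesis using False by (simp add: hermite_def r_def)
  qed
  then obtain g where g: "\<And>i j. i < ?N \<Longrightarrow> j < ?N \<Longrightarrow> hermite (n + 2) c d i (u j) =
      fps_X ^ (if i < n + 2 then 0 else 2 * n - 1 - 2 * (i - (n + 2))) * g i j" by metis
  have "fps_X ^ (\<Sum>i<?N. 0) * det (mat ?N ?N (\<lambda>(i, j). hermite (n + 2) c d i (u j))) =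
      fps_X ^ ((\<Sum>i<?N. if i < n + 2 then 0 else 2 * n - 1 - 2 * (i - (n + 2))) + (\<Sum>j<?N. 0)) *
      det (mat ?N ?N (\<lambda>(i, j). g i j))"
  proof (rule det_rescale)
    fix i j assume "i < ?N" "j < ?N"
    from g[OF this] show "fps_X ^ 0 * hermite (n + 2) c d i (u j) =
        fps_X ^ ((if i < n + 2 then 0 else 2 * n - 1 - 2 * (i - (n + 2))) + 0) * g i j"
      by (simp only: power_0 mult_1_left add_0_right)
  qed
  moreover have "(\<Sum>i<?N. if i < n + 2 then 0 else 2 * n - 1 - 2 * (i - (n + 2))) = n\<^sup>2 - 1"
  proof -
    obtain m where m: "n = Suc m" using assms by (cases n) auto
    have N: "?N = (n + 2) + m" using m by simp
    have "(\<Sum>i<?N. if i < n + 2 then 0 else 2 * n - 1 - 2 * (i - (n + 2))) = (\<Sum>i<m. 2 * n - 1 - 2 * i)"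
      unfolding N sum_split_lessThan by simp
    also have "\<dots> = (\<Sum>i<m. 2 * (m - Suc i) + 3)" using m by (intro sum.cong) auto
    also have "\<dots> = (\<Sum>i<m. 2 * i + 3)" by (rule sum.nat_diff_reindex)
    also have "\<dots> = n\<^sup>2 - 1" unfolding m by (induction m) (auto simp: power2_eq_square)
    finally show ?thesis .
  qed
  ultimately have "det (mat ?N ?N (\<lambda>(i, j). hermite (n + 2) c d i (u j))) =
      fps_X ^ (n\<^sup>2 - 1) * det (mat ?N ?N (\<lambda>(i, j). g i j))" by simp
  then have "St n fps_X c d (n + 2) = fps_X ^ (n\<^sup>2 - 1) * ((-1) ^ (\<Sum>l\<le>n. l) *
      inverse ((d - c) ^ ((n + 2) * (2 * n + 1 - (n + 2)))) * det (mat ?N ?N (\<lambda>(i, j). g i j)))"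
    using St_eq[of "n + 2"] assms by (simp only: mult.left_commute)
  then show ?thesis by blast
qed

end

lemma fps_shift_step: "fps_shift k E = fps_const (fps_nth E k) + fps_X * fps_shift (Suc k) (E :: 'a::comm_ring_1 fps)"
  by (rule fps_ext) (auto simp: fps_X_def[symmetric] gr0_conv_Suc)

text \<open>The limits at X = 0 of the three polynomials in \<open>v0\<close>: -(t + 1/2)^2, 2t and
  1/2 - t.\<close>

context
  fixes f0 g0 h0 :: "rat poly"
  defines "f0 \<equiv> [:-1/4, -1, -1:]" and "g0 \<equiv> [:0, 2:]" and "h0 \<equiv> [:1/2, -1:]"
begin

private definition "f = fps_of_poly f0"
private definition "g = fps_of_poly g0"
private definition "h = fps_of_poly h0"
private definition "W = g * inverse f"
private definition "B = fps_binomial (-1/2 :: rat)"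

private lemma fgh_0: "fps_nth f 0 = -1/4" "fps_nth g 0 = 0" "fps_nth h 0 = 1/2" "g = 2 * fps_X"
  by (simp_all add: f_def g_def h_def f0_def g0_def h0_def fps_of_poly_pCons numeral_fps_const)

private lemma W: "W * f = g" "fps_nth W 0 = 0" "W \<noteq> 0"
proof -
  have "inverse f * f = 1" by (rule inverse_mult_eq_1) (simp add: fgh_0)
  then show Wf: "W * f = g" by (simp add: W_def mult.assoc)
  show "fps_nth W 0 = 0" by (simp add: W_def fgh_0)
  show "W \<noteq> 0" using Wf fgh_0(4) by auto
qed

text \<open>With \<open>W = g / f\<close> one has \<open>1 + W = (h / (X + 1/2))\<^sup>2\<close>, so that the expansion of \<open>f / h\<close> in powers
  of \<open>W\<close> is a shifted binomial series with exponent \<open>-1/2\<close>.\<close>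

private lemma binomial_compose: "h * (fps_shift 1 B oo W) = f"
proof -
  define b where "b = B oo W"
  define x where "x = fps_of_poly [:1/2 :: rat, 1:]"
  have B2: "(1 + fps_X) * (B * B) = 1"
  proof -
    have "B * B = inverse (1 + fps_X)"
      unfolding B_def fps_binomial_add_mult[symmetric] by (simp add: fps_binomial_minus_one)
    then show ?thesis by (simp add: inverse_mult_eq_1')
  qed
  have "((1 + fps_X) * (B * B)) oo W = 1" unfolding B2 by simp
  then have "(1 + W) * (b * b) = 1"
    by (simp add: fps_compose_mult_distrib[OF W(2)] fps_compose_add_distrib b_def W(2))
  then have "f * ((1 + W) * (b * b)) = f" by simp
  moreover have "f * ((1 + W) * (b * b)) = (f + W * f) * (b * b)" by (simp add: algebra_simps)
  ultimately have e1: "(f + g) * (b * b) = f" by (simp only: W(1))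
  have e2: "f + g = - (h * h)"
    unfolding f_def g_def h_def fps_of_poly_mult[symmetric] fps_of_poly_add[symmetric] fps_of_poly_uminus[symmetric]
    by (simp add: f0_def g0_def h0_def)
  have e3: "f = - (x * x)"
    unfolding f_def x_def fps_of_poly_mult[symmetric] fps_of_poly_uminus[symmetric] by (simp add: f0_def)
  have "(h * b) * (h * b) = x * x" using trans[OF e1[unfolded e2] e3] by (simp add: mult_ac)
  \<comment> \<open>The constant term 1/2 selects the square root.\<close>
  then have "h * b = x \<or> h * b = - x" by (simp add: square_eq_iff power2_eq_square)
  moreover have "fps_nth (h * b) 0 = 1/2" "fps_nth (- x) 0 = -1/2"
    by (simp_all add: fgh_0 b_def B_def x_def)
  ultimately have hb: "h * b = x" by force
  have "fps_X * fps_shift 1 B = B - 1"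
    by (rule fps_ext) (auto simp: B_def gr0_conv_Suc fps_X_def[symmetric])
  then have "(fps_X * fps_shift 1 B) oo W = b - 1" by (simp add: fps_compose_sub_distrib b_def)
  then have "W * (fps_shift 1 B oo W) = b - 1"
    by (simp add: fps_compose_mult_distrib[OF W(2)] W(2))
  then have "h * (W * (fps_shift 1 B oo W)) = h * (b - 1)" by (simp only:)
  then have "W * (h * (fps_shift 1 B oo W)) = h * b - h"
    by (simp only: mult.left_commute right_diff_distrib mult_1_right)
  also have "\<dots> = x - h" by (simp only: hb)
  also have "\<dots> = g" unfolding x_def h_def g_def fps_of_poly_diff[symmetric] by (simp add: h0_def g0_def)
  also have "\<dots> = W * f" using W(1) by simp
  finally show ?thesis using W(3) by simp
qed

private definition "e k = fps_nth B (Suc k)"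

private lemma expansion: "f = h * ((\<Sum>j<k. fps_const (e j) * W ^ j) + W ^ k * (fps_shift (Suc k) B oo W))"
proof (induction k)
  case 0
  show ?case using binomial_compose by simp
next
  case (Suc k)
  have "fps_shift (Suc k) B oo W = fps_const (e k) + W * (fps_shift (Suc (Suc k)) B oo W)"
    by (subst fps_shift_step)
      (simp add: fps_compose_add_distrib fps_compose_mult_distrib[OF W(2)] W(2) e_def)
  with Suc show ?case by (simp add: algebra_simps)
qed

text \<open>Multiplying the expansion of f by \<open>f ^ n\<close> clears the denominators of W =
  g/f up to order n. The sum is then a combination of the columns with factor h, and subtracting it
  from \<open>f ^ n\<close> leaves a multiple of \<open>g ^ n\<close>.\<close>

private lemma remainder_fps:
  "f * fps_of_poly (f0 ^ n - (\<Sum>k<n. smult (e (n - Suc k)) (h0 * f0 ^ k * g0 ^ (n - 1 - k)))) =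
     h * g ^ n * (fps_shift (Suc n) B oo W)"
proof -
  have "f * fps_of_poly (\<Sum>k<n. smult (e (n - Suc k)) (h0 * f0 ^ k * g0 ^ (n - 1 - k))) =
      (\<Sum>k<n. f * (fps_const (e (n - Suc k)) * (h * f ^ k * g ^ (n - 1 - k))))"
    by (simp add: fps_of_poly_sum fps_of_poly_smult fps_of_poly_mult fps_of_poly_power f_def g_def h_def
        sum_distrib_left)
  also have "\<dots> = (\<Sum>j<n. f * (fps_const (e j) * (h * f ^ (n - 1 - j) * g ^ j)))"
    by (subst sum.nat_diff_reindex[symmetric]) (intro sum.cong, auto)
  also have "\<dots> = f ^ n * (h * (\<Sum>j<n. fps_const (e j) * W ^ j))"
    unfolding sum_distrib_left
  proof (intro sum.cong refl)
    fix j assume "j \<in> {..<n}"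
    then have "n = Suc (n - 1 - j) + j" by simp
    then have "f ^ n = f * f ^ (n - 1 - j) * f ^ j" by (metis power_Suc power_add)
    moreover have "g ^ j = W ^ j * f ^ j" using W(1) by (metis power_mult_distrib)
    ultimately show "f * (fps_const (e j) * (h * f ^ (n - 1 - j) * g ^ j)) = f ^ n * (h * (fps_const (e j) * W ^ j))"
      by (simp only: mult_ac)
  qed
  also have "h * (\<Sum>j<n. fps_const (e j) * W ^ j) = f - h * W ^ n * (fps_shift (Suc n) B oo W)"
    using expansion[of n] by (simp add: algebra_simps)
  finally have "f * fps_of_poly (f0 ^ n - (\<Sum>k<n. smult (e (n - Suc k)) (h0 * f0 ^ k * g0 ^ (n - 1 - k)))) =
      f * f ^ n - f ^ n * (f - h * W ^ n * (fps_shift (Suc n) B oo W))"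
    by (simp add: fps_of_poly_diff right_diff_distrib fps_of_poly_power f_def)
  also have "\<dots> = h * (W * f) ^ n * (fps_shift (Suc n) B oo W)"
    unfolding power_mult_distrib by (simp add: algebra_simps)
  finally show ?thesis unfolding W(1) .
qed

private lemma remainder_coeffs:
  fixes n defines "r \<equiv> f0 ^ n - (\<Sum>k<n. smult (e (n - Suc k)) (h0 * f0 ^ k * g0 ^ (n - 1 - k)))"
  shows "i < n \<Longrightarrow> coeff r i = 0" and "coeff r n = - (2 ^ (n + 1) * e n)"
proof -
  let ?T = "fps_shift (Suc n) B oo W"
  have inv: "inverse f * f = 1" by (rule inverse_mult_eq_1) (simp add: fgh_0)
  have "fps_of_poly r = inverse f * (f * fps_of_poly r)" by (simp add: mult.assoc[symmetric] inv)
  also have "\<dots> = fps_X ^ n * (inverse f * h * 2 ^ n * ?T)"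
    unfolding r_def remainder_fps fgh_0(4) power_mult_distrib by (simp only: mult_ac)
  finally have *: "fps_of_poly r = fps_X ^ n * (inverse f * h * 2 ^ n * ?T)" .
  \<comment> \<open>The constant terms of \<open>inverse f\<close>, \<open>h\<close> and the shifted
    series are -4, 1/2 and \<open>e n\<close>.\<close>
  have "fps_nth (inverse f * h * 2 ^ n * ?T) 0 = - (2 ^ (n + 1) * e n)"
    by (simp add: fgh_0 e_def fps_power_zeroth inverse_eq_divide)
  then show "coeff r n = - (2 ^ (n + 1) * e n)"
    using arg_cong[OF *, of "\<lambda>x. fps_nth x n"] by (simp add: fps_X_power_mult_nth)
  show "coeff r i = 0" if "i < n"
    using arg_cong[OF *, of "\<lambda>x. fps_nth x i"] that by (simp add: fps_X_power_mult_nth)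
qed

text \<open>Replacing the column \<open>f0 ^ n\<close> by its remainder gives columns of orders n, n
  - 1, ..., 0, so reversing the rows makes the matrix triangular. The first diagonal entry carries
  the binomial coefficient.\<close>

lemma abs_det_taylor:
  fixes n :: nat
  shows "\<bar>det (mat (n + 1) (n + 1) (\<lambda>(i, j). coeff (ufam n f0 g0 h0 (n + j)) i))\<bar> =
    2 ^ (n + 1) * \<bar>(-1/2 :: rat) gchoose (n + 1)\<bar> * (\<Prod>k<n. (1/2) * (1/4) ^ k * 2 ^ (n - 1 - k))"
proof -
  let ?M = "\<lambda>i j. coeff (ufam n f0 g0 h0 (n + j)) i"
  define C :: "nat \<Rightarrow> nat \<Rightarrow> rat"
    where "C i j = (if i = j then 1 else if j = 0 then - e (n - i) else 0)" for i j
  define r where "r = f0 ^ n - (\<Sum>k<n. smult (e (n - Suc k)) (h0 * f0 ^ k * g0 ^ (n - 1 - k)))"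
  define M' where "M' i j = (if j = 0 then coeff r i else coeff (h0 * f0 ^ (j - 1) * g0 ^ (n - j)) i)" for i j
  have cols: "?M i 0 = coeff (f0 ^ n) i" "k < n \<Longrightarrow> ?M i (Suc k) = coeff (h0 * f0 ^ k * g0 ^ (n - 1 - k)) i" for i k
    using ufam_a[of n n f0 g0 h0] ufam_b[of k n f0 g0 h0] by simp_all
  have MC: "(\<Sum>k<n + 1. ?M i k * C k j) = M' i j" if "j < n + 1" for i j
  proof (cases "j = 0")
    case True
    have "(\<Sum>k<n + 1. ?M i k * C k j) = ?M i 0 * C 0 j + (\<Sum>k<n. ?M i (Suc k) * C (Suc k) j)"
      by (simp add: sum.lessThan_Suc_shift del: sum.lessThan_Suc)
    also have "\<dots> = coeff (f0 ^ n) i - (\<Sum>k<n. e (n - Suc k) * coeff (h0 * f0 ^ k * g0 ^ (n - 1 - k)) i)"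
      using True cols by (simp add: C_def sum_negf mult.commute)
    finally show ?thesis using True by (simp add: M'_def r_def coeff_sum)
  next
    case False
    then obtain k where k: "j = Suc k" "k < n" using \<open>j < n + 1\<close> by (cases j) auto
    have "(\<Sum>l<n + 1. ?M i l * C l j) = (\<Sum>l<n + 1. if l = j then ?M i l else 0)"
      using False by (intro sum.cong) (auto simp: C_def)
    also have "\<dots> = ?M i j"
      using \<open>j < n + 1\<close> by (simp only: sum.delta finite_lessThan lessThan_iff if_True)
    finally show ?thesis using k cols(2)[of k i] by (simp add: M'_def)
  qed
  have "det (mat (n + 1) (n + 1) (\<lambda>(i, j). C i j)) = 1"
    by (subst det_lower_triangular_mat) (auto simp: C_def)
  then have "det (mat (n + 1) (n + 1) (\<lambda>(i, j). ?M i j)) =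
      det (mat (n + 1) (n + 1) (\<lambda>(i, j). \<Sum>k<n + 1. ?M i k * C k j))"
    by (simp only: det_mat_mult_fun mult_1_right)
  also have "\<dots> = det (mat (n + 1) (n + 1) (\<lambda>(i, j). M' i j))"
    using MC by (intro arg_cong[of _ _ det] cong_mat) auto
  finally have 1: "det (mat (n + 1) (n + 1) (\<lambda>(i, j). ?M i j)) = det (mat (n + 1) (n + 1) (\<lambda>(i, j). M' i j))" .
  define \<pi> where "\<pi> i = (if i \<le> n then n - i else i)" for i
  have \<pi>: "\<pi> permutes {0..<n + 1}"
    by (rule bij_imp_permutes, rule bij_betwI[where g = \<pi>]) (auto simp: \<pi>_def)
  have "det (mat (n + 1) (n + 1) (\<lambda>(i, j). mat (n + 1) (n + 1) (\<lambda>(i, j). M' i j) $$ (\<pi> i, j))) =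
      signof \<pi> * det (mat (n + 1) (n + 1) (\<lambda>(i, j). M' i j))"
    by (rule det_permute_rows[OF _ \<pi>]) auto
  moreover have "mat (n + 1) (n + 1) (\<lambda>(i, j). mat (n + 1) (n + 1) (\<lambda>(i, j). M' i j) $$ (\<pi> i, j)) =
      mat (n + 1) (n + 1) (\<lambda>(i, j). M' (n - i) j)"
    by (intro cong_mat) (auto simp: \<pi>_def)
  moreover have "\<bar>signof \<pi> :: rat\<bar> = 1" by (simp add: sign_def)
  ultimately have 2: "\<bar>det (mat (n + 1) (n + 1) (\<lambda>(i, j). M' i j))\<bar> = \<bar>det (mat (n + 1) (n + 1) (\<lambda>(i, j). M' (n - i) j))\<bar>"
    by (simp add: abs_mult)
  have g0p: "g0 ^ k = [:0, 1:] ^ k * [:2 ^ k:]" for k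
    by (induction k) (auto simp: g0_def mult_ac)
  have low: "coeff (w * g0 ^ k) i = (if i < k then 0 else 2 ^ k * coeff w (i - k))" for w k i
  proof -
    have "w * g0 ^ k = [:0, 1:] ^ k * smult (2 ^ k) w" unfolding g0p by (simp add: mult_ac)
    then show ?thesis by (simp only: coeff_mult_X_power coeff_smult)
  qed
  have "det (mat (n + 1) (n + 1) (\<lambda>(i, j). M' (n - i) j)) = (\<Prod>i<n + 1. M' (n - i) i)"
  proof (rule det_upper_triangular_mat)
    fix i j assume "j < i" "i < n + 1"
    then show "M' (n - i) j = 0"
      using remainder_coeffs(1)[of "n - i" n] by (auto simp: M'_def r_def low)
  qed
  also have "\<dots> = M' n 0 * (\<Prod>k<n. M' (n - Suc k) (Suc k))"
    by (simp add: prod.lessThan_Suc_shift del: prod.lessThan_Suc)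
  also have "M' n 0 = - (2 ^ (n + 1) * ((-1/2) gchoose (n + 1)))"
    using remainder_coeffs(2)[of n] by (simp add: M'_def r_def e_def B_def fps_binomial_nth)
  also have "(\<Prod>k<n. M' (n - Suc k) (Suc k)) = (\<Prod>k<n. (1/2) * (-1/4) ^ k * 2 ^ (n - 1 - k))"
  proof (intro prod.cong refl)
    fix k assume "k \<in> {..<n}"
    then show "M' (n - Suc k) (Suc k) = (1/2) * (-1/4) ^ k * 2 ^ (n - 1 - k)"
      by (simp add: M'_def low coeff_mult_0 coeff_0_power) (simp add: h0_def f0_def)
  qed
  finally have 3: "det (mat (n + 1) (n + 1) (\<lambda>(i, j). M' (n - i) j)) =
      - (2 ^ (n + 1) * ((-1/2) gchoose (n + 1))) * (\<Prod>k<n. (1/2) * (-1/4) ^ k * 2 ^ (n - 1 - k))" .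
  show ?thesis unfolding 1 2 3
    by (simp add: abs_mult abs_prod power_abs)
qed

end

text \<open>The powers of 2 from the diagonals at the two nodes cancel, which leaves a clean leading
  coefficient.\<close>

lemma prod_two_powers:
  "(\<Prod>i<n. 2 ^ (n - i)) * (\<Prod>k<n. (1/2) * (1/4) ^ k * 2 ^ (n - 1 - k)) = (1 :: rat)"
proof -
  have "(\<Prod>i<n. 2 ^ (n - i)) = (\<Prod>i<n. 2 ^ (Suc (n - Suc i)) :: rat)"
    by (intro prod.cong) (auto simp: Suc_diff_Suc)
  also have "\<dots> = (\<Prod>k<n. 2 ^ Suc k)" by (rule prod.nat_diff_reindex)
  finally have "(\<Prod>i<n. 2 ^ (n - i)) * (\<Prod>k<n. (1/2) * (1/4) ^ k * 2 ^ (n - 1 - k)) =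
      (\<Prod>k<n. 2 ^ Suc k * ((1/2) * (1/4) ^ k * 2 ^ (n - 1 - k)) :: rat)"
    by (simp only: prod.distrib)
  also have "\<dots> = (\<Prod>k<n. 2 ^ (n - 1) * (1/4) ^ k)"
  proof (intro prod.cong refl)
    fix k assume "k \<in> {..<n}"
    then have "n - 1 = k + (n - 1 - k)" by simp
    then have "(2 :: rat) ^ (n - 1) = 2 ^ k * 2 ^ (n - 1 - k)" by (metis power_add)
    then show "2 ^ Suc k * ((1/2) * (1/4) ^ k * 2 ^ (n - 1 - k)) = 2 ^ (n - 1) * (1/4 :: rat) ^ k" by simp
  qed
  also have "\<dots> = 2 ^ ((n - 1) * n) * (1/4) ^ (\<Sum>k<n. k)"
    by (simp only: prod.distrib prod_constant card_lessThan power_mult power_sum)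
  also have "(n - 1) * n = 2 * (\<Sum>k<n. k)"
  proof -
    have "n + 2 * (\<Sum>k<n. k) = n * n" by (induction n) auto
    then show ?thesis by (simp add: diff_mult_distrib)
  qed
  also have "2 ^ (2 * (\<Sum>k<n. k)) * (1/4 :: rat) ^ (\<Sum>k<n. k) = 1"
    by (simp add: power_mult power_mult_distrib[symmetric])
  finally show ?thesis .
qed

context at_zero
begin

text \<open>At X = 0 the matrix is block triangular: in the first n rows the column t^n and all
  columns of the second block vanish. One block is diagonal, the other is evaluated by
  \<open>abs_det_taylor\<close>.\<close>

lemma lead_p_tilde:
  "\<bar>fps_nth ((-1) ^ (\<Sum>l\<le>n. l) * inverse ((d - c) ^ (n * (n + 1))) *
     det (mat (2 * n + 1) (2 * n + 1) (\<lambda>(i, j). H' n i j))) 0\<bar> =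
   2 ^ (n + 1) * \<bar>(-1/2 :: rat) gchoose (n + 1)\<bar>"
proof -
  let ?N = "n + (n + 1)" and ?h = "\<lambda>f :: rat fps. fps_nth f 0"
  let ?fa = "[:-1/4, -1, -1:] :: rat poly" and ?ga = "[:0, 2:] :: rat poly" and ?ha = "[:1/2, -1:] :: rat poly"
  have hom: "comm_ring_hom ?h" by (rule fps_nth_0_hom)
  interpret h: comm_ring_hom ?h by (rule hom)
  interpret hp: map_poly_comm_ring_hom ?h ..
  have v1: "map_poly ?h (v1 j) = ufam n [:0, 1:] [:2:] 0 j" for j
    unfolding v1_def map_poly_ufam[OF hom]
    by (simp add: h.map_poly_pCons_hom c_def fps_power_zeroth)
  have v0: "map_poly ?h (v0 j) = ufam n ?fa ?ga ?ha j" for j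
  proof -
    have "map_poly ?h ([:t1, 1:]\<^sup>2 * [:fps_X * t1 - c, fps_X:]) = ?fa"
      unfolding hp.hom_mult hp.hom_power
      by (simp add: h.map_poly_pCons_hom t1_0 c_def power2_eq_square)
    moreover have "map_poly ?h ([:fps_X * t1 - 1, fps_X:] * [:t1 - 1, 1:]) = ?ha"
      unfolding hp.hom_mult by (simp add: h.map_poly_pCons_hom t1_0)
    moreover have "map_poly ?h [:0, fps_X + 2:] = ?ga"
      by (simp add: h.map_poly_pCons_hom)
    ultimately show ?thesis unfolding v0_def map_poly_ufam[OF hom] by (simp only:)
  qed
  define M where "M i j = (if i < n then coeff (ufam n [:0, 1:] [:2 :: rat:] 0 j) i
      else coeff (ufam n ?fa ?ga ?ha j) (i - n))" for i j
  have H'0: "?h (H' n i j) = M i j" for i j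
    unfolding M_def v1[symmetric] v0[symmetric] H'_def by simp
  have xp: "coeff ([:0, 1 :: rat:] ^ j * [:2:] ^ k) i = (if i = j then 2 ^ k else 0)" if "i < n" for i j k
  proof -
    have "coeff ([:0, 1 :: rat:] ^ j * [:2:] ^ k) i = (if i < j then 0 else coeff [:2 ^ k:] (i - j))"
      by (simp only: coeff_mult_X_power poly_const_pow)
    then show ?thesis by (auto simp: coeff_pCons split: nat.splits)
  qed
  have "?h (det (mat ?N ?N (\<lambda>(i, j). H' n i j))) = det (mat ?N ?N (\<lambda>(i, j). M i j))"
    unfolding hom_det_fun[OF hom] H'0 ..
  also have "\<dots> = det (mat n n (\<lambda>(i, j). M i j)) * det (mat (n + 1) (n + 1) (\<lambda>(i, j). M (n + i) (n + j)))"
  proof (rule det_block_lower_mat)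
    fix i j assume ij: "i < n" "n \<le> j"
    show "M i j = 0"
    proof (cases "j = n")
      case True
      then show ?thesis using ij xp[of i n 0] by (simp add: M_def ufam_a)
    qed (use ij in \<open>auto simp: M_def ufam_def\<close>)
  qed
  also have "det (mat n n (\<lambda>(i, j). M i j)) = (\<Prod>i<n. 2 ^ (n - i))"
    by (subst det_upper_triangular_mat) (auto simp: M_def ufam_def xp)
  also have "(\<lambda>(i, j). M (n + i) (n + j)) = (\<lambda>(i, j). coeff (ufam n ?fa ?ga ?ha (n + j)) i)"
    by (auto simp: M_def fun_eq_iff)
  finally have det0: "?h (det (mat (2 * n + 1) (2 * n + 1) (\<lambda>(i, j). H' n i j))) =
      (\<Prod>i<n. 2 ^ (n - i)) * det (mat (n + 1) (n + 1) (\<lambda>(i, j). coeff (ufam n ?fa ?ga ?ha (n + j)) i))"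
    by (simp add: mult_2 add.assoc)
  have "?h (inverse ((d - c) ^ (n * (n + 1)))) = inverse (?h (d - c) ^ (n * (n + 1)))"
    by (simp only: fps_inverse_def fps_power_zeroth) simp
  then have sgn: "\<bar>?h (inverse ((d - c) ^ (n * (n + 1))))\<bar> = 1"
    by (simp only: unit) (simp add: abs_inverse power_abs)
  have "\<bar>?h ((-1) ^ (\<Sum>l\<le>n. l))\<bar> = 1" by (simp add: fps_power_zeroth power_abs)
  then show ?thesis
    unfolding h.hom_mult abs_mult sgn det0 abs_det_taylor
    using prod_two_powers[of n] by (simp add: abs_prod mult_ac)
qed

end

section \<open>Expansions of rational functions\<close>

text \<open>Extension to the field of fractions; needed for Laurent expansions as well as for the
  substitution of 1/zeta.\<close>

definition fract_lift :: "('a::idom \<Rightarrow> 'b::field) \<Rightarrow> 'a fract \<Rightarrow> 'b" where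
  "fract_lift h x = (SOME y. \<exists>a b. b \<noteq> 0 \<and> x = to_fract a / to_fract b \<and> y = h a / h b)"

lemma fract_repr:
  obtains a b where "b \<noteq> 0" "x = to_fract a / to_fract b"
  by (cases x) (simp add: Fract_conv_to_fract)

lemma fract_lift_divide:
  assumes "inj_idom_hom h" "b \<noteq> 0"
  shows "fract_lift h (to_fract a / to_fract b) = h a / h b"
  unfolding fract_lift_def
proof (rule some_equality)
  interpret inj_idom_hom h by fact
  fix y assume "\<exists>a' b'. b' \<noteq> 0 \<and> to_fract a / to_fract b = to_fract a' / to_fract b' \<and> y = h a' / h b'"
  then obtain a' b' where ab: "b' \<noteq> 0" "to_fract a / to_fract b = to_fract a' / to_fract b'" "y = h a' / h b'"
    by blast
  have "to_fract (a * b') = to_fract (a' * b)" using ab assms(2) by (simp add: field_simps)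
  then have "h a * h b' = h a' * h b" by (metis to_fract_eq_iff hom_mult)
  then show "y = h a / h b" using ab(1) assms(2) unfolding ab(3) by (simp add: frac_eq_eq)
qed (use assms in auto)

lemma fract_lift_to_fract: "inj_idom_hom h \<Longrightarrow> fract_lift h (to_fract a) = h a"
proof -
  assume h: "inj_idom_hom h"
  interpret inj_idom_hom h by fact
  show ?thesis using fract_lift_divide[OF h, of 1 a] by simp
qed

lemma fract_lift_field_hom:
  assumes h: "inj_idom_hom h"
  shows "field_hom (fract_lift h)"
proof -
  interpret inj_idom_hom h by fact
  show ?thesis
  proof unfold_locales
    fix x y :: "'a fract"
    obtain a b where x: "b \<noteq> 0" "x = to_fract a / to_fract b" by (rule fract_repr)
    obtain c d where y: "d \<noteq> 0" "y = to_fract c / to_fract d" by (rule fract_repr)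
    have bd: "b * d \<noteq> 0" using x y by simp
    have xy: "x + y = to_fract (a * d + c * b) / to_fract (b * d)" "x * y = to_fract (a * c) / to_fract (b * d)"
      unfolding x(2) y(2) using x(1) y(1) by (simp_all add: field_simps)
    show "fract_lift h (x + y) = fract_lift h x + fract_lift h y"
      "fract_lift h (x * y) = fract_lift h x * fract_lift h y"
      unfolding xy fract_lift_divide[OF h bd]
      unfolding x(2) y(2) fract_lift_divide[OF h x(1)] fract_lift_divide[OF h y(1)]
      using x(1) y(1) by (simp_all add: hom_distribs add_frac_eq)
  next
    show "fract_lift h 0 = 0" using fract_lift_to_fract[OF h, of 0] by simp
    show "fract_lift h 1 = 1" using fract_lift_to_fract[OF h, of 1] by simp
  qed
qed

section \<open>Substitution of a power series into rational functions\<close>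

definition fps_eval :: "rat fps \<Rightarrow> rat poly \<Rightarrow> rat fps" where
  "fps_eval z w = poly (map_poly fps_const w) z"

lemma fps_eval_hom: "comm_ring_hom (fps_eval z)"
proof -
  interpret c: comm_ring_hom "fps_const :: rat \<Rightarrow> rat fps" by unfold_locales auto
  interpret m: map_poly_comm_ring_hom "fps_const :: rat \<Rightarrow> rat fps" ..
  show ?thesis by unfold_locales (simp_all add: fps_eval_def hom_distribs)
qed

lemma fps_eval_pCons: "fps_eval z (pCons a w) = fps_const a + z * fps_eval z w"
proof -
  interpret c: comm_ring_hom "fps_const :: rat \<Rightarrow> rat fps" by unfold_locales auto
  show ?thesis by (simp add: fps_eval_def c.map_poly_pCons_hom)
qed

lemma fps_eval_nth_0: "fps_nth (fps_eval z w) 0 = poly w (fps_nth z 0)"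
  by (induction w) (simp add: fps_eval_def, simp add: fps_eval_pCons)

text \<open>Splitting off all factors that vanish at the constant term of \<open>z\<close> leaves a
  polynomial with invertible value.\<close>

lemma fps_eval_eq_0:
  assumes "z \<noteq> fps_const (fps_nth z 0)" "fps_eval z w = 0"
  shows "w = 0"
proof (rule ccontr)
  interpret comm_ring_hom "fps_eval z" by (rule fps_eval_hom)
  let ?a = "fps_nth z 0"
  assume "w \<noteq> 0"
  then obtain q where q: "w = [:- ?a, 1:] ^ order ?a w * q" "\<not> [:- ?a, 1:] dvd q"
    using order_decomp[of w ?a] by auto
  have "fps_eval z w = (z - fps_const ?a) ^ order ?a w * fps_eval z q"
  proof -
    have "fps_eval z [:- ?a, 1:] = z - fps_const ?a"
      by (simp add: fps_eval_pCons fps_eval_def)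
    then show ?thesis using arg_cong[OF q(1), of "fps_eval z"] by (simp only: hom_mult hom_power)
  qed
  moreover have "fps_eval z q \<noteq> 0"
    using q(2) fps_eval_nth_0[of z q] by (auto simp: poly_eq_0_iff_dvd)
  ultimately show False using assms by simp
qed

definition lau :: "rat fps \<Rightarrow> rat poly fract \<Rightarrow> rat fls" where
  "lau z = fract_lift (\<lambda>w. fps_to_fls (fps_eval z w))"

definition nonconst :: "rat fps \<Rightarrow> bool" where
  "nonconst z \<longleftrightarrow> z \<noteq> fps_const (fps_nth z 0)"

lemma lau_poly_hom: "nonconst z \<Longrightarrow> inj_idom_hom (\<lambda>w. fps_to_fls (fps_eval z w))"
proof -
  assume z: "nonconst z"
  interpret comm_ring_hom "fps_eval z" by (rule fps_eval_hom)
  show ?thesis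
    by unfold_locales
      (use fps_eval_eq_0 z in \<open>auto simp: hom_distribs nonconst_def fls_times_fps_to_fls\<close>)
qed

lemma lau_to_fract: "nonconst z \<Longrightarrow> lau z (to_fract w) = fps_to_fls (fps_eval z w)"
  unfolding lau_def by (rule fract_lift_to_fract[OF lau_poly_hom])

lemma lau_field_hom: "nonconst z \<Longrightarrow> field_hom (lau z)"
  unfolding lau_def by (rule fract_lift_field_hom[OF lau_poly_hom])

text \<open>For nonconstant \<open>z\<close> this is the local ring at the point
  \<open>fps_nth z 0\<close>; \<open>units\<close> below consists of its invertible
  elements.\<close>

definition regular :: "rat fps \<Rightarrow> rat poly fract set" where
  "regular z = {x. \<exists>g. lau z x = fps_to_fls g}"

definition units :: "rat fps \<Rightarrow> rat poly fract set" where
  "units z = {x. \<exists>g. fps_nth g 0 \<noteq> 0 \<and> lau z x = fps_to_fls g}"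

context
  fixes z :: "rat fps"
  assumes z: "nonconst z"
begin

interpretation field_hom "lau z" by (rule lau_field_hom[OF z])

lemma units_regular: "x \<in> units z \<Longrightarrow> x \<in> regular z"
  by (auto simp: units_def regular_def)

lemma regular_mult: "x \<in> regular z \<Longrightarrow> y \<in> regular z \<Longrightarrow> x * y \<in> regular z"
  by (auto simp: regular_def hom_mult fls_times_fps_to_fls[symmetric])

lemma units_mult: "x \<in> units z \<Longrightarrow> y \<in> units z \<Longrightarrow> x * y \<in> units z"
proof -
  assume "x \<in> units z" "y \<in> units z"
  then obtain g g' where "fps_nth g 0 \<noteq> 0" "lau z x = fps_to_fls g" "fps_nth g' 0 \<noteq> 0" "lau z y = fps_to_fls g'"
    by (auto simp: units_def)
  then show ?thesis unfolding units_def
    by (auto simp: hom_mult fls_times_fps_to_fls intro!: exI[of _ "g * g'"])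
qed

lemma units_power: "x \<in> units z \<Longrightarrow> x ^ k \<in> units z"
proof (induction k)
  case 0
  show ?case unfolding units_def by (auto intro!: exI[of _ 1])
qed (auto intro: units_mult)

lemma units_inverse: "x \<in> units z \<Longrightarrow> inverse x \<in> units z"
proof -
  assume "x \<in> units z"
  then obtain g where g: "fps_nth g 0 \<noteq> 0" "lau z x = fps_to_fls g" by (auto simp: units_def)
  have "g * inverse g = 1" by (rule inverse_mult_eq_1'[OF g(1)])
  then have "lau z x * fps_to_fls (inverse g) = 1" unfolding g(2) by (simp flip: fls_times_fps_to_fls)
  then have "lau z (inverse x) = fps_to_fls (inverse g)" by (simp add: hom_inverse inverse_unique)
  then show ?thesis using g(1) unfolding units_def by (auto intro!: exI[of _ "inverse g"])
qed

lemma to_fract_units: "poly w (fps_nth z 0) \<noteq> 0 \<Longrightarrow> to_fract w \<in> units z"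
  by (auto simp: units_def lau_to_fract[OF z] fps_eval_nth_0)

text \<open>If x has no pole at the zero of the linear polynomial q, the right side must vanish
  there, so it contains q and one factor cancels.\<close>

lemma regular_cancel:
  assumes "x \<in> regular z" "x * to_fract (q ^ k * w) = to_fract v"
    and q: "degree q = 1" "poly q (fps_nth z 0) = 0"
  shows "\<exists>v'. x * to_fract w = to_fract v'"
  using assms(2)
proof (induction k arbitrary: v)
  case (Suc k)
  obtain g where g: "lau z x = fps_to_fls g" using assms(1) by (auto simp: regular_def)
  interpret e: comm_ring_hom "fps_eval z" by (rule fps_eval_hom)
  have "lau z (x * to_fract (q ^ Suc k * w)) = lau z (to_fract v)" using Suc.prems by simp
  then have "g * fps_eval z (q ^ Suc k * w) = fps_eval z v"
    by (simp only: hom_mult g lau_to_fract[OF z] fls_times_fps_to_fls[symmetric] fps_to_fls_eq_iff)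
  then have "fps_nth (g * (fps_eval z q * fps_eval z (q ^ k * w))) 0 = fps_nth (fps_eval z v) 0"
    by (simp only: power_Suc mult.assoc e.hom_mult)
  then have "poly v (fps_nth z 0) = 0" using q(2) by (simp add: fps_eval_nth_0)
  then have dv: "[:- fps_nth z 0, 1:] dvd v" "[:- fps_nth z 0, 1:] dvd q"
    using q(2) by (simp_all add: poly_eq_0_iff_dvd)
  then obtain r where r: "q = [:- fps_nth z 0, 1:] * r" by (auto elim: dvdE)
  have q0: "q \<noteq> 0" using q(1) by auto
  then have "degree r = 0" "r \<noteq> 0" using q(1) r by (auto simp: degree_mult_eq simp del: mult_pCons_left)
  then have "r dvd 1" by (simp add: is_unit_iff_degree)
  then have "q dvd v" using dv(1) unfolding r by (simp only: mult_unit_dvd_iff)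
  then obtain v1 where v1: "v = q * v1" by (auto elim: dvdE)
  have "to_fract q * (x * to_fract (q ^ k * w)) = to_fract q * to_fract v1"
    using Suc.prems unfolding v1 by (simp add: mult_ac)
  then have "x * to_fract (q ^ k * w) = to_fract v1" using q0 by simp
  then show ?case by (rule Suc.IH)
qed auto

end

section \<open>The special nodes and the orders at the four exceptional points\<close>

definition q0 :: "rat poly" where "q0 = [:0, 1:]"
definition q1 :: "rat poly" where "q1 = [:1, 1:]"
definition q2 :: "rat poly" where "q2 = [:1, 2:]"
definition q3 :: "rat poly" where "q3 = [:1, 1/2:]"

definition xi0 :: "rat poly fract" where "xi0 = 2 * zeta + 1"
definition xi1 :: "rat poly fract" where "xi1 = zeta / (zeta + 2)"

definition SS :: "nat \<Rightarrow> nat \<Rightarrow> rat poly fract" where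
  "SS n k = St n zeta xi0 xi1 k"

text \<open>\<open>dd k = \<delta> (k - 1)\<close> in the notation of the paper.\<close>

definition dd :: "nat \<Rightarrow> nat" where "dd k = (\<Sum>j<k. j div 2)"

lemma to_fract_2: "to_fract 2 = (2 :: 'a::idom fract)"
  using to_fract_add[of 1 1] by (simp only: one_add_one to_fract_1)

lemma to_fract_q:
  "to_fract q0 = zeta" "to_fract q1 = 1 + zeta" "to_fract q2 = 1 + 2 * zeta" "to_fract q3 = 1 + zeta / 2"
proof -
  show z: "to_fract q0 = zeta" by (simp add: q0_def zeta_def)
  have "q1 = 1 + q0" by (simp add: q1_def q0_def one_pCons)
  then have "to_fract q1 = to_fract (1 + q0)" by (rule arg_cong)
  then show "to_fract q1 = 1 + zeta" by (simp only: to_fract_add to_fract_1 z)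
  have "q2 = 1 + 2 * q0" by (simp add: q2_def q0_def one_pCons numeral_poly)
  then have "to_fract q2 = to_fract (1 + 2 * q0)" by (rule arg_cong)
  then show "to_fract q2 = 1 + 2 * zeta" by (simp only: to_fract_add to_fract_mult to_fract_1 to_fract_2 z)
  have "2 * q3 = 2 + q0" by (simp add: q3_def q0_def numeral_poly)
  then have "2 * to_fract q3 = 2 + zeta" by (metis to_fract_2 to_fract_add to_fract_mult z)
  moreover have "(2 :: rat poly fract) \<noteq> 0" using to_fract_2 by (metis to_fract_eq_0_iff zero_neq_numeral)
  ultimately show "to_fract q3 = 1 + zeta / 2" by (simp add: field_simps)
qed

lemma q_nonzero [simp]: "q0 \<noteq> 0" "q1 \<noteq> 0" "q2 \<noteq> 0" "q3 \<noteq> 0"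
  by (simp_all add: q0_def q1_def q2_def q3_def)

lemma two_nonzero: "(2 :: rat poly fract) \<noteq> 0"
  by (metis to_fract_2 to_fract_eq_0_iff zero_neq_numeral)

lemma zeta_plus_2: "zeta + 2 = 2 * to_fract q3" "zeta + 2 \<noteq> 0"
proof -
  show *: "zeta + 2 = 2 * to_fract q3" unfolding to_fract_q using two_nonzero by (simp add: field_simps)
  show "zeta + 2 \<noteq> 0" unfolding * using two_nonzero by simp
qed

lemma St_hom:
  fixes h :: "'a::comm_ring_1 \<Rightarrow> 'b::comm_ring_1"
  assumes "comm_ring_hom h"
  shows "h (St n \<zeta> c d a) = St n (h \<zeta>) (h c) (h d) a"
  unfolding St_def Sg_hom[OF assms] by simp

lemma nonconstI: "fps_nth z 1 \<noteq> 0 \<Longrightarrow> nonconst z"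
  unfolding nonconst_def by (metis fps_nth_fps_const zero_neq_one)

lemma fps_to_fls_hom: "comm_ring_hom (fps_to_fls :: rat fps \<Rightarrow> rat fls)"
  by unfold_locales (auto simp: fls_times_fps_to_fls)

lemma lau_zeta: "nonconst z \<Longrightarrow> lau z zeta = fps_to_fls z"
  unfolding zeta_def by (simp add: lau_to_fract fps_eval_pCons) (simp add: fps_eval_def)

lemma lau_2: "nonconst z \<Longrightarrow> lau z 2 = 2"
proof -
  assume z: "nonconst z"
  interpret field_hom "lau z" by (rule lau_field_hom[OF z])
  show ?thesis using hom_add[of 1 1] by simp
qed

lemma lau_SS:
  assumes z: "nonconst z"
  shows "lau z (SS n k) = St n (fps_to_fls z) (fps_to_fls (2 * z + 1)) (fps_to_fls z / (fps_to_fls z + 2)) k"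
proof -
  interpret field_hom "lau z" by (rule lau_field_hom[OF z])
  have "comm_ring_hom (lau z)" ..
  then show ?thesis
    by (simp add: SS_def St_hom xi0_def xi1_def hom_distribs lau_zeta[OF z] lau_2[OF z] fls_times_fps_to_fls)
qed

lemma fps_to_fls_inverse: "fps_nth f 0 \<noteq> 0 \<Longrightarrow> fps_to_fls (inverse f) = inverse (fps_to_fls (f :: rat fps))"
proof -
  assume "fps_nth f 0 \<noteq> 0"
  then have "fps_to_fls f * fps_to_fls (inverse f) = 1"
    by (simp add: inverse_mult_eq_1' flip: fls_times_fps_to_fls)
  then show ?thesis by (simp add: inverse_unique)
qed

lemma lau_SS_fps:
  assumes z: "nonconst z" and z2: "fps_nth z 0 \<noteq> -2"
  shows "lau z (SS n k) = fps_to_fls (St n z (2 * z + 1) (z * inverse (z + 2)) k)"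
proof -
  have "fps_nth (z + 2) 0 \<noteq> 0" using z2 by (simp add: add_eq_0_iff2)
  then have "fps_to_fls (z * inverse (z + 2)) = fps_to_fls z / (fps_to_fls z + 2)"
    by (simp add: fls_times_fps_to_fls fps_to_fls_inverse divide_inverse)
  then show ?thesis
    unfolding lau_SS[OF z] St_hom[OF fps_to_fls_hom] by simp
qed

lemma regular_div:
  assumes z: "nonconst z" and "lau z x = fps_to_fls (fps_X ^ B * g)"
    and "lau z y = fps_to_fls (fps_X * w)" "fps_nth w 0 \<noteq> 0"
  shows "x * inverse y ^ B \<in> regular z"
proof -
  interpret field_hom "lau z" by (rule lau_field_hom[OF z])
  have "lau z (x * inverse y ^ B) = fps_to_fls (g * inverse w ^ B)"
    using assms(2-4)
    by (simp add: hom_mult hom_power hom_inverse fls_times_fps_to_fls fps_to_fls_power power_mult_distrib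
        fps_to_fls_inverse power_inverse)
  then show ?thesis by (auto simp: regular_def)
qed

text \<open>Power series parameters at the points \<open>0, -1, -1/2, -2\<close>, the zeros of \<open>q0, \<dots>, q3\<close>; the last one is
  reduced to the third by the symmetry \<open>\<zeta> \<mapsto> 1/\<zeta>\<close>.\<close>

definition z0 :: "rat fps" where "z0 = fps_X"
definition z1 :: "rat fps" where "z1 = fps_X - 1"
definition z2 :: "rat fps" where "z2 = fps_const (1/2) * (fps_X - 1)"
definition z3 :: "rat fps" where "z3 = inverse z2"

lemma z_nth_0: "fps_nth z0 0 = 0" "fps_nth z1 0 = -1" "fps_nth z2 0 = -1/2" "fps_nth z3 0 = -2"
  by (simp_all add: z0_def z1_def z2_def z3_def)

lemma z3_z2: "z2 * z3 = 1"
  unfolding z3_def by (rule inverse_mult_eq_1') (simp add: z2_def)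

lemma z_nonconst: "nonconst z0" "nonconst z1" "nonconst z2" "nonconst z3"
proof -
  show "nonconst z0" "nonconst z1" "nonconst z2"
    by (auto intro!: nonconstI simp: z0_def z1_def z2_def)
  show "nonconst z3" unfolding nonconst_def
  proof
    assume "z3 = fps_const (fps_nth z3 0)"
    then have "z2 * fps_const (-2) = 1" using z3_z2 z_nth_0(4) by metis
    then have "fps_nth (z2 * fps_const (-2)) 1 = fps_nth 1 1" by simp
    then show False by (simp add: z2_def)
  qed
qed

lemma lau_q:
  "lau z0 (to_fract q0) = fps_to_fls (fps_X * 1)" "lau z1 (to_fract q1) = fps_to_fls (fps_X * 1)"
  "lau z2 (to_fract q2) = fps_to_fls (fps_X * 1)"
  "lau z3 (to_fract q3) = fps_to_fls (fps_X * (fps_const (1/2) * z3))"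
proof -
  have e: "fps_eval z [:a, b:] = fps_const a + fps_const b * z" for z a b
    by (simp add: fps_eval_pCons mult.commute) (simp add: fps_eval_def)
  have "fps_const (1/2) * z3 * (fps_X - 1) = 1"
    using z3_z2 unfolding z2_def by (simp only: mult_ac)
  then have "1 + fps_const (1/2) * z3 = fps_X * (fps_const (1/2) * z3)"
    by (simp add: algebra_simps)
  then show "lau z3 (to_fract q3) = fps_to_fls (fps_X * (fps_const (1/2) * z3))"
    by (simp only: lau_to_fract[OF z_nonconst(4)] q3_def e fps_const_1_eq_1)
  have "1 + fps_const 2 * z2 = fps_X"
    unfolding z2_def by (simp only: mult.assoc[symmetric] fps_const_mult) simp
  then show "lau z2 (to_fract q2) = fps_to_fls (fps_X * 1)"
    by (simp only: lau_to_fract[OF z_nonconst(3)] q2_def e fps_const_1_eq_1 mult_1_right)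
  show "lau z0 (to_fract q0) = fps_to_fls (fps_X * 1)"
    by (simp only: lau_to_fract[OF z_nonconst(1)] q0_def e) (simp add: z0_def)
  show "lau z1 (to_fract q1) = fps_to_fls (fps_X * 1)"
    by (simp only: lau_to_fract[OF z_nonconst(2)] q1_def e) (simp add: z1_def)
qed

lemma order_SS_z1:
  assumes "k \<le> 2 * n + 1"
  shows "\<exists>g. lau z1 (SS n k) = fps_to_fls (fps_X ^ n\<^sup>2 * g)"
proof -
  \<comment> \<open>For zeta = X - 1 the nodes are -1 + 2X and (X - 1)/(X + 1) = -1 + 2X/(1 +
    X).\<close>
  let ?ts = "replicate k 2 @ replicate (2 * n + 1 - k) (2 * inverse (1 + fps_X :: rat fps))"
  have inv: "(1 + fps_X) * inverse (1 + fps_X :: rat fps) = 1" by (rule inverse_mult_eq_1') simp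
  have E1: "2 * z1 + 1 = -1 + fps_X * 2" by (simp add: z1_def algebra_simps)
  have E2: "z1 * inverse (z1 + 2) = -1 + fps_X * (2 * inverse (1 + fps_X))"
  proof -
    have "z1 + 2 = 1 + fps_X" by (simp add: z1_def)
    moreover have "z1 * J = - ((1 + fps_X) * J) + fps_X * (2 * J)" for J by (simp add: z1_def algebra_simps)
    ultimately show ?thesis using inv by (simp only:)
  qed
  have "St n z1 (2 * z1 + 1) (z1 * inverse (z1 + 2)) k = Sg n (fps_X - 1) (map (\<lambda>t. -1 + fps_X * t) ?ts)"
    unfolding St_def E1 E2 map_append map_replicate by (simp only: z1_def)
  moreover obtain g where "Sg n (fps_X - 1) (map (\<lambda>t. -1 + fps_X * t) ?ts) = fps_X ^ n\<^sup>2 * g"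
    using Sg_order_minus_one[of ?ts n] assms by auto
  ultimately show ?thesis using lau_SS_fps[OF z_nonconst(2), of n k] z_nth_0 by auto
qed

lemma order_St_z2:
  assumes "k \<le> 2 * n + 1"
  shows "\<exists>g. St n z2 fps_X (z2 * inverse (z2 + 2)) k = fps_X ^ dd k * g"
proof -
  have "2 * z2 + 1 = fps_X"
    unfolding z2_def numeral_fps_const by (simp only: mult.assoc[symmetric] fps_const_mult) simp
  moreover have "fps_nth (z2 * inverse (z2 + 2)) 0 \<noteq> 0" by (simp add: z_nth_0)
  ultimately show ?thesis unfolding dd_def by (rule St_order_minus_half[OF _ _ assms])
qed

lemma two_z2: "2 * z2 + 1 = fps_X"
  unfolding z2_def numeral_fps_const by (simp only: mult.assoc[symmetric] fps_const_mult) simp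

lemma order_SS_z2:
  assumes "k \<le> 2 * n + 1"
  shows "\<exists>g. lau z2 (SS n k) = fps_to_fls (fps_X ^ dd k * g)"
  using order_St_z2[OF assms] lau_SS_fps[OF z_nonconst(3), of n k] z_nth_0 two_z2 by auto

text \<open>The right side lists \<open>d\<close> first because inversion exchanges the roles of
  \<open>xi0\<close> and \<open>xi1\<close>.\<close>

lemma Sg_reflect_two_values:
  fixes \<zeta> c d :: "'a::field_char_0"
  assumes "\<zeta> \<noteq> 0" "c \<noteq> 0" "d \<noteq> 0" "k \<le> 2 * n + 1"
  shows "\<exists>e\<in>{1, -1}. St n (inverse \<zeta>) (inverse c) (inverse d) k =
    e * inverse \<zeta> ^ (2 * n\<^sup>2) * (inverse c ^ k * inverse d ^ (2 * n + 1 - k)) ^ n * St n \<zeta> d c (2 * n + 1 - k)"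
proof -
  define t where "t i = (if i < k then c else d)" for i
  have m: "map (\<lambda>i. f (t i)) [0..<2 * n + 1] = replicate k (f c) @ replicate (2 * n + 1 - k) (f d)" for f :: "'a \<Rightarrow> 'a"
    by (rule nth_equalityI) (use assms(4) in \<open>auto simp: t_def nth_append simp del: upt_Suc\<close>)
  have "\<exists>e\<in>{1, -1}. Sg n (inverse \<zeta>) (map (\<lambda>i. inverse (t i)) [0..<2 * n + 1]) =
    e * inverse \<zeta> ^ (2 * n\<^sup>2) * (\<Prod>i<2 * n + 1. inverse (t i)) ^ n * Sg n \<zeta> (map t [0..<2 * n + 1])"
    using assms by (intro Sg_reflect) (auto simp: t_def)
  moreover have "(\<Prod>i<2 * n + 1. inverse (t i)) = inverse c ^ k * inverse d ^ (2 * n + 1 - k)"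
  proof -
    have N: "2 * n + 1 = k + (2 * n + 1 - k)" using assms(4) by simp
    have "(\<Prod>i<k + (2 * n + 1 - k). inverse (t i)) = inverse c ^ k * inverse d ^ (2 * n + 1 - k)"
      unfolding prod_split_lessThan by (simp add: t_def)
    then show ?thesis using N by simp
  qed
  moreover have "Sg n \<zeta> (map t [0..<2 * n + 1]) = St n \<zeta> d c (2 * n + 1 - k)"
    unfolding St_def m[of "\<lambda>x. x"] using assms(4) by (intro Sg_linpoly) (simp add: mult.commute)
  ultimately show ?thesis unfolding m[of inverse] St_def by simp
qed

text \<open>At zeta = -2 the node \<open>xi1\<close> has a pole. Inversion leads to -1/2 and to the
  node X, whose negative powers in the reflection formula are cancelled by the given power of
  \<open>q3\<close>; \<open>order_St_z2\<close> does the rest.\<close>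

lemma order_SS_z3:
  assumes "k \<le> 2 * n + 1"
  shows "\<exists>g. lau z3 (to_fract q3 ^ (n * (2 * n + 1 - k)) * SS n k) = fps_to_fls (fps_X ^ dd (2 * n + 1 - k) * g)"
proof -
  interpret field_hom "lau z3" by (rule lau_field_hom[OF z_nonconst(4)])
  let ?b = "2 * n + 1 - k"
  let ?f = "fps_to_fls :: rat fps \<Rightarrow> rat fls"
  define x1 where "x1 = z2 * inverse (z2 + 2)"
  have z2n: "fps_nth z2 0 \<noteq> 0" "fps_nth (z2 + 2) 0 \<noteq> 0" by (simp_all add: z_nth_0)
  have x1n: "fps_nth x1 0 \<noteq> 0" by (simp add: x1_def z_nth_0)
  have fz3: "?f z3 = inverse (?f z2)" unfolding z3_def by (rule fps_to_fls_inverse[OF z2n(1)])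
  have fz2: "?f z2 \<noteq> 0" using z2n(1) by auto
  have c: "?f (2 * z3 + 1) = inverse (?f x1)"
    unfolding x1_def using fz2 z2n fz3
    by (simp add: fls_times_fps_to_fls fps_to_fls_inverse field_simps)
  have "?f (2 * z2 + 1) = 2 * ?f z2 + 1" by (simp add: fls_times_fps_to_fls)
  then have X: "?f (fps_X) = 2 * ?f z2 + 1" by (simp only: two_z2)
  have d: "?f z3 / (?f z3 + 2) = inverse (?f fps_X)"
    unfolding fz3 X using fz2 by (simp add: field_simps)
  obtain e where e: "e \<in> {1, -1}" "St n (inverse (?f z2)) (inverse (?f x1)) (inverse (?f fps_X)) k =
    e * inverse (?f z2) ^ (2 * n\<^sup>2) * (inverse (?f x1) ^ k * inverse (?f fps_X) ^ ?b) ^ n * St n (?f z2) (?f fps_X) (?f x1) ?b"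
  proof -
    have "?f x1 \<noteq> 0" "?f fps_X \<noteq> 0" using x1n by auto
    from Sg_reflect_two_values[OF fz2 this assms] show ?thesis using that by blast
  qed
  obtain g where g: "St n z2 fps_X x1 ?b = fps_X ^ dd ?b * g"
    using order_St_z2[of ?b n] unfolding x1_def by auto
  obtain e0 where e0: "e = ?f e0" using e(1) by (metis fps_one_to_fls fps_to_fls_uminus insertE singletonD)
  let ?w = "fps_const (1/2) * z3"
  have "lau z3 (SS n k) = e * inverse (?f z2) ^ (2 * n\<^sup>2) * (inverse (?f x1) ^ k * inverse (?f fps_X) ^ ?b) ^ n *
      ?f (fps_X ^ dd ?b * g)"
    unfolding lau_SS[OF z_nonconst(4)] c d unfolding fz3 e(2) St_hom[OF fps_to_fls_hom, symmetric] g ..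
  then have "lau z3 (to_fract q3 ^ (n * ?b) * SS n k) =
      (?f fps_X * ?f ?w) ^ (n * ?b) * (?f e0 * ?f (inverse z2) ^ (2 * n\<^sup>2) * (?f (inverse x1) ^ k * inverse (?f fps_X) ^ ?b) ^ n *
      ?f (fps_X ^ dd ?b * g))"
    by (simp only: hom_mult hom_power lau_q fls_times_fps_to_fls e0 fps_to_fls_inverse[OF z2n(1)] fps_to_fls_inverse[OF x1n])
  also have "\<dots> = ?f (fps_X ^ dd ?b * (?w ^ (n * ?b) * e0 * inverse z2 ^ (2 * n\<^sup>2) * inverse x1 ^ (k * n) * g))"
  proof -
    have 1: "(?f fps_X) ^ (n * ?b) * (inverse (?f fps_X) ^ ?b) ^ n = 1"
      by (simp add: power_mult[symmetric] mult.commute power_inverse)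
    have 2: "(r1 * r2) * (r3 * r4 * (r5 * r6) * (r7 * r8)) = r7 * (r2 * r3 * r4 * r5 * r8)"
      if "r1 * r6 = 1" for r1 r2 r3 r4 r5 r6 r7 r8 :: "rat fls"
    proof -
      have "(r1 * r2) * (r3 * r4 * (r5 * r6) * (r7 * r8)) = (r1 * r6) * (r7 * (r2 * r3 * r4 * r5 * r8))"
        by (simp only: mult_ac)
      then show ?thesis by (simp only: that mult_1_left)
    qed
    show ?thesis
      unfolding power_mult_distrib[of "?f fps_X" "?f ?w"] power_mult_distrib[of "?f (inverse x1) ^ k"]
        fls_times_fps_to_fls[of "fps_X ^ dd ?b"] 2[OF 1]
      by (simp only: fls_times_fps_to_fls fps_to_fls_power power_mult)
  qed
  finally show ?thesis by blast
qed

section \<open>The normalised values are polynomials\<close>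

instance fract :: ("{idom, ring_char_0}") ring_char_0
proof
  have "of_nat k = to_fract (of_nat k :: 'a)" for k
    by (induction k) simp_all
  then show "inj (of_nat :: nat \<Rightarrow> 'a fract)" by (simp add: inj_def)
qed

instance fract :: ("{idom, ring_char_0}") field_char_0 ..

text \<open>The exponents are the orders established above: B at 0, n^2 at -1, \<open>dd k\<close>
  at -1/2 and, after clearing the pole of \<open>xi1\<close>, \<open>dd (2 * n + 1 - k)\<close> at
  -2.\<close>

definition Qf :: "nat \<Rightarrow> nat \<Rightarrow> nat \<Rightarrow> rat poly fract" where
  "Qf n k B = to_fract q3 ^ (n * (2 * n + 1 - k)) * SS n k *
     (inverse (to_fract q0) ^ B * inverse (to_fract q1) ^ n\<^sup>2 *
      inverse (to_fract q2) ^ dd k * inverse (to_fract q3) ^ dd (2 * n + 1 - k))"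

text \<open>The three cases belong to \<open>p\<^sub>n\<close>, \<open>Y\<close> and the reflection of \<open>p\<^sub>n\<close>.\<close>

definition admissible :: "nat \<Rightarrow> nat \<Rightarrow> nat \<Rightarrow> bool" where
  "admissible n k B \<longleftrightarrow> (k = n + 1 \<and> B = n\<^sup>2) \<or> (k = n + 2 \<and> B = n\<^sup>2 - 1 \<and> n \<ge> 1) \<or> (k = n \<and> B = n\<^sup>2 + n)"

lemma admissible_le: "admissible n k B \<Longrightarrow> k \<le> 2 * n + 1"
  by (auto simp: admissible_def)

lemma at_zero_cd: "2 * z0 + 1 = at_zero.c" "z0 * inverse (z0 + 2) = at_zero.d"
  by (simp_all add: z0_def at_zero.c_def at_zero.d_def at_zero.t1_def add.commute)

lemma lau_SS_z0: "lau z0 (SS n k) = fps_to_fls (St n fps_X at_zero.c at_zero.d k)"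
  using lau_SS_fps[OF z_nonconst(1), of n k] z_nth_0 unfolding at_zero_cd by (simp add: z0_def)

lemma order_SS_z0:
  assumes "admissible n k B"
  shows "\<exists>g. lau z0 (SS n k) = fps_to_fls (fps_X ^ B * g)"
  using assms at_zero.order_p[of n] at_zero.order_Y[of n] at_zero.order_p_tilde[of n]
  unfolding lau_SS_z0 admissible_def by auto

lemma Qf_regular:
  assumes admissible_intros: "admissible n k B"
  shows "Qf n k B \<in> regular z0" "Qf n k B \<in> regular z1" "Qf n k B \<in> regular z2" "Qf n k B \<in> regular z3"
proof -
  note k = admissible_le[OF admissible_intros]
  have u: "to_fract q1 \<in> units z0" "to_fract q2 \<in> units z0" "to_fract q3 \<in> units z0"
    "to_fract q0 \<in> units z1" "to_fract q2 \<in> units z1" "to_fract q3 \<in> units z1"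
    "to_fract q0 \<in> units z2" "to_fract q1 \<in> units z2" "to_fract q3 \<in> units z2"
    "to_fract q0 \<in> units z3" "to_fract q1 \<in> units z3" "to_fract q2 \<in> units z3"
    by (auto intro!: to_fract_units z_nonconst simp: z_nth_0 q0_def q1_def q2_def q3_def)
  note ui = units_power units_inverse units_mult units_regular u z_nonconst
  have one: "fps_nth (1 :: rat fps) 0 \<noteq> 0" by simp
  obtain g where "lau z0 (SS n k) = fps_to_fls (fps_X ^ B * g)" using order_SS_z0[OF admissible_intros] by blast
  from regular_div[OF z_nonconst(1) this lau_q(1) one]
  have "SS n k * inverse (to_fract q0) ^ B * (to_fract q3 ^ (n * (2 * n + 1 - k)) *
      (inverse (to_fract q1) ^ n\<^sup>2 * inverse (to_fract q2) ^ dd k * inverse (to_fract q3) ^ dd (2 * n + 1 - k))) \<in> regular z0"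
    by (rule regular_mult[OF z_nonconst(1)]) (intro ui)
  then show "Qf n k B \<in> regular z0" unfolding Qf_def by (simp only: mult_ac)
  obtain g where "lau z1 (SS n k) = fps_to_fls (fps_X ^ n\<^sup>2 * g)" using order_SS_z1[OF k] by blast
  from regular_div[OF z_nonconst(2) this lau_q(2) one]
  have "SS n k * inverse (to_fract q1) ^ n\<^sup>2 * (to_fract q3 ^ (n * (2 * n + 1 - k)) *
      (inverse (to_fract q0) ^ B * inverse (to_fract q2) ^ dd k * inverse (to_fract q3) ^ dd (2 * n + 1 - k))) \<in> regular z1"
    by (rule regular_mult[OF z_nonconst(2)]) (intro ui)
  then show "Qf n k B \<in> regular z1" unfolding Qf_def by (simp only: mult_ac)
  obtain g where "lau z2 (SS n k) = fps_to_fls (fps_X ^ dd k * g)" using order_SS_z2[OF k] by blast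
  from regular_div[OF z_nonconst(3) this lau_q(3) one]
  have "SS n k * inverse (to_fract q2) ^ dd k * (to_fract q3 ^ (n * (2 * n + 1 - k)) *
      (inverse (to_fract q0) ^ B * inverse (to_fract q1) ^ n\<^sup>2 * inverse (to_fract q3) ^ dd (2 * n + 1 - k))) \<in> regular z2"
    by (rule regular_mult[OF z_nonconst(3)]) (intro ui)
  then show "Qf n k B \<in> regular z2" unfolding Qf_def by (simp only: mult_ac)
  obtain g where "lau z3 (to_fract q3 ^ (n * (2 * n + 1 - k)) * SS n k) = fps_to_fls (fps_X ^ dd (2 * n + 1 - k) * g)"
    using order_SS_z3[OF k] by blast
  moreover have "fps_nth (fps_const (1/2) * z3) 0 \<noteq> 0" by (simp add: z_nth_0)
  ultimately have "to_fract q3 ^ (n * (2 * n + 1 - k)) * SS n k * inverse (to_fract q3) ^ dd (2 * n + 1 - k) \<in> regular z3"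
    by (rule regular_div[OF z_nonconst(4) _ lau_q(4)])
  then
  have "to_fract q3 ^ (n * (2 * n + 1 - k)) * SS n k * inverse (to_fract q3) ^ dd (2 * n + 1 - k) *
      (inverse (to_fract q0) ^ B * inverse (to_fract q1) ^ n\<^sup>2 * inverse (to_fract q2) ^ dd k) \<in> regular z3"
    by (rule regular_mult[OF z_nonconst(4)]) (intro ui)
  then show "Qf n k B \<in> regular z3" unfolding Qf_def by (simp only: mult_ac)
qed

text \<open>Needed to exclude poles other than the four points handled by expansions: evaluating \<open>S\<^sub>n\<close> at \<open>\<xi>\<^sub>0, \<xi>\<^sub>1\<close>
  creates no denominators besides powers of \<open>\<zeta> + 2\<close>.\<close>

definition q3_fractions :: "rat poly fract set" where
  "q3_fractions = {x. \<exists>M w. x * to_fract (q3 ^ M) = to_fract w}"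

lemma q3_fractions_add: "x \<in> q3_fractions \<Longrightarrow> y \<in> q3_fractions \<Longrightarrow> x + y \<in> q3_fractions"
proof -
  assume "x \<in> q3_fractions" "y \<in> q3_fractions"
  then obtain M w M' w' where e: "x * to_fract (q3 ^ M) = to_fract w" "y * to_fract (q3 ^ M') = to_fract w'"
    unfolding q3_fractions_def by blast
  have "(x + y) * to_fract (q3 ^ (M + M')) =
      (x * to_fract (q3 ^ M)) * to_fract (q3 ^ M') + (y * to_fract (q3 ^ M')) * to_fract (q3 ^ M)"
    by (simp add: power_add algebra_simps)
  also have "\<dots> = to_fract (w * q3 ^ M' + w' * q3 ^ M)" unfolding e by simp
  finally show ?thesis unfolding q3_fractions_def by blast
qed

lemma q3_fractions_mult: "x \<in> q3_fractions \<Longrightarrow> y \<in> q3_fractions \<Longrightarrow> x * y \<in> q3_fractions"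
proof -
  assume "x \<in> q3_fractions" "y \<in> q3_fractions"
  then obtain M w M' w' where e: "x * to_fract (q3 ^ M) = to_fract w" "y * to_fract (q3 ^ M') = to_fract w'"
    unfolding q3_fractions_def by blast
  have "(x * y) * to_fract (q3 ^ (M + M')) = (x * to_fract (q3 ^ M)) * (y * to_fract (q3 ^ M'))"
    by (simp add: power_add mult_ac)
  also have "\<dots> = to_fract (w * w')" unfolding e by simp
  finally show ?thesis unfolding q3_fractions_def by blast
qed

lemma to_fract_q3_fractions: "to_fract w \<in> q3_fractions"
proof -
  have "to_fract w * to_fract (q3 ^ 0) = to_fract w" by simp
  then show ?thesis unfolding q3_fractions_def by blast
qed

lemma meval_q3_fractions:
  assumes "\<And>i. v i \<in> q3_fractions"
  shows "meval v P \<in> q3_fractions"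
proof -
  have pow: "x ^ k \<in> q3_fractions" if "x \<in> q3_fractions" for x k
    by (induction k) (use that to_fract_q3_fractions[of 1] in \<open>auto intro: q3_fractions_mult\<close>)
  have prod: "(\<Prod>i\<in>A. f i) \<in> q3_fractions" if "\<And>i. f i \<in> q3_fractions" for A and f :: "nat \<Rightarrow> _"
    by (induction A rule: infinite_finite_induct)
      (use that to_fract_q3_fractions[of 1] in \<open>auto intro: q3_fractions_mult\<close>)
  have sum: "(\<Sum>i\<in>A. f i) \<in> q3_fractions" if "\<And>i. f i \<in> q3_fractions" for A and f :: "(nat \<Rightarrow>\<^sub>0 nat) \<Rightarrow> _"
    by (induction A rule: infinite_finite_induct)
      (use that to_fract_q3_fractions[of 0] in \<open>auto intro: q3_fractions_add\<close>)
  show ?thesis unfolding meval_def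
    by (intro sum q3_fractions_mult to_fract_q3_fractions prod pow assms)
qed

lemma map_two_values:
  "k \<le> N \<Longrightarrow> map (\<lambda>i. if i < k then c else d) [0..<N] = replicate k c @ replicate (N - k) d"
  by (rule nth_equalityI) (auto simp: nth_append)

lemma SS_meval: "k \<le> 2 * n + 1 \<Longrightarrow> SS n k = meval (\<lambda>i. if i < k then xi0 else xi1) (S n)"
  unfolding meval_S SS_def St_def by (simp only: map_two_values)

lemma SS_q3_fractions: "k \<le> 2 * n + 1 \<Longrightarrow> SS n k \<in> q3_fractions"
proof -
  have "xi0 = to_fract q2" by (simp add: xi0_def to_fract_q)
  then have 0: "xi0 \<in> q3_fractions" using to_fract_q3_fractions[of q2] by metis
  have "q0 = 2 * [:0, 1/2:]" by (simp add: q0_def numeral_poly)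
  then have "zeta = 2 * to_fract [:0, 1/2:]"
    using to_fract_q(1) by (metis to_fract_2 to_fract_mult)
  then have "xi1 * to_fract (q3 ^ 1) = to_fract [:0, 1/2:]"
    unfolding xi1_def zeta_plus_2(1) using two_nonzero by (simp add: field_simps)
  then have "xi1 \<in> q3_fractions" unfolding q3_fractions_def by blast
  with 0 show "k \<le> 2 * n + 1 \<Longrightarrow> SS n k \<in> q3_fractions"
    by (simp only: SS_meval) (rule meval_q3_fractions, simp)
qed

lemma Qf_denominators:
  "Qf n k B * (to_fract q0 ^ B * to_fract q1 ^ n\<^sup>2 * to_fract q2 ^ dd k * to_fract q3 ^ dd (2 * n + 1 - k)) =
     to_fract q3 ^ (n * (2 * n + 1 - k)) * SS n k"
proof -
  have c: "inverse (to_fract w) ^ e * to_fract w ^ e = 1" if "w \<noteq> 0" for w :: "rat poly" and e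
    using that by (simp add: power_mult_distrib[symmetric])
  have "Qf n k B * (to_fract q0 ^ B * to_fract q1 ^ n\<^sup>2 * to_fract q2 ^ dd k * to_fract q3 ^ dd (2 * n + 1 - k)) =
    to_fract q3 ^ (n * (2 * n + 1 - k)) * SS n k *
    ((inverse (to_fract q0) ^ B * to_fract q0 ^ B) * (inverse (to_fract q1) ^ n\<^sup>2 * to_fract q1 ^ n\<^sup>2) *
     (inverse (to_fract q2) ^ dd k * to_fract q2 ^ dd k) *
     (inverse (to_fract q3) ^ dd (2 * n + 1 - k) * to_fract q3 ^ dd (2 * n + 1 - k)))"
    unfolding Qf_def by (simp only: mult_ac)
  then show ?thesis by (simp only: c q_nonzero mult_1_right not_False_eq_True simp_thms)
qed

lemma to_fract_power: "to_fract (w ^ k) = to_fract w ^ k"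
  by (induction k) simp_all

text \<open>The denominator is a product of powers of \<open>q0\<close>, ..., \<open>q3\<close>, and
  regularity at the zero of each factor removes its power, one factor after another.\<close>

lemma Qf_polynomial:
  assumes admissible_intros: "admissible n k B"
  shows "\<exists>v. Qf n k B = to_fract v"
proof -
  let ?x = "Qf n k B"
  obtain M w where M: "SS n k * to_fract (q3 ^ M) = to_fract w"
    using SS_q3_fractions[OF admissible_le[OF admissible_intros]] unfolding q3_fractions_def by blast
  let ?e = "dd (2 * n + 1 - k)"
  have "?x * to_fract (q0 ^ B * (q1 ^ n\<^sup>2 * (q2 ^ dd k * (q3 ^ (?e + M) * 1)))) =
      ?x * (to_fract q0 ^ B * to_fract q1 ^ n\<^sup>2 * to_fract q2 ^ dd k * to_fract q3 ^ ?e) * to_fract (q3 ^ M)"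
    by (simp only: to_fract_mult to_fract_power power_add to_fract_1 mult_1_right mult_ac)
  also have "\<dots> = to_fract q3 ^ (n * (2 * n + 1 - k)) * (SS n k * to_fract (q3 ^ M))"
    unfolding Qf_denominators by (simp only: mult_ac)
  also have "\<dots> = to_fract (q3 ^ (n * (2 * n + 1 - k)) * w)"
    unfolding M by (simp only: to_fract_mult to_fract_power)
  finally have 0: "?x * to_fract (q0 ^ B * (q1 ^ n\<^sup>2 * (q2 ^ dd k * (q3 ^ (?e + M) * 1)))) = \<dots>" .
  have deg: "degree q0 = 1" "degree q1 = 1" "degree q2 = 1" "degree q3 = 1"
    and rt: "poly q0 (fps_nth z0 0) = 0" "poly q1 (fps_nth z1 0) = 0" "poly q2 (fps_nth z2 0) = 0"
      "poly q3 (fps_nth z3 0) = 0"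
    by (simp_all add: q0_def q1_def q2_def q3_def z_nth_0)
  note reg = Qf_regular[OF admissible_intros]
  obtain v1 where "?x * to_fract (q1 ^ n\<^sup>2 * (q2 ^ dd k * (q3 ^ (?e + M) * 1))) = to_fract v1"
    using regular_cancel[OF z_nonconst(1) reg(1) 0 deg(1) rt(1)] by blast
  from regular_cancel[OF z_nonconst(2) reg(2) this deg(2) rt(2)]
  obtain v2 where "?x * to_fract (q2 ^ dd k * (q3 ^ (?e + M) * 1)) = to_fract v2" by blast
  from regular_cancel[OF z_nonconst(3) reg(3) this deg(3) rt(3)]
  obtain v3 where "?x * to_fract (q3 ^ (?e + M) * 1) = to_fract v3" by blast
  from regular_cancel[OF z_nonconst(4) reg(4) this deg(4) rt(4)]
  show ?thesis by simp
qed

definition Qp :: "nat \<Rightarrow> nat \<Rightarrow> nat \<Rightarrow> rat poly" where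
  "Qp n k B = of_fract (Qf n k B)"

lemma to_fract_Qp: "admissible n k B \<Longrightarrow> to_fract (Qp n k B) = Qf n k B"
  using Qf_polynomial unfolding Qp_def by fastforce

section \<open>The recurrence for the normalised values\<close>

abbreviation "qa \<equiv> to_fract q0"
abbreviation "qb \<equiv> to_fract q1"
abbreviation "qc \<equiv> to_fract q2"
abbreviation "qd \<equiv> to_fract q3"

lemma two_cancel: "2 * x = 2 * y \<Longrightarrow> x = (y :: rat poly fract)"
  by (rule iffD1[OF mult_left_cancel[OF two_nonzero]])

lemma xi_q: "xi0 = qc" "xi1 = qa / (2 * qd)"
  unfolding xi0_def xi1_def zeta_plus_2(1) by (simp_all add: to_fract_q)

lemma two_qd: "2 * qd = qa + 2" and qb_qa: "qb = 1 + qa" and qc_qa: "qc = 1 + 2 * qa"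
  using zeta_plus_2(1) by (simp_all add: to_fract_q)

lemma xi_difference: "(xi1 - xi0) * qd = - qb\<^sup>2"
proof -
  have "2 * ((xi1 - xi0) * qd) = qa - qc * (2 * qd)"
    unfolding xi_q using two_nonzero by (simp add: field_simps)
  also have "\<dots> = 2 * (- qb\<^sup>2)"
    unfolding two_qd qb_qa qc_qa by (simp add: algebra_simps power2_eq_square)
  finally show ?thesis by (rule two_cancel)
qed

lemma G_values:
  "G zeta xi0 xi0 = 2 * qc\<^sup>2 * qb\<^sup>2"
  "2 * qd\<^sup>2 * G zeta xi0 xi1 = qa\<^sup>2 * qb\<^sup>2"
  "2 * qd\<^sup>2 * G zeta xi1 xi1 = qa\<^sup>2 * qb\<^sup>2"
proof -
  have z: "zeta = qa" by (simp add: to_fract_q)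
  have w: "xi1 * (qa + 2) = qa" unfolding xi_q two_qd[symmetric] using two_nonzero by simp
  show "G zeta xi0 xi0 = 2 * qc\<^sup>2 * qb\<^sup>2"
    unfolding xi_q z G_def qb_qa qc_qa by (simp add: algebra_simps power2_eq_square)
  have 2: "4 * qd\<^sup>2 = (qa + 2)\<^sup>2" unfolding two_qd[symmetric] by (simp add: power_mult_distrib)
  have "4 * qd\<^sup>2 * G zeta xi0 xi1 = ((qa + 2) * xi0 - qa) * (xi1 * (qa + 2))\<^sup>2 +
      ((qa + 2) * xi0\<^sup>2 - 2 * (qa\<^sup>2 + 3 * qa + 1) * xi0 + qa * (2 * qa + 1)) * (xi1 * (qa + 2)) * (qa + 2) +
      (qa * (2 * qa + 1) * xi0 - qa * xi0\<^sup>2) * (qa + 2)\<^sup>2"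
    unfolding 2 G_def z by (simp add: algebra_simps power2_eq_square)
  also have "\<dots> = 2 * (qa\<^sup>2 * qb\<^sup>2)"
    unfolding w xi_q(1) qb_qa qc_qa by (simp add: algebra_simps power2_eq_square)
  also have "4 * qd\<^sup>2 * G zeta xi0 xi1 = 2 * (2 * qd\<^sup>2 * G zeta xi0 xi1)" by simp
  finally show "2 * qd\<^sup>2 * G zeta xi0 xi1 = qa\<^sup>2 * qb\<^sup>2" by (rule two_cancel)
  have "4 * qd\<^sup>2 * G zeta xi1 xi1 = 2 * (xi1 * (qa + 2)) ^ 3 -
      (2 * qa + 2 * (qa\<^sup>2 + 3 * qa + 1)) * (xi1 * (qa + 2))\<^sup>2 +
      2 * (qa * (2 * qa + 1)) * (xi1 * (qa + 2)) * (qa + 2)"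
    unfolding 2 G_def z by (simp add: algebra_simps power2_eq_square power3_eq_cube)
  also have "\<dots> = 2 * (qa\<^sup>2 * qb\<^sup>2)"
    unfolding w qb_qa by (simp add: algebra_simps power2_eq_square power3_eq_cube)
  also have "4 * qd\<^sup>2 * G zeta xi1 xi1 = 2 * (2 * qd\<^sup>2 * G zeta xi1 xi1)" by simp
  finally show "2 * qd\<^sup>2 * G zeta xi1 xi1 = qa\<^sup>2 * qb\<^sup>2" by (rule two_cancel)
qed

text \<open>\<open>St_desnanot\<close> at the special nodes, multiplied by 4 qd^4 and with the
  common factor qb^4 cancelled.\<close>

lemma SS_desnanot:
  "4 * qd\<^sup>2 * SS (m + 2) (m + 3) * SS m (m + 1) =
     qa ^ 4 * SS (m + 1) (m + 3) * SS (m + 1) (m + 1) - 4 * qd\<^sup>2 * qc\<^sup>2 * qa\<^sup>2 * (SS (m + 1) (m + 2))\<^sup>2"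
proof -
  have nz: "qa \<noteq> 0" "qb \<noteq> 0" "qc \<noteq> 0" "qd \<noteq> 0" by simp_all
  have G: "G zeta xi0 xi0 \<noteq> 0" "G zeta xi0 xi1 \<noteq> 0" "G zeta xi1 xi1 \<noteq> 0"
  proof -
    show "G zeta xi0 xi0 \<noteq> 0" unfolding G_values(1) using two_nonzero by simp
    have "qa\<^sup>2 * qb\<^sup>2 \<noteq> 0" by simp
    then show "G zeta xi0 xi1 \<noteq> 0" "G zeta xi1 xi1 \<noteq> 0"
      using G_values(2,3) by (metis mult_zero_right)+
  qed
  have "xi0 \<noteq> xi1" using xi_difference by auto
  from St_desnanot[OF zeta_plus_2(2) this G]
  have J: "(xi1 - xi0)\<^sup>2 * SS (m + 2) (m + 3) * SS m (m + 1) =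
    (G zeta xi0 xi1)\<^sup>2 * SS (m + 1) (m + 3) * SS (m + 1) (m + 1) -
    G zeta xi0 xi0 * G zeta xi1 xi1 * (SS (m + 1) (m + 2))\<^sup>2"
    unfolding SS_def by blast
  let ?u = "SS (m + 2) (m + 3) * SS m (m + 1)" and ?v = "SS (m + 1) (m + 3) * SS (m + 1) (m + 1)"
    and ?w = "(SS (m + 1) (m + 2))\<^sup>2"
  have "qb ^ 4 * (4 * qd\<^sup>2 * ?u) = 4 * qd ^ 4 * (((xi1 - xi0)\<^sup>2) * ?u)"
  proof -
    have "qb ^ 4 = ((xi1 - xi0) * qd)\<^sup>2" unfolding xi_difference by simp
    then show ?thesis by (simp add: power_mult_distrib power2_eq_square power4_eq_xxxx mult_ac)
  qed
  also have "\<dots> = (2 * qd\<^sup>2 * G zeta xi0 xi1)\<^sup>2 * ?v -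
      2 * qd\<^sup>2 * (2 * qd\<^sup>2 * G zeta xi1 xi1) * G zeta xi0 xi0 * ?w"
    unfolding J[unfolded mult.assoc[of _ "SS (m + 2) (m + 3)"] mult.assoc[of _ "SS (m + 1) (m + 3)"]]
    by (simp add: power_mult_distrib power2_eq_square power4_eq_xxxx algebra_simps)
  also have "\<dots> = qb ^ 4 * (qa ^ 4 * ?v - 4 * qd\<^sup>2 * qc\<^sup>2 * qa\<^sup>2 * ?w)"
    unfolding G_values by (simp add: power_mult_distrib power2_eq_square power4_eq_xxxx algebra_simps)
  finally have "4 * qd\<^sup>2 * ?u = qa ^ 4 * ?v - 4 * qd\<^sup>2 * qc\<^sup>2 * qa\<^sup>2 * ?w"
    using nz by (simp only: mult_cancel_left power_eq_0_iff) simp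
  then show ?thesis by (simp only: mult_ac)
qed

lemma dd_Suc: "dd (Suc k) = dd k + k div 2"
  by (simp add: dd_def)

text \<open>Exponent bookkeeping. The second difference of n^2 accounts for qb^2, the exponents at 0
  leave the power qa^(m+2) of the coefficient B in the theorem, and the second differences of
  \<open>dd\<close>, which are 0 or 1, produce the parity-dependent powers.\<close>

lemma Qf_desnanot:
  "4 * qb\<^sup>2 * Qf (m + 2) (m + 3) ((m + 2)\<^sup>2) * Qf m (m + 1) (m\<^sup>2) =
     qa ^ (m + 2) * Qf (m + 1) (m + 3) ((m + 1)\<^sup>2 - 1) * Qf (m + 1) (m + 1) ((m + 1)\<^sup>2 + (m + 1)) -
     4 * qc ^ (1 + of_bool (even (m + 1))) * qd ^ (1 + of_bool (odd (m + 1))) * (Qf (m + 1) (m + 2) ((m + 1)\<^sup>2))\<^sup>2"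
proof -
  let ?S2 = "SS (m + 2) (m + 3)" and ?S0 = "SS m (m + 1)" and ?Sp = "SS (m + 1) (m + 3)"
    and ?Sm = "SS (m + 1) (m + 1)" and ?S1 = "SS (m + 1) (m + 2)"
  let ?P2 = "Qf (m + 2) (m + 3) ((m + 2)\<^sup>2)" and ?P0 = "Qf m (m + 1) (m\<^sup>2)"
    and ?Y = "Qf (m + 1) (m + 3) ((m + 1)\<^sup>2 - 1)" and ?T = "Qf (m + 1) (m + 1) ((m + 1)\<^sup>2 + (m + 1))"
    and ?P1 = "Qf (m + 1) (m + 2) ((m + 1)\<^sup>2)"
  have nz: "qa \<noteq> 0" "qb \<noteq> 0" "qc \<noteq> 0" "qd \<noteq> 0" by simp_all
  have a: "2 * (m + 2) + 1 - (m + 3) = m + 2" "2 * m + 1 - (m + 1) = m" "2 * (m + 1) + 1 - (m + 3) = m"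
    "2 * (m + 1) + 1 - (m + 1) = m + 2" "2 * (m + 1) + 1 - (m + 2) = m + 1" by auto
  note d2 = Qf_denominators[of "m + 2" "m + 3" "(m + 2)\<^sup>2", unfolded a]
    and d0 = Qf_denominators[of m "m + 1" "m\<^sup>2", unfolded a]
    and dp = Qf_denominators[of "m + 1" "m + 3" "(m + 1)\<^sup>2 - 1", unfolded a]
    and dm = Qf_denominators[of "m + 1" "m + 1" "(m + 1)\<^sup>2 + (m + 1)", unfolded a]
    and d1 = Qf_denominators[of "m + 1" "m + 2" "(m + 1)\<^sup>2", unfolded a]
  let ?E = "(m + 2) * (m + 2) + m * m"
  have E: "?E = (m + 1) * m + (m + 1) * (m + 2) + 2" "?E = 2 * ((m + 1) * (m + 1)) + 2"
    by (simp_all add: algebra_simps)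
  have "4 * (qd ^ ((m + 2) * (m + 2)) * ?S2) * (qd ^ (m * m) * ?S0) = qd ^ ?E * (4 * ?S2 * ?S0)"
    by (simp only: power_add mult_ac)
  also have "qd\<^sup>2 * \<dots> = qd ^ ?E * (4 * qd\<^sup>2 * ?S2 * ?S0)" by (simp only: mult_ac)
  also have "\<dots> = qd ^ ?E * (qa ^ 4 * ?Sp * ?Sm) - qd ^ ?E * (4 * qd\<^sup>2 * qc\<^sup>2 * qa\<^sup>2 * ?S1\<^sup>2)"
    unfolding SS_desnanot by (simp only: right_diff_distrib)
  also have "qd ^ ?E * (qa ^ 4 * ?Sp * ?Sm) =
      qd\<^sup>2 * (qa ^ 4 * (qd ^ ((m + 1) * m) * ?Sp) * (qd ^ ((m + 1) * (m + 2)) * ?Sm))"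
    unfolding E(1) power_add by (simp only: mult_ac)
  also have "qd ^ ?E * (4 * qd\<^sup>2 * qc\<^sup>2 * qa\<^sup>2 * ?S1\<^sup>2) =
      qd\<^sup>2 * (4 * qd\<^sup>2 * qc\<^sup>2 * qa\<^sup>2 * (qd ^ ((m + 1) * (m + 1)) * ?S1)\<^sup>2)"
    unfolding E(2) power_add power_mult_distrib power_mult[of qd 2, symmetric]
    by (simp only: mult_ac power_mult[symmetric])
  finally have J: "4 * (qd ^ ((m + 2) * (m + 2)) * ?S2) * (qd ^ (m * m) * ?S0) =
      qa ^ 4 * (qd ^ ((m + 1) * m) * ?Sp) * (qd ^ ((m + 1) * (m + 2)) * ?Sm) -
      4 * qd\<^sup>2 * qc\<^sup>2 * qa\<^sup>2 * (qd ^ ((m + 1) * (m + 1)) * ?S1)\<^sup>2"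
    using nz unfolding right_diff_distrib[symmetric] by (simp only: mult_cancel_left power_eq_0_iff) simp
  let ?K = "qa ^ (2 * (m + 1)\<^sup>2 + 2) * qb ^ (2 * (m + 1)\<^sup>2) * qc ^ (dd (m + 3) + dd (m + 1)) * qd ^ (dd (m + 2) + dd m)"
  have sq: "(m + 2)\<^sup>2 + m\<^sup>2 = 2 * (m + 1)\<^sup>2 + 2" by (simp add: power2_eq_square algebra_simps)
  have l: "4 * (qd ^ ((m + 2) * (m + 2)) * ?S2) * (qd ^ (m * m) * ?S0) = ?K * (4 * qb\<^sup>2 * ?P2 * ?P0)"
  proof -
    have a': "qa ^ (m + 2)\<^sup>2 * qa ^ m\<^sup>2 = qa ^ (2 * (m + 1)\<^sup>2 + 2)" unfolding power_add[symmetric] sq ..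
    have b: "qb ^ ((m + 2)\<^sup>2) * qb ^ (m\<^sup>2) = qb ^ (2 * (m + 1)\<^sup>2) * qb\<^sup>2" unfolding power_add[symmetric] sq ..
    have "4 * (qd ^ ((m + 2) * (m + 2)) * ?S2) * (qd ^ (m * m) * ?S0) =
        (qa ^ (m + 2)\<^sup>2 * qa ^ m\<^sup>2) * (qb ^ ((m + 2)\<^sup>2) * qb ^ (m\<^sup>2)) * (qc ^ dd (m + 3) * qc ^ dd (m + 1)) *
        (qd ^ dd (m + 2) * qd ^ dd m) * (4 * ?P2 * ?P0)"
      unfolding d2[symmetric] d0[symmetric] by (simp only: mult_ac)
    then show ?thesis unfolding b a' by (simp only: power_add[of qc] power_add[of qd] mult_ac)
  qed
  have e: "qa ^ 4 * (qa ^ ((m + 1)\<^sup>2 - 1) * qa ^ ((m + 1)\<^sup>2 + (m + 1))) = qa ^ (2 * (m + 1)\<^sup>2 + 2) * qa ^ (m + 2)"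
    unfolding power_add[symmetric] by (rule arg_cong[of _ _ "\<lambda>k. qa ^ k"]) (simp add: power2_eq_square)
  have r1: "qa ^ 4 * (qd ^ ((m + 1) * m) * ?Sp) * (qd ^ ((m + 1) * (m + 2)) * ?Sm) = ?K * (qa ^ (m + 2) * ?Y * ?T)"
  proof -
    have "qa ^ 4 * (qd ^ ((m + 1) * m) * ?Sp) * (qd ^ ((m + 1) * (m + 2)) * ?Sm) =
        (qa ^ 4 * (qa ^ ((m + 1)\<^sup>2 - 1) * qa ^ ((m + 1)\<^sup>2 + (m + 1)))) * (qb ^ (m + 1)\<^sup>2 * qb ^ (m + 1)\<^sup>2) *
        (qc ^ dd (m + 3) * qc ^ dd (m + 1)) * (qd ^ dd (m + 2) * qd ^ dd m) * (?Y * ?T)"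
      unfolding dp[symmetric] dm[symmetric] by (simp only: mult_ac)
    also have "qb ^ (m + 1)\<^sup>2 * qb ^ (m + 1)\<^sup>2 = qb ^ (2 * (m + 1)\<^sup>2)" by (simp only: power_add[symmetric] mult_2)
    finally show ?thesis unfolding e by (simp only: power_add mult_ac)
  qed
  have dds: "dd (Suc m) = dd m + m div 2" "dd (Suc (Suc m)) = dd m + m div 2 + Suc m div 2"
    "dd (m + 3) = dd m + m div 2 + Suc m div 2 + Suc (Suc m) div 2"
    by (simp_all add: dd_Suc numeral_3_eq_3)
  have "4 * qd\<^sup>2 * qc\<^sup>2 * qa\<^sup>2 * (qd ^ ((m + 1) * (m + 1)) * ?S1)\<^sup>2 =
      4 * qd\<^sup>2 * qc\<^sup>2 * qa\<^sup>2 * (?P1 * (qa ^ (m + 1)\<^sup>2 * qb ^ (m + 1)\<^sup>2 * qc ^ dd (m + 2) * qd ^ dd (m + 1)))\<^sup>2"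
    unfolding d1 ..
  also have "\<dots> = 4 * (qa ^ (2 * (m + 1)\<^sup>2) * qa\<^sup>2) * qb ^ (2 * (m + 1)\<^sup>2) * (qc\<^sup>2 * qc ^ (2 * dd (m + 2))) *
      (qd\<^sup>2 * qd ^ (2 * dd (m + 1))) * ?P1\<^sup>2"
    by (simp add: power_mult_distrib power_mult[symmetric] mult_ac)
  also have "qc\<^sup>2 * qc ^ (2 * dd (m + 2)) = qc ^ (dd (m + 3) + dd (m + 1)) * qc ^ (1 + of_bool (even (m + 1)))"
    unfolding power_add[symmetric]
    by (rule arg_cong[of _ _ "\<lambda>k. qc ^ k"]) (cases "even m"; auto simp: dds elim!: evenE oddE)
  also have "qd\<^sup>2 * qd ^ (2 * dd (m + 1)) = qd ^ (dd (m + 2) + dd m) * qd ^ (1 + of_bool (odd (m + 1)))"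
    unfolding power_add[symmetric]
    by (rule arg_cong[of _ _ "\<lambda>k. qd ^ k"]) (cases "even m"; auto simp: dds elim!: evenE oddE)
  finally have r2: "4 * qd\<^sup>2 * qc\<^sup>2 * qa\<^sup>2 * (qd ^ ((m + 1) * (m + 1)) * ?S1)\<^sup>2 =
      ?K * (4 * qc ^ (1 + of_bool (even (m + 1))) * qd ^ (1 + of_bool (odd (m + 1))) * ?P1\<^sup>2)"
    unfolding power_add[of qa] by (simp only: mult_ac)
  have K: "?K \<noteq> 0" using nz by simp
  have "?K * (4 * qb\<^sup>2 * ?P2 * ?P0) = ?K * (qa ^ (m + 2) * ?Y * ?T -
      4 * qc ^ (1 + of_bool (even (m + 1))) * qd ^ (1 + of_bool (odd (m + 1))) * ?P1\<^sup>2)"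
    using J unfolding l r1 r2 by (simp only: right_diff_distrib)
  then show ?thesis using K by (simp only: mult_cancel_left) simp
qed

section \<open>The substitution \<open>\<zeta> \<mapsto> 1/\<zeta>\<close>\<close>

definition cst :: "rat \<Rightarrow> rat poly fract" where "cst c = to_fract [:c:]"

lemma cst_hom: "inj_idom_hom cst"
proof unfold_locales
  show "cst (x * y) = cst x * cst y" for x y
    unfolding cst_def to_fract_mult[symmetric] by simp
  show "cst (x + y) = cst x + cst y" for x y
    unfolding cst_def to_fract_add[symmetric] by simp
qed (simp_all add: cst_def pCons_one)

text \<open>The values lie in the fraction field, so this is a homomorphism to be lifted; the lift
  \<open>iota\<close> sends zeta to its inverse.\<close>

definition iota_poly :: "rat poly \<Rightarrow> rat poly fract" where
  "iota_poly f = poly (map_poly cst f) (1 / zeta)"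

lemma poly_cst_zeta: "poly (map_poly cst f) zeta = to_fract f"
proof -
  interpret cst: inj_idom_hom cst by (rule cst_hom)
  show ?thesis
  proof (induction f)
    case (pCons a f)
    have "pCons a f = [:a:] + [:0, 1:] * f" by simp
    then have "to_fract (pCons a f) = cst a + zeta * to_fract f"
      by (simp only: to_fract_add to_fract_mult cst_def zeta_def)
    then show ?case using pCons by (simp add: cst.map_poly_pCons_hom)
  qed simp
qed

lemma zeta_nonzero: "zeta \<noteq> 0"
  by (simp add: zeta_def)

lemma iota_poly_reflect: "zeta ^ degree f * iota_poly f = to_fract (reflect_poly f)"
proof -
  interpret cst: inj_idom_hom cst by (rule cst_hom)
  have "reflect_poly (map_poly cst f) = map_poly cst (reflect_poly f)"
    by (rule poly_eqI) (simp add: coeff_reflect_poly)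
  then show ?thesis
    using poly_reflect_poly_nz[OF zeta_nonzero, of "map_poly cst f"]
    by (simp add: poly_cst_zeta iota_poly_def inverse_eq_divide)
qed

lemma iota_poly_hom: "inj_idom_hom iota_poly"
proof -
  interpret cst: inj_idom_hom cst by (rule cst_hom)
  interpret m: map_poly_inj_idom_hom cst ..
  show ?thesis
  proof unfold_locales
    show "f = 0" if "iota_poly f = 0" for f
      using iota_poly_reflect[of f] that by simp
  qed (simp_all add: iota_poly_def m.hom_add m.hom_mult)
qed

definition iota :: "rat poly fract \<Rightarrow> rat poly fract" where
  "iota = fract_lift iota_poly"

lemma iota_hom: "field_hom iota"
  unfolding iota_def by (rule fract_lift_field_hom[OF iota_poly_hom])

lemma iota_to_fract: "iota (to_fract f) = iota_poly f"
  unfolding iota_def by (rule fract_lift_to_fract[OF iota_poly_hom])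

lemma iota_q:
  "iota qa = inverse qa" "iota qb = qb * inverse qa" "iota qc = 2 * qd * inverse qa"
  "iota qd = qc * inverse qa * inverse 2"
proof -
  interpret field_hom iota by (rule iota_hom)
  interpret cst: inj_idom_hom cst by (rule cst_hom)
  have i2: "iota 2 = 2" using hom_add[of 1 1] by simp
  have za: "zeta = qa" by (simp add: to_fract_q)
  show a: "iota qa = inverse qa"
    unfolding iota_to_fract iota_poly_def za
    by (simp add: q0_def cst.map_poly_pCons_hom inverse_eq_divide)
  have nz: "qa \<noteq> 0" by simp
  show "iota qb = qb * inverse qa" unfolding qb_qa hom_add hom_one a using nz by (simp add: field_simps)
  show "iota qc = 2 * qd * inverse qa"
    unfolding two_qd unfolding qc_qa hom_add hom_mult hom_one i2 a using nz by (simp add: field_simps)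
  have "2 * iota qd = iota (2 * qd)" unfolding hom_mult i2 ..
  also have "\<dots> = inverse qa + 2" unfolding two_qd hom_add i2 a ..
  also have "\<dots> = qc * inverse qa" unfolding qc_qa using nz by (simp add: field_simps)
  finally show "iota qd = qc * inverse qa * inverse 2" using two_nonzero by (simp add: field_simps)
qed

lemma iota_SS:
  assumes "k \<le> 2 * n + 1"
  shows "\<exists>e\<in>{1, -1}. iota (SS n k) = e * inverse qa ^ (2 * n\<^sup>2) *
    ((2 * qd * inverse qa) ^ k * inverse qc ^ (2 * n + 1 - k)) ^ n * SS n (2 * n + 1 - k)"
proof -
  interpret field_hom iota by (rule iota_hom)
  have hom: "comm_ring_hom iota" ..
  have za: "zeta = qa" by (simp add: to_fract_q)
  have i2: "iota 2 = 2" using hom_add[of 1 1] by simp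
  have x1: "inverse xi1 = 2 * qd * inverse qa" unfolding xi_q by (simp add: field_simps)
  have e0: "iota xi0 = inverse xi1" unfolding x1 xi_q(1) iota_q ..
  have e1: "iota xi1 = inverse xi0"
    unfolding xi_q divide_inverse hom_mult hom_inverse i2 iota_q using two_nonzero by (simp add: field_simps)
  have nz: "zeta \<noteq> 0" "xi1 \<noteq> 0" "xi0 \<noteq> 0" unfolding za xi_q using two_nonzero by auto
  have "iota (SS n k) = St n (inverse zeta) (inverse xi1) (inverse xi0) k"
    unfolding SS_def St_hom[OF hom] e0 e1 by (simp add: za iota_q)
  with Sg_reflect_two_values[OF nz assms] show ?thesis
    unfolding SS_def[symmetric] unfolding x1 unfolding xi_q(1) za by simp
qed

text \<open>This balance explains the exponent n(n+1)/2 in \<open>p_tilde\<close>: with it the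
  powers of zeta in \<open>iota_Qf\<close> combine to the normalisation at 0 of the reflected
  value.\<close>

lemma dd_sum: "dd (n + 1) + dd n + n * (n + 1) div 2 = n\<^sup>2"
proof -
  have "2 * (dd (n + 1) + dd n) = n * (n - 1)"
  proof (induction n)
    case (Suc n)
    have "2 * (dd (Suc n + 1) + dd (Suc n)) = 2 * (dd (n + 1) + dd n) + 2 * (Suc n div 2 + n div 2)"
      by (simp add: dd_Suc)
    also have "Suc n div 2 + n div 2 = n" by (cases "even n") (auto elim!: evenE oddE)
    finally show ?case using Suc by (cases n) auto
  qed (simp add: dd_def)
  moreover have "2 * (n * (n + 1) div 2) = n * (n + 1)" by simp
  moreover have "n * (n - 1) + n * (n + 1) = 2 * n\<^sup>2" by (cases n) (auto simp: power2_eq_square)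
  ultimately have "2 * (dd (n + 1) + dd n) + 2 * (n * (n + 1) div 2) = 2 * n\<^sup>2" by presburger
  then show ?thesis unfolding distrib_left[symmetric] by (simp only: mult_cancel_left) simp
qed

lemma inverse_power_cancel:
  "x \<noteq> 0 \<Longrightarrow> inverse x ^ k * x ^ (k + l) = (x :: 'a::field) ^ l"
  by (simp add: power_add power_inverse)

text \<open>Inversion swaps the factors 1 + 2 zeta and 1 + zeta/2 and turns n + 1 copies of
  \<open>xi0\<close> into n. The power of 2 arises because these factors are swapped only up to 2
  and powers of zeta.\<close>

lemma iota_Qf:
  "\<exists>e\<in>{1, -1}. zeta ^ (n * (n + 1) div 2) * iota (Qf n (n + 1) (n\<^sup>2)) =
     e * 2 ^ (n - n div 2) * Qf n n (n\<^sup>2 + n)"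
proof -
  interpret field_hom iota by (rule iota_hom)
  let ?D1 = "dd (n + 1)" and ?D0 = "dd n" and ?M = "n * (n + 1) div 2"
  have za: "zeta = qa" by (simp add: to_fract_q)
  have k: "2 * n + 1 - (n + 1) = n" "2 * n + 1 - n = n + 1" by auto
  obtain e where e: "e \<in> {1, -1}" and eS: "iota (SS n (n + 1)) = e * inverse qa ^ (2 * n\<^sup>2) *
      ((2 * qd * inverse qa) ^ (n + 1) * inverse qc ^ n) ^ n * SS n n"
  proof -
    have "n + 1 \<le> 2 * n + 1" by simp
    from iota_SS[OF this] show ?thesis unfolding k using that by blast
  qed
  have nz: "qa \<noteq> 0" "qb \<noteq> 0" "qc \<noteq> 0" "qd \<noteq> 0" by simp_all
  have ii: "iota (inverse x) = inverse (iota x)" for x by (rule hom_inverse)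
  have inv: "inverse (iota qa) = qa" "inverse (iota qb) = qa * inverse qb"
    "inverse (iota qc) = inverse 2 * inverse qd * qa" "inverse (iota qd) = 2 * inverse qc * qa"
    unfolding iota_q using nz two_nonzero by (simp_all add: field_simps)
  have h2: "inverse 2 ^ (n * n) * 2 ^ ((n + 1) * n) * inverse 2 ^ ?D1 * 2 ^ ?D0 = (2 :: rat poly fract) ^ (n - n div 2)"
  proof -
    have "inverse 2 ^ (n * n) * 2 ^ ((n + 1) * n) * inverse 2 ^ ?D1 * 2 ^ ?D0 =
        inverse (2 :: rat poly fract) ^ (n * n + ?D1) * 2 ^ ((n + 1) * n + ?D0)"
      by (simp only: power_add mult_ac)
    also have "(n + 1) * n + ?D0 = (n * n + ?D1) + (n - n div 2)" by (simp add: dd_Suc)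
    finally show ?thesis unfolding inverse_power_cancel[OF two_nonzero] .
  qed
  have ha: "qa ^ ?M * (inverse qa ^ (n * n) * inverse qa ^ (2 * n\<^sup>2) * inverse qa ^ ((n + 1) * n) *
      qa ^ n\<^sup>2 * qa ^ n\<^sup>2 * qa ^ ?D1 * qa ^ ?D0) = inverse qa ^ (n\<^sup>2 + n)"
  proof -
    have "qa ^ ?M * (inverse qa ^ (n * n) * inverse qa ^ (2 * n\<^sup>2) * inverse qa ^ ((n + 1) * n) *
        qa ^ n\<^sup>2 * qa ^ n\<^sup>2 * qa ^ ?D1 * qa ^ ?D0) =
        inverse qa ^ ((n + 1) * n) * (inverse qa ^ (n * n + 2 * n\<^sup>2) * qa ^ (n\<^sup>2 + n\<^sup>2 + (?D1 + ?D0 + ?M)))"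
      by (simp only: power_add mult_ac)
    also have "n\<^sup>2 + n\<^sup>2 + (?D1 + ?D0 + ?M) = (n * n + 2 * n\<^sup>2) + 0"
      unfolding dd_sum by (simp add: power2_eq_square)
    finally show ?thesis unfolding inverse_power_cancel[OF nz(1)]
      by (simp add: power2_eq_square add.commute)
  qed
  have hc: "qc ^ (n * n) * inverse qc ^ (n * n) = 1"
    using nz by (simp add: power_mult_distrib[symmetric])
  have "zeta ^ ?M * iota (Qf n (n + 1) (n\<^sup>2)) =
      qa ^ ?M * ((qc * inverse qa * inverse 2) ^ (n * n) *
       (e * inverse qa ^ (2 * n\<^sup>2) * ((2 * qd * inverse qa) ^ (n + 1) * inverse qc ^ n) ^ n * SS n n) *
       (qa ^ n\<^sup>2 * (qa * inverse qb) ^ n\<^sup>2 * (inverse 2 * inverse qd * qa) ^ ?D1 * (2 * inverse qc * qa) ^ ?D0))"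
    unfolding Qf_def k hom_mult hom_power ii inv eS unfolding za iota_q ..
  also have "\<dots> = e * (inverse 2 ^ (n * n) * 2 ^ ((n + 1) * n) * inverse 2 ^ ?D1 * 2 ^ ?D0) *
      (qc ^ (n * n) * inverse qc ^ (n * n)) *
      (qa ^ ?M * (inverse qa ^ (n * n) * inverse qa ^ (2 * n\<^sup>2) * inverse qa ^ ((n + 1) * n) *
      qa ^ n\<^sup>2 * qa ^ n\<^sup>2 * qa ^ ?D1 * qa ^ ?D0)) *
      (qd ^ ((n + 1) * n) * SS n n * (inverse qb ^ n\<^sup>2 * inverse qc ^ ?D0 * inverse qd ^ ?D1))"
    by (simp only: power_mult_distrib power_mult[symmetric] mult_ac)
  also have "\<dots> = e * 2 ^ (n - n div 2) * Qf n n (n\<^sup>2 + n)"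
    unfolding h2 hc ha Qf_def k by (simp only: mult_1_right mult_ac)
  finally show ?thesis using e by blast
qed

section \<open>Comparison with \<open>p\<close> and \<open>p_tilde\<close>\<close>

lemma \<delta>_dd: "\<delta> (int n) = dd (n + 1)" "\<delta> (int n - 1) = dd n"
proof -
  have dd: "dd (k + 1) = k * k div 4" for k
  proof (induction k)
    case (Suc k)
    have "Suc k * Suc k div 4 = k * k div 4 + Suc k div 2"
    proof (cases "even k")
      case True
      then obtain r where "k = 2 * r" by (auto elim: evenE)
      then show ?thesis by (simp add: algebra_simps)
    next
      case False
      then obtain r where "k = 2 * r + 1" by (auto elim: oddE)
      then show ?thesis by (simp add: algebra_simps)
    qed
    then show ?case using Suc by (simp add: dd_Suc)
  qed (simp add: dd_def)
  have \<delta>: "\<delta> (int k) = k * k div 4" for k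
    unfolding \<delta>_def power2_eq_square by (metis nat_int of_nat_mult of_nat_numeral zdiv_int)
  show "\<delta> (int n) = dd (n + 1)" unfolding \<delta> dd ..
  show "\<delta> (int n - 1) = dd n"
  proof (cases n)
    \<comment> \<open>Here \<open>\<delta>\<close> is taken at -1, where the division by 4 rounds 1
      down to 0, the value of the empty sum \<open>dd 0\<close>.\<close>
    case 0
    then show ?thesis by (simp add: \<delta>_def dd_def)
  next
    case (Suc k)
    then show ?thesis using \<delta>[of k] dd[of k] by simp
  qed
qed

definition sg :: "nat \<Rightarrow> rat" where "sg n = (-1) ^ ((n + 1) choose 2)"

text \<open>The third relation turns the recurrence for unsigned values into one where
  \<open>A * X\<close> and \<open>C\<close> have the sign required by the theorem.\<close>

lemma sg_facts: "sg n \<in> {1, -1}" "sg n * sg n = 1" "sg (m + 2) * sg m = -1"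
proof -
  show "sg n \<in> {1, -1}" by (simp add: sg_def minus_one_power_iff)
  then show "sg n * sg n = 1" by auto
  have "(m + 3) choose 2 = ((m + 1) choose 2) + (2 * m + 3)"
    by (simp add: numeral_3_eq_3 numeral_2_eq_2)
  then have "sg (m + 2) = sg m * (-1) ^ (2 * m + 3)" by (simp add: sg_def power_add numeral_3_eq_3)
  then show "sg (m + 2) * sg m = -1" using \<open>sg n * sg n = 1\<close>
    by (simp add: power_add sg_def power_mult_distrib[symmetric] mult_ac)
qed

lemma p_fract_eq: "p_fract n = cst (sg n) * Qf n (n + 1) (n\<^sup>2)"
proof -
  interpret cst: inj_idom_hom cst by (rule cst_hom)
  have k: "2 * n + 1 - (n + 1) = n" by simp
  have s: "(-1) ^ ((n + 1) choose 2) = cst (sg n)"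
    by (simp add: sg_def cst.hom_power cst.hom_uminus)
  have "cst (sg n) * cst (sg n) = 1" using sg_facts(2)[of n] by (simp add: cst.hom_mult[symmetric])
  then have i: "inverse (cst (sg n)) = cst (sg n)" by (rule inverse_unique)
  have m: "meval (\<lambda>k. if k < n + 1 then 2 * zeta + 1 else zeta / (zeta + 2)) (S n) = SS n (n + 1)"
    unfolding xi0_def[symmetric] xi1_def[symmetric] by (rule SS_meval[symmetric]) simp
  show ?thesis
    unfolding p_fract_def Let_def zeta_def[symmetric] m s \<delta>_dd Qf_def k to_fract_q
    by (simp only: divide_inverse inverse_mult_distrib i power_inverse power2_eq_square[of n] mult_ac)
qed

lemma admissible_intros: "admissible n (n + 1) (n\<^sup>2)" "admissible n n (n\<^sup>2 + n)"
  "n \<ge> 1 \<Longrightarrow> admissible n (n + 2) (n\<^sup>2 - 1)"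
  by (auto simp: admissible_def)

abbreviation "Pp n \<equiv> Qp n (n + 1) (n\<^sup>2)"
abbreviation "Tp n \<equiv> Qp n n (n\<^sup>2 + n)"
abbreviation "Yp n \<equiv> Qp n (n + 2) (n\<^sup>2 - 1)"

lemma p_eq: "p n = smult (sg n) (Pp n)"
proof -
  have "p_fract n = to_fract ([:sg n:] * Pp n)"
    unfolding p_fract_eq cst_def to_fract_mult to_fract_Qp[OF admissible_intros(1)] ..
  then show ?thesis unfolding p_def by simp
qed

lemma p_tilde_eq:
  "\<exists>\<kappa>. \<bar>\<kappa>\<bar> = 2 ^ (n - n div 2) \<and> p_tilde n = smult \<kappa> (Tp n) \<and>
     zeta ^ (n * (n + 1) div 2) * iota_poly (p n) = to_fract (smult \<kappa> (Tp n))"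
proof -
  interpret field_hom iota by (rule iota_hom)
  interpret cst: inj_idom_hom cst by (rule cst_hom)
  obtain e where e: "e \<in> {1, -1}" "zeta ^ (n * (n + 1) div 2) * iota (Qf n (n + 1) (n\<^sup>2)) =
     e * 2 ^ (n - n div 2) * Qf n n (n\<^sup>2 + n)" using iota_Qf[of n] by blast
  obtain e' where e': "e' \<in> {1, -1 :: rat}" "e = cst e'"
    using e(1) cst.hom_one cst.hom_uminus[of 1] by (metis insert_iff singletonD)
  define \<kappa> where "\<kappa> = sg n * e' * 2 ^ (n - n div 2)"
  have c2: "cst 2 = 2" using cst.hom_add[of 1 1] by simp
  have cst_iota: "iota (cst c) = cst c" for c
  proof -
    have "iota_poly [:c:] = cst c" unfolding iota_poly_def by (simp add: cst.map_poly_pCons_hom)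
    then show ?thesis by (metis cst_def iota_to_fract)
  qed
  have "iota_poly (p n) = cst (sg n) * iota (Qf n (n + 1) (n\<^sup>2))"
  proof -
    have "to_fract (p n) = cst (sg n) * Qf n (n + 1) (n\<^sup>2)"
      unfolding p_eq to_fract_Qp[OF admissible_intros(1), symmetric] cst_def to_fract_mult[symmetric] by simp
    then have "iota (to_fract (p n)) = cst (sg n) * iota (Qf n (n + 1) (n\<^sup>2))"
      by (simp only: hom_mult cst_iota)
    then show ?thesis by (simp only: iota_to_fract)
  qed
  then have "zeta ^ (n * (n + 1) div 2) * iota_poly (p n) = cst (sg n) * (e * 2 ^ (n - n div 2) * Qf n n (n\<^sup>2 + n))"
    unfolding e(2)[symmetric] by (simp only: mult_ac)
  also have "\<dots> = cst \<kappa> * to_fract (Tp n)"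
    unfolding \<kappa>_def cst.hom_mult cst.hom_power c2 e'(2) to_fract_Qp[OF admissible_intros(2)] by (simp only: mult_ac)
  also have "\<dots> = to_fract (smult \<kappa> (Tp n))" unfolding cst_def to_fract_mult[symmetric] by simp
  finally have *: "zeta ^ (n * (n + 1) div 2) * iota_poly (p n) = to_fract (smult \<kappa> (Tp n))" .
  moreover have "p_tilde n = smult \<kappa> (Tp n)"
    using * unfolding p_tilde_def Let_def iota_poly_def zeta_def cst_def[abs_def] by simp
  moreover have "\<bar>\<kappa>\<bar> = 2 ^ (n - n div 2)"
    using sg_facts(1)[of n] e'(1) by (auto simp: \<kappa>_def abs_mult)
  ultimately show ?thesis by blast
qed

text \<open>\<open>q1\<close>, \<open>q2\<close>, \<open>q3\<close> have value 1 at 0, so the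
  constant term is that of the cofactor in \<open>order_p_tilde\<close>.\<close>

lemma coeff_Tp_0: "\<bar>coeff (Tp n) 0\<bar> = 2 ^ (n + 1) * \<bar>(-1/2) gchoose (n + 1)\<bar>"
proof -
  interpret field_hom "lau z0" by (rule lau_field_hom[OF z_nonconst(1)])
  interpret ev: comm_ring_hom "fps_eval z0" by (rule fps_eval_hom)
  define g where "g = (-1) ^ (\<Sum>l\<le>n. l) * inverse ((at_zero.d - at_zero.c) ^ (n * (n + 1))) *
     det (mat (2 * n + 1) (2 * n + 1) (\<lambda>(i, j). at_zero.H' n n i j))"
  have k: "2 * n + 1 - n = n + 1" by simp
  have ev0: "poly q1 0 = 1" "poly q2 0 = 1" "poly q3 0 = 1" by (simp_all add: q1_def q2_def q3_def)
  have X: "fps_eval z0 q0 = fps_X" by (simp add: q0_def fps_eval_pCons z0_def) (simp add: fps_eval_def)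
  have "to_fract (Tp n * (q0 ^ (n\<^sup>2 + n) * q1 ^ n\<^sup>2 * q2 ^ dd n * q3 ^ dd (n + 1))) =
      to_fract (q3 ^ (n * (n + 1))) * SS n n"
    using Qf_denominators[of n n "n\<^sup>2 + n"] unfolding k to_fract_mult to_fract_power to_fract_Qp[OF admissible_intros(2)] .
  from arg_cong[OF this, of "lau z0"]
  have "fps_to_fls (fps_eval z0 (Tp n * (q0 ^ (n\<^sup>2 + n) * q1 ^ n\<^sup>2 * q2 ^ dd n * q3 ^ dd (n + 1)))) =
      fps_to_fls (fps_eval z0 (q3 ^ (n * (n + 1))) * (fps_X ^ (n\<^sup>2 + n) * g))"
    unfolding lau_to_fract[OF z_nonconst(1)] hom_mult lau_SS_z0 at_zero.order_p_tilde g_def[symmetric]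
    by (simp only: fls_times_fps_to_fls)
  then have "fps_eval z0 (Tp n * (q0 ^ (n\<^sup>2 + n) * q1 ^ n\<^sup>2 * q2 ^ dd n * q3 ^ dd (n + 1))) =
      fps_eval z0 (q3 ^ (n * (n + 1))) * (fps_X ^ (n\<^sup>2 + n) * g)"
    by (simp only: fps_to_fls_eq_iff)
  then have "fps_X ^ (n\<^sup>2 + n) * fps_eval z0 (Tp n * (q1 ^ n\<^sup>2 * q2 ^ dd n * q3 ^ dd (n + 1))) =
      fps_X ^ (n\<^sup>2 + n) * (fps_eval z0 (q3 ^ (n * (n + 1))) * g)"
    unfolding ev.hom_mult ev.hom_power X by (simp only: mult_ac)
  then have "fps_eval z0 (Tp n * (q1 ^ n\<^sup>2 * q2 ^ dd n * q3 ^ dd (n + 1))) = fps_eval z0 (q3 ^ (n * (n + 1))) * g"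
    by simp
  then have "fps_nth (fps_eval z0 (Tp n * (q1 ^ n\<^sup>2 * q2 ^ dd n * q3 ^ dd (n + 1)))) 0 =
      fps_nth (fps_eval z0 (q3 ^ (n * (n + 1))) * g) 0" by simp
  then have "coeff (Tp n) 0 = fps_nth g 0"
    unfolding fps_eval_nth_0 fps_mult_nth_0 z_nth_0 poly_mult poly_power
    unfolding ev0 by (simp add: poly_0_coeff_0)
  then show ?thesis unfolding g_def using at_zero.lead_p_tilde[of n] by simp
qed

section \<open>Degrees and the main identity\<close>

text \<open>The polynomial \<open>reflect_poly f\<close> is the case N = \<open>degree f\<close> and
  has nonzero constant term; another N would change the order of vanishing at 0.\<close>

lemma reflect_degree:
  assumes "zeta ^ N * iota_poly f = to_fract w" "coeff w 0 \<noteq> 0"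
  shows "degree f = N" "reflect_poly f = w"
proof -
  have "to_fract (q0 ^ N * reflect_poly f) = to_fract (q0 ^ degree f * w)"
    unfolding to_fract_mult to_fract_power to_fract_q iota_poly_reflect[symmetric] assms(1)[symmetric]
    by (simp only: mult_ac)
  then have eq: "q0 ^ N * reflect_poly f = q0 ^ degree f * w" by (simp only: to_fract_eq_iff)
  have f: "f \<noteq> 0"
  proof
    assume "f = 0"
    with eq have "w = 0" by simp
    with assms(2) show False by simp
  qed
  have cancel: "x = y" if "q0 ^ k * x = q0 ^ k * y" for k x y using that by simp
  have zero: "poly q0 0 = 0" by (simp add: q0_def)
  show *: "degree f = N"
  proof (rule linorder_cases)
    assume "N < degree f"
    then obtain k where k: "degree f = N + Suc k" using less_imp_Suc_add by fastforce
    from eq have "q0 ^ N * reflect_poly f = q0 ^ N * (q0 ^ Suc k * w)"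
      unfolding k power_add by (simp only: mult_ac)
    then have "reflect_poly f = q0 ^ Suc k * w" by (rule cancel)
    then have "poly (reflect_poly f) 0 = 0" by (simp add: zero)
    with f show ?thesis by simp
  next
    assume "degree f < N"
    then obtain k where k: "N = degree f + Suc k" using less_imp_Suc_add by fastforce
    from eq have "q0 ^ degree f * (q0 ^ Suc k * reflect_poly f) = q0 ^ degree f * w"
      unfolding k power_add by (simp only: mult_ac)
    then have "q0 ^ Suc k * reflect_poly f = w" by (rule cancel)
    then have "poly w 0 = 0" by (auto simp: zero)
    with assms(2) show ?thesis by (simp add: poly_0_coeff_0)
  qed simp
  from eq show "reflect_poly f = w" unfolding * by (rule cancel)
qed

lemma Pp_recurrence:
  "4 * q1\<^sup>2 * Pp (m + 2) * Pp m = q0 ^ (m + 2) * Yp (m + 1) * Tp (m + 1) -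
     4 * q2 ^ (1 + of_bool (even (m + 1))) * q3 ^ (1 + of_bool (odd (m + 1))) * (Pp (m + 1))\<^sup>2"
proof -
  have k: "m + 2 + 1 = m + 3" "m + 1 + 2 = m + 3" "m + 1 + 1 = m + 2" by simp_all
  have four: "(4 :: rat poly fract) = to_fract 4"
  proof -
    have "to_fract (2 * 2 :: rat poly) = 2 * 2" unfolding to_fract_mult to_fract_2 ..
    then show ?thesis by simp
  qed
  have Q: "Qf (m + 2) (m + 3) ((m + 2)\<^sup>2) = to_fract (Pp (m + 2))" "Qf m (m + 1) (m\<^sup>2) = to_fract (Pp m)"
    "Qf (m + 1) (m + 3) ((m + 1)\<^sup>2 - 1) = to_fract (Yp (m + 1))"
    "Qf (m + 1) (m + 1) ((m + 1)\<^sup>2 + (m + 1)) = to_fract (Tp (m + 1))"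
    "Qf (m + 1) (m + 2) ((m + 1)\<^sup>2) = to_fract (Pp (m + 1))"
    using to_fract_Qp[OF admissible_intros(1)[of "m + 2"]] to_fract_Qp[OF admissible_intros(1)[of m]] to_fract_Qp[OF admissible_intros(3)[of "m + 1"]]
      to_fract_Qp[OF admissible_intros(2)[of "m + 1"]] to_fract_Qp[OF admissible_intros(1)[of "m + 1"]] unfolding k by simp_all
  have "to_fract (4 * q1\<^sup>2 * Pp (m + 2) * Pp m) = to_fract (q0 ^ (m + 2) * Yp (m + 1) * Tp (m + 1) -
     4 * q2 ^ (1 + of_bool (even (m + 1))) * q3 ^ (1 + of_bool (odd (m + 1))) * (Pp (m + 1))\<^sup>2)"
    using Qf_desnanot[of m] unfolding Q four to_fract_mult to_fract_diff to_fract_power .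
  then show ?thesis by (simp only: to_fract_eq_iff)
qed

section \<open>Initial values and nonvanishing at 0\<close>

lemma SS_0_1: "SS 0 1 = 1"
proof -
  have "S_fract 0 = to_fract 1" by (simp add: S_fract_def)
  then have "S 0 = 1" unfolding S_def by (simp only: of_fract_to_fract)
  interpret comm_ring_hom "meval v" for v by (rule meval_comm_ring_hom)
  show ?thesis using SS_meval[of 1 0] \<open>S 0 = 1\<close> by simp
qed

lemma SS_1_2: "SS 1 2 = F zeta xi0 xi0 xi1"
proof -
  let ?\<zeta> = "mconst [:0, 1:]"
  have "meval (\<lambda>k. if k = 0 then 0 else 1) (G ?\<zeta> (mvar 0) (mvar 1)) = 2 * zeta\<^sup>2"
    by (simp add: hom_F_G[OF meval_comm_ring_hom])
       (simp add: G_def zeta_def power2_eq_square algebra_simps)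
  also have "\<dots> \<noteq> 0" using two_nonzero zeta_nonzero by simp
  finally have G: "G ?\<zeta> (mvar 0) (mvar 1) \<noteq> 0" by (auto simp: meval_def)
  have tf: "comm_ring_hom (to_fract :: mpoly \<Rightarrow> mpoly fract)"
  proof -
    interpret inj_idom_hom "to_fract :: mpoly \<Rightarrow> mpoly fract" by (rule to_fract_comm_ring_hom)
    show ?thesis ..
  qed
  have "S_fract 1 = to_fract (F ?\<zeta> (mvar 0) (mvar 1) (mvar 2))"
    unfolding S_fract_def Let_def hom_F_G[OF tf, symmetric] using G
    by (simp add: det_single hom_F_G[OF tf, symmetric])
  then have "S 1 = F ?\<zeta> (mvar 0) (mvar 1) (mvar 2)" unfolding S_def by (simp only: of_fract_to_fract)
  then show ?thesis using SS_meval[of 2 1] by (simp add: hom_F_G[OF meval_comm_ring_hom] zeta_def)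
qed

lemma Pp_0: "Pp 0 = 1"
proof -
  have "to_fract (Pp 0) = to_fract 1"
    unfolding to_fract_Qp[OF admissible_intros(1)] using SS_0_1 by (simp add: Qf_def dd_def)
  then show ?thesis by (simp only: to_fract_eq_iff)
qed

lemma Pp_1: "Pp 1 = - [:1, 3:]"
proof -
  have q: "[:1, 3:] = 1 + (2 + 1) * q0" by (simp add: q0_def one_pCons numeral_poly)
  have nz: "qa \<noteq> 0" "qb \<noteq> 0" "qc \<noteq> 0" "qd \<noteq> 0" by simp_all
  have "2 * (qd * SS 1 2) = (zeta + 2) * F zeta xi0 xi0 xi1" unfolding SS_1_2 zeta_plus_2(1) by (simp only: mult_ac)
  also have "\<dots> = - zeta * (2 * xi0 * ((zeta + 2) * xi1) + xi0 * (zeta + 2) + (zeta + 2) * xi1) +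
      zeta * (zeta + 2) * (2 * zeta + 1 - xi0) + xi0 * xi0 * (zeta + 2) * ((zeta + 2) * xi1 - zeta)"
    unfolding F_def by (simp add: algebra_simps)
  also have "(zeta + 2) * xi1 = zeta" unfolding xi1_def using zeta_plus_2(2) by simp
  also have "- zeta * (2 * xi0 * zeta + xi0 * (zeta + 2) + zeta) +
      zeta * (zeta + 2) * (2 * zeta + 1 - xi0) + xi0 * xi0 * (zeta + 2) * (zeta - zeta) =
      2 * (- (1 + (2 + 1) * zeta) * (zeta * (1 + zeta)))"
    unfolding xi0_def by (simp add: algebra_simps)
  finally have S: "qd * SS 1 2 = - (1 + (2 + 1) * qa) * (qa * qb)" unfolding to_fract_q by (rule two_cancel)
  have "to_fract (Pp 1) = qd * SS 1 2 * (inverse qa * inverse qb)"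
    unfolding to_fract_Qp[OF admissible_intros(1)] by (simp add: Qf_def dd_def numeral_2_eq_2)
  also have "\<dots> = - (1 + (2 + 1) * qa) * (qa * inverse qa) * (qb * inverse qb)" unfolding S by (simp only: mult_ac)
  also have "\<dots> = - (1 + (2 + 1) * qa)" using nz by simp
  also have "\<dots> = to_fract (- [:1, 3:])"
    unfolding q to_fract_uminus to_fract_add to_fract_mult to_fract_1 to_fract_2 ..
  finally show ?thesis by (simp only: to_fract_eq_iff)
qed

text \<open>At 0 the term with \<open>Yp\<close> disappears, so the product of the outer values is
  minus the square of the middle one. The conjunction carries the two-step recursion through the
  induction.\<close>

lemma poly_Pp_0: "poly (Pp n) 0 \<noteq> 0 \<and> poly (Pp (n + 1)) 0 \<noteq> 0"
proof (induction n)
  case 0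
  show ?case using Pp_0 Pp_1 by simp
next
  case (Suc n)
  have ev: "poly q0 0 = 0" "poly q2 0 = 1" "poly q3 0 = 1" by (simp_all add: q0_def q2_def q3_def)
  have "poly (4 * q1\<^sup>2 * Pp (n + 2) * Pp n) 0 = - 4 * (poly (Pp (n + 1)) 0)\<^sup>2"
    unfolding Pp_recurrence poly_mult poly_diff poly_power ev
    by (simp only: power_one mult_1_right mult_zero_left zero_power zero_less_Suc add_2_eq_Suc' poly_numeral diff_0 mult_minus_left)
  moreover have "- 4 * (poly (Pp (n + 1)) 0)\<^sup>2 \<noteq> 0" using Suc by simp
  ultimately have "poly (Pp (n + 2)) 0 \<noteq> 0" unfolding poly_mult by (metis mult_eq_0_iff)
  moreover have "n + 2 = Suc n + 1" "n + 1 = Suc n" by simp_all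
  ultimately show ?case using Suc by (metis (no_types))
qed

section \<open>Degrees and leading coefficients\<close>

abbreviation "lead_abs n \<equiv> 2 ^ (n - n div 2) * (2 ^ (n + 1) * \<bar>(-1/2 :: rat) gchoose (n + 1)\<bar>)"

lemma gbinomial_minus_half:
  "\<bar>(-1/2 :: rat) gchoose (k + 1)\<bar> * (2 * of_nat k + 2) = \<bar>(-1/2) gchoose k\<bar> * (2 * of_nat k + 1)"
proof -
  have "((-1/2 :: rat) gchoose (k + 1)) * (2 * of_nat k + 2) = - (((-1/2) gchoose k) * (2 * of_nat k + 1))"
    using gbinomial_mult_1[of "-1/2 :: rat" k] by (simp add: field_simps)
  then have "\<bar>((-1/2 :: rat) gchoose (k + 1)) * (2 * of_nat k + 2)\<bar> = \<bar>((-1/2) gchoose k) * (2 * of_nat k + 1)\<bar>"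
    by simp
  then show ?thesis by (simp add: abs_mult)
qed

lemma gbinomial_minus_half_nonzero: "(-1/2 :: rat) gchoose k \<noteq> 0"
proof (induction k)
  case (Suc k)
  have "(2 * of_nat k + 1 :: rat) \<noteq> 0" by (metis add.commute of_nat_Suc of_nat_mult of_nat_neq_0 of_nat_numeral)
  with Suc gbinomial_minus_half[of k] show ?case by auto
qed simp

text \<open>Degree and leading coefficient of \<open>p\<close> come from the constant term of its
  reflection; the degree of \<open>p_tilde\<close> in turn uses that \<open>p\<close> does not
  vanish at 0.\<close>

lemma p_p_tilde_degree:
  shows "degree (p n) = n * (n + 1) div 2" "\<bar>lead_coeff (p n)\<bar> = lead_abs n" "p n \<noteq> 0"
    "degree (p_tilde n) = n * (n + 1) div 2" "\<exists>\<kappa>. \<kappa> \<noteq> 0 \<and> p_tilde n = smult \<kappa> (Tp n)"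
proof -
  obtain \<kappa> where k: "\<bar>\<kappa>\<bar> = 2 ^ (n - n div 2)" "p_tilde n = smult \<kappa> (Tp n)"
    "zeta ^ (n * (n + 1) div 2) * iota_poly (p n) = to_fract (smult \<kappa> (Tp n))"
    using p_tilde_eq[of n] by blast
  have k0: "\<kappa> \<noteq> 0" using k(1) by auto
  then show "\<exists>\<kappa>. \<kappa> \<noteq> 0 \<and> p_tilde n = smult \<kappa> (Tp n)" using k(2) by blast
  have ab: "\<bar>coeff (smult \<kappa> (Tp n)) 0\<bar> = lead_abs n"
    unfolding coeff_smult abs_mult coeff_Tp_0 k(1) ..
  then have "coeff (smult \<kappa> (Tp n)) 0 \<noteq> 0" using gbinomial_minus_half_nonzero[of "n + 1"] by (metis abs_zero mult_eq_0_iff power_not_zero zero_neq_numeral abs_eq_0)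
  note r = reflect_degree[OF k(3) this]
  show "degree (p n) = n * (n + 1) div 2" by (rule r(1))
  have "lead_coeff (p n) = coeff (smult \<kappa> (Tp n)) 0" unfolding r(2)[symmetric] by simp
  then show l: "\<bar>lead_coeff (p n)\<bar> = lead_abs n" using ab by (simp only:)
  have p0: "coeff (p n) 0 \<noteq> 0"
    using poly_Pp_0[of n] sg_facts(2)[of n] unfolding p_eq poly_0_coeff_0 by auto
  then show "p n \<noteq> 0" by auto
  show "degree (p_tilde n) = n * (n + 1) div 2"
    unfolding k(2) r(2)[symmetric] using degree_reflect_poly_eq[OF p0] r(1) by simp
qed

text \<open>The powers of 2 on both sides agree. By the ratios of consecutive binomials, equality of
  the rest would force (2m+3)(2m+6) = (2m+4)(2m+5), that is 18 = 20.\<close>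

lemma lead_abs_neq:
  "lead_abs m * lead_abs (m + 2) \<noteq>
     2 ^ (1 + of_bool (even (m + 1))) * (1/2) ^ (1 + of_bool (odd (m + 1))) * (lead_abs (m + 1))\<^sup>2"
proof -
  have k: "m + 2 + 1 = m + 3" "m + 1 + 1 = m + 2" by simp_all
  define g where "g k = \<bar>(-1/2 :: rat) gchoose k\<bar>" for k
  have g0: "g (m + 2) > 0" using gbinomial_minus_half_nonzero by (simp add: g_def)
  have g1: "g (m + 2) * (2 * of_nat m + 4) = g (m + 1) * (2 * of_nat m + 3)"
    using gbinomial_minus_half[of "m + 1"] by (simp add: g_def algebra_simps)
  have g2: "g (m + 3) * (2 * of_nat m + 6) = g (m + 2) * (2 * of_nat m + 5)"
    using gbinomial_minus_half[of "m + 2"] by (simp add: g_def algebra_simps eval_nat_numeral)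
  have e: "2 ^ (m - m div 2) * 2 ^ (m + 1) * (2 ^ (m + 2 - (m + 2) div 2) * 2 ^ (m + 3)) =
      2 ^ (1 + of_bool (even (m + 1))) * (1/2) ^ (1 + of_bool (odd (m + 1))) *
      (2 ^ (m + 1 - (m + 1) div 2) * 2 ^ (m + 2))\<^sup>2 * (1 :: rat)"
    by (cases "even m") (auto elim!: evenE oddE simp: power_add power_mult power2_eq_square field_simps)
  have neq: "g (m + 1) * g (m + 3) \<noteq> (g (m + 2))\<^sup>2"
  proof
    assume *: "g (m + 1) * g (m + 3) = (g (m + 2))\<^sup>2"
    have "(g (m + 1) * (2 * of_nat m + 3)) * (g (m + 3) * (2 * of_nat m + 6)) =
        (g (m + 2) * (2 * of_nat m + 4)) * (g (m + 2) * (2 * of_nat m + 5))"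
      unfolding g1 g2 ..
    then have "(g (m + 1) * g (m + 3)) * ((2 * of_nat m + 3) * (2 * of_nat m + 6)) =
        (g (m + 2))\<^sup>2 * ((2 * of_nat m + 4) * (2 * of_nat m + 5))"
      by (simp only: power2_eq_square mult_ac)
    then have "(2 * of_nat m + 3) * (2 * of_nat m + 6) = (2 * of_nat m + 4) * (2 * of_nat m + 5 :: rat)"
      unfolding * using g0 by simp
    then show False by (simp add: algebra_simps)
  qed
  let ?E = "2 ^ (m - m div 2) * 2 ^ (m + 1) * (2 ^ (m + 2 - (m + 2) div 2) * 2 ^ (m + 3)) :: rat"
  have "lead_abs m * lead_abs (m + 2) = ?E * (g (m + 1) * g (m + 3))"
    unfolding g_def k by (simp only: mult_ac)
  moreover have "2 ^ (1 + of_bool (even (m + 1))) * (1/2) ^ (1 + of_bool (odd (m + 1))) * (lead_abs (m + 1))\<^sup>2 =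
      ?E * (g (m + 2))\<^sup>2"
    unfolding e g_def k by (simp only: mult_ac power_mult_distrib mult_1_right)
  moreover have "?E \<noteq> 0" by simp
  ultimately show ?thesis using neq by (metis (no_types) mult_left_cancel)
qed

theorem theorem3p7:
  fixes n :: nat and A B C :: "rat poly"
  assumes "n \<ge> 1"
    and "A = [:1, 1:]\<^sup>2 * p (n - 1)"
    and "B = [:0, 1:] ^ (n + 1) * p_tilde n"
    and "C = [:1, 2:] ^ (1 + of_bool (even n)) * [:1, 1/2:] ^ (1 + of_bool (odd n)) * (p n)\<^sup>2"
  shows "\<exists>X Y :: rat poly. A * X - B * Y = C \<and> X = p (n + 1) \<and> degree Y = degree A"
proof -
  obtain m where n: "n = m + 1" using assms(1) by (metis add.commute le_Suc_ex)
  have A: "A = q1\<^sup>2 * p m" and B: "B = q0 ^ (m + 2) * p_tilde (m + 1)"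
    and C: "C = q2 ^ (1 + of_bool (even (m + 1))) * q3 ^ (1 + of_bool (odd (m + 1))) * (p (m + 1))\<^sup>2"
    using assms(2-4) unfolding n q0_def q1_def q2_def q3_def by simp_all
  obtain \<kappa> where \<kappa>: "\<kappa> \<noteq> 0" "p_tilde (m + 1) = smult \<kappa> (Tp (m + 1))" using p_p_tilde_degree(5) by blast
  \<comment> \<open>The 4 is the common factor in \<open>Pp_recurrence\<close>,
    \<open>\<kappa>\<close> undoes the scaling of \<open>p_tilde\<close>, and the sign matches
    \<open>sg m * sg (m + 2) = -1\<close>.\<close>
  define Y where "Y = smult (- 1 / (4 * \<kappa>)) (Yp (m + 1))"
  have eq: "A * p (m + 2) - B * Y = C"
  proof -
    have scale: "smult 4 (q * smult s f * smult t g - x * smult \<kappa> h * smult (- 1 / (4 * \<kappa>)) y) =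
        smult (s * t) (4 * q * g * f) + x * y * h" for q f g h x y :: "rat poly" and s t
      using \<kappa>(1) by (simp add: smult_diff_right smult_add_right numeral_poly mult_ac)
    have "smult 4 (A * p (m + 2) - B * Y) = smult (sg m * sg (m + 2)) (4 * q1\<^sup>2 * Pp (m + 2) * Pp m) +
        q0 ^ (m + 2) * Yp (m + 1) * Tp (m + 1)"
      unfolding A B p_eq Y_def \<kappa>(2) by (rule scale)
    also have "sg m * sg (m + 2) = -1" using sg_facts(3)[of m] by (simp only: mult.commute)
    also have "smult (-1) (4 * q1\<^sup>2 * Pp (m + 2) * Pp m) + q0 ^ (m + 2) * Yp (m + 1) * Tp (m + 1) =
        4 * (q2 ^ (1 + of_bool (even (m + 1))) * q3 ^ (1 + of_bool (odd (m + 1))) * (Pp (m + 1))\<^sup>2)"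
      unfolding Pp_recurrence by simp
    also have "(Pp (m + 1))\<^sup>2 = (p (m + 1))\<^sup>2"
      unfolding p_eq using sg_facts(2)[of "m + 1"] by (simp add: power2_eq_square)
    finally have "smult 4 (A * p (m + 2) - B * Y) = smult 4 C" unfolding C by (simp add: numeral_poly)
    from arg_cong[OF this, of "smult (1 / 4)"] show ?thesis unfolding smult_smult by simp
  qed
  have nz: "p k \<noteq> 0" for k by (rule p_p_tilde_degree(3))
  have dq: "degree q0 = 1" "degree q1 = 1" "degree q2 = 1" "degree q3 = 1"
    by (simp_all add: q0_def q1_def q2_def q3_def)
  have lq: "lead_coeff q1 = 1" "lead_coeff q2 = 2" "lead_coeff q3 = 1 / 2"
    by (simp_all add: q1_def q2_def q3_def)
  \<comment> \<open>With \<open>a\<close> the degree of \<open>p m\<close>, the degree of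
    \<open>Y\<close> will be (2a + 2m + 5) - (a + 2m + 3) = a + 2, the degree of
    \<open>A\<close>.\<close>
  define a where "a = m * (m + 1) div 2"
  have a1: "(m + 1) * (m + 1 + 1) div 2 = a + m + 1"
  proof -
    have "(m + 1) * (m + 1 + 1) = m * (m + 1) + (m + 1) * 2" by (simp add: algebra_simps)
    then show ?thesis unfolding a_def by simp
  qed
  have a2: "(m + 2) * (m + 2 + 1) div 2 = a + 2 * m + 3"
  proof -
    have "(m + 2) * (m + 2 + 1) = m * (m + 1) + (2 * m + 3) * 2" by (simp add: algebra_simps)
    then show ?thesis unfolding a_def by simp
  qed
  note dp = p_p_tilde_degree(1)[of m, folded a_def] p_p_tilde_degree(1)[of "m + 1", unfolded a1] p_p_tilde_degree(1)[of "m + 2", unfolded a2]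
  have dA: "degree A = a + 2"
    unfolding A using nz[of m] by (simp add: degree_mult_eq degree_power_eq dq dp)
  have dB: "degree B = a + 2 * m + 3"
  proof -
    have d: "degree (p_tilde (m + 1)) = a + m + 1" using p_p_tilde_degree(4)[of "m + 1"] unfolding a1 .
    then have "p_tilde (m + 1) \<noteq> 0" by auto
    then have "degree B = degree (q0 ^ (m + 2)) + degree (p_tilde (m + 1))"
      unfolding B by (intro degree_mult_eq) simp_all
    then show ?thesis unfolding d degree_power_eq[OF q_nonzero(1)] dq by simp
  qed
  have A0: "A \<noteq> 0" unfolding A using nz[of m] by simp
  have dX: "degree (A * p (m + 2)) = 2 * a + 2 * m + 5"
    unfolding degree_mult_eq[OF A0 nz] dA dp by simp
  have dC: "degree C = 2 * a + 2 * m + 5"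
  proof -
    have "degree (q2 ^ (1 + of_bool (even (m + 1)))) = 1 + of_bool (even (m + 1))"
      "degree (q3 ^ (1 + of_bool (odd (m + 1)))) = 1 + of_bool (odd (m + 1))"
      by (simp_all only: degree_power_eq q_nonzero dq mult_1_left mult_1_right not_False_eq_True)
    moreover have "degree ((p (m + 1))\<^sup>2) = 2 * (a + m + 1)"
      unfolding degree_power_eq[OF nz] dp by simp
    moreover have "degree C = degree (q2 ^ (1 + of_bool (even (m + 1)))) +
        degree (q3 ^ (1 + of_bool (odd (m + 1)))) + degree ((p (m + 1))\<^sup>2)"
      unfolding C using nz[of "m + 1"] by (simp only: degree_mult_eq power_not_zero q_nonzero mult_eq_0_iff not_False_eq_True simp_thms)
    ultimately show ?thesis by (cases "even m") simp_all
  qed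
  have "\<bar>lead_coeff (A * p (m + 2))\<bar> = lead_abs m * lead_abs (m + 2)"
    unfolding A lead_coeff_mult lead_coeff_power lq abs_mult p_p_tilde_degree(2) by simp
  moreover have "\<bar>lead_coeff C\<bar> = 2 ^ (1 + of_bool (even (m + 1))) * (1/2) ^ (1 + of_bool (odd (m + 1))) * (lead_abs (m + 1))\<^sup>2"
    unfolding C lead_coeff_mult lead_coeff_power lq abs_mult power_abs p_p_tilde_degree(2) by simp
  ultimately have "lead_coeff (A * p (m + 2)) \<noteq> lead_coeff C" using lead_abs_neq[of m] by metis
  moreover have BY: "B * Y = A * p (m + 2) - C" using eq by (simp add: algebra_simps)
  ultimately have "coeff (B * Y) (2 * a + 2 * m + 5) \<noteq> 0" unfolding dX dC by simp
  then have "2 * a + 2 * m + 5 \<le> degree (B * Y)" "B * Y \<noteq> 0" by (auto intro: le_degree)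
  moreover have "degree (B * Y) \<le> 2 * a + 2 * m + 5"
    unfolding BY using dX dC by (intro degree_diff_le) (simp_all only: order_refl)
  ultimately have "degree B + degree Y = 2 * a + 2 * m + 5" by (auto simp: degree_mult_eq)
  then have "degree Y = degree A" unfolding dA dB by linarith
  moreover have "n + 1 = m + 2" using n by simp
  ultimately show ?thesis using eq by metis
qed

end
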